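(* Fix an integer $k\ge2$ and let $\alpha(n)=\operatorname{polylog}(n)$ with $\alpha(n)=\omega(1)$. Let $\mathcal{A}^{\mathrm{decide}}$ be an algorithm that solves the planted decision $k\text{-OV}^\alpha$ problem with success probability $1-\delta(n)$ in time $T(n)$. Then there exists an algorithm $\mathcal{A}^{\mathrm{search}}$ that solves the planted search $k\text{-OV}^\alpha$ problem with success probability at least $1-k\lceil\log n\rceil\cdot\delta(n)$ in expected time $\widetilde{O}(T(n)+n)$.
   Context: Let $d=\alpha(n)\log_2 n$ and $p=\left(1-2^{-2k/\alpha(n)}\right)^{1/k}$ ($n$ large enough that $p\le1/2$). Vectors $u_1,\dots,u_k\in\{0,1\}^d$ are orthogonal if for every $j\in[d]$, $\prod_{\ell}u_\ell[j]=0$. A $k$-OV instance is a tuple of matrices $U_1,\dots,U_k\in\{0,1\}^{n\times d}$, $U_{\ell,i}$ the $i$-th row of $U_\ell$. The model distribution $k\text{-OV}_0^\alpha(n)$ samples all entries independently, each $1$ with probability $p$. $\mathsf{Plant}(U_1,\dots,U_k,s_1,\dots,s_k)$: for each coordinate $j\in[d]$ independently, let $m$ be the number of ones among $U_{1,s_1}[j],\dots,U_{k,s_k}[j]$; if $k-m$ is even, flip $U_{k,s_k}[j]$ with probability $(p/(1-p))^{k-m}$; return the instance. The planted distribution $k\text{-OV}_1^\alpha(n)$ samples from $k\text{-OV}_0^\alpha(n)$, picks $(s_1,\dots,s_k)$ uniformly in $[n]^k$, and applies $\mathsf{Plant}$. An algorithm $\mathcal{A}$ outputting a bit solves the planted decision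 $k\text{-OV}^\alpha$ problem with success probability $\delta(n)$ if for both $b\in\{0,1\}$ and all large enough $n$, $\Pr_{U\sim k\text{-OV}_b^\alpha(n)}[\mathcal{A}(U)=b]\ge\delta(n)$ (over the instance and $\mathcal{A}$'s coins). An algorithm $\mathcal{A}$ outputting $(s_1,\dots,s_k)\in[n]^k$ solves the planted search $k\text{-OV}^\alpha$ problem with success probability $\delta(n)$ if for large enough $n$, $\Pr_{U\sim k\text{-OV}_1^\alpha(n)}[U_{1,s_1},\dots,U_{k,s_k}\text{ are orthogonal}]\ge\delta(n)$ where $(s_1,\dots,s_k)=\mathcal{A}(U)$ (over the instance and $\mathcal{A}$'s coins). *)

theory Defs
  imports
    "HOL-Probability.Probability"
    "HOL-Library.Discrete_Functions"
    "HOL-Library.Landau_Symbols"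
begin

section \<open>The model of computation: a randomized RAM with logarithmic cost\<close>

text \<open>
  Programs work on finitely many zero-initialized arrays of natural numbers (array names are part
  of the program text) and can flip fair coins. Every operation is charged the bit lengths of the
  numbers it touches, addresses included, so that unit-cost arithmetic on long numbers cannot be
  exploited. Up to polylogarithmic factors this is the same notion of time as on a word RAM with
  words of logarithmic length.

  The entry probability \<open>p\<close> is in general irrational and cannot be sampled with fair coins by an
  algorithm that does not know it. As usual for real parameters it is given by its binary
  expansion: \<^emph>\<open>Digit e\<close> reads one digit, and reading the digit with index \<open>i\<close> costs \<open>i + 1\<close>.
\<close>

datatype binop = Plus | Minus | Times | Div

datatype exp =
    Const nat
  | Read nat exp
  | Digit exp
  | Bin binop exp exp

datatype com =
    Skip
  | Assign nat exp exp
  | Flip nat exp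
  | Clear nat
  | Seq com com
  | If exp com com
  | While exp com

type_synonym mem = "nat \<Rightarrow> nat \<Rightarrow> nat"

type_synonym config = "mem \<times> nat"  \<comment> \<open>memory and time spent so far\<close>

definition bits :: "nat \<Rightarrow> nat" where
  "bits x = Suc (floor_log x)"

text \<open>Subtraction is truncated at 0; division by 0 yields 0.\<close>

fun binval :: "binop \<Rightarrow> nat \<Rightarrow> nat \<Rightarrow> nat" where
  "binval Plus x y = x + y"
| "binval Minus x y = x - y"
| "binval Times x y = x * y"
| "binval Div x y = x div y"

primrec val :: "(nat \<Rightarrow> nat) \<Rightarrow> mem \<Rightarrow> exp \<Rightarrow> nat" where
  "val w m (Const c) = c"
| "val w m (Read a e) = m a (val w m e)"
| "val w m (Digit e) = w (val w m e)"
| "val w m (Bin f e1 e2) = binval f (val w m e1) (val w m e2)"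

primrec ecost :: "(nat \<Rightarrow> nat) \<Rightarrow> mem \<Rightarrow> exp \<Rightarrow> nat" where
  "ecost w m (Const c) = bits c"
| "ecost w m (Read a e) = ecost w m e + bits (val w m e) + bits (m a (val w m e))"
| "ecost w m (Digit e) = ecost w m e + val w m e + 1"
| "ecost w m (Bin f e1 e2) =
     ecost w m e1 + ecost w m e2 + bits (val w m e1) + bits (val w m e2)"

definition store :: "mem \<Rightarrow> nat \<Rightarrow> nat \<Rightarrow> nat \<Rightarrow> mem" where
  "store m a i x = m(a := (m a)(i := x))"

text \<open>Diverging runs of a loop show up as missing probability mass.\<close>

partial_function (spmf) while_spmf :: "('s \<Rightarrow> bool) \<Rightarrow> ('s \<Rightarrow> 's spmf) \<Rightarrow> 's \<Rightarrow> 's spmf" where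
  "while_spmf b f s = (if b s then bind_spmf (f s) (while_spmf b f) else return_spmf s)"

text \<open>Evaluating the test of a conditional or loop; conditions are true iff they are nonzero.\<close>

definition charge :: "(nat \<Rightarrow> nat) \<Rightarrow> exp \<Rightarrow> config \<Rightarrow> config" where
  "charge w e = (\<lambda>(m, t). (m, t + ecost w m e + bits (val w m e)))"

text \<open>
  \<^emph>\<open>Clear a\<close> replaces the array \<open>a\<close> by a new all-zero array. Version stamps on the cells
  implement this with constant overhead on a machine that can only overwrite single cells.
\<close>

primrec exec :: "(nat \<Rightarrow> nat) \<Rightarrow> com \<Rightarrow> config \<Rightarrow> config spmf" where
  "exec w Skip = (\<lambda>(m, t). return_spmf (m, t + 1))"
| "exec w (Assign a e1 e2) = (\<lambda>(m, t).
     return_spmf (store m a (val w m e1) (val w m e2),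
       t + ecost w m e1 + ecost w m e2 + bits (val w m e1) + bits (val w m e2)))"
| "exec w (Flip a e) = (\<lambda>(m, t).
     map_spmf (\<lambda>c. (store m a (val w m e) (of_bool c), t + ecost w m e + bits (val w m e) + 1))
       coin_spmf)"
| "exec w (Clear a) = (\<lambda>(m, t). return_spmf (m(a := (\<lambda>_. 0)), t + 1))"
| "exec w (Seq c1 c2) = (\<lambda>\<sigma>. bind_spmf (exec w c1 \<sigma>) (exec w c2))"
| "exec w (If e c1 c2) = (\<lambda>\<sigma>.
     if val w (fst \<sigma>) e \<noteq> 0 then exec w c1 (charge w e \<sigma>) else exec w c2 (charge w e \<sigma>))"
| "exec w (While e c) = (\<lambda>\<sigma>.
     map_spmf (charge w e)
       (while_spmf (\<lambda>\<sigma>. val w (fst \<sigma>) e \<noteq> 0) (\<lambda>\<sigma>. exec w c (charge w e \<sigma>)) \<sigma>))"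

definition expected_time :: "config spmf \<Rightarrow> ennreal" where
  "expected_time P =
     (if lossless_spmf P then \<integral>\<^sup>+\<sigma>. of_nat (snd \<sigma>) \<partial>measure_spmf P else \<infinity>)"


section \<open>The planted orthogonal vectors problem\<close>

text \<open>
  \<open>U (l, i, j)\<close> is the entry in row \<open>i\<close> and column \<open>j\<close> of the matrix with index \<open>l\<close>. All indices
  are 0-based: \<open>l < k\<close>, \<open>i < n\<close>, \<open>j < d\<close>.
\<close>

type_synonym kov = "nat \<times> nat \<times> nat \<Rightarrow> bool"

text \<open>\<open>\<alpha> n * log 2 n\<close> need not be an integer and is rounded up.\<close>

definition ov_dim :: "(nat \<Rightarrow> real) \<Rightarrow> nat \<Rightarrow> nat" where
  "ov_dim \<alpha> n = nat \<lceil>\<alpha> n * log 2 (real n)\<rceil>"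

definition ov_prob :: "nat \<Rightarrow> (nat \<Rightarrow> real) \<Rightarrow> nat \<Rightarrow> real" where
  "ov_prob k \<alpha> n = (1 - 2 powr (- 2 * real k / \<alpha> n)) powr (1 / real k)"

definition orthogonal_rows :: "nat \<Rightarrow> nat \<Rightarrow> kov \<Rightarrow> (nat \<Rightarrow> nat) \<Rightarrow> bool" where
  "orthogonal_rows k d U s \<longleftrightarrow> (\<forall>j<d. (\<Prod>l<k. of_bool (U (l, s l, j)) :: nat) = 0)"

definition model_kov :: "nat \<Rightarrow> (nat \<Rightarrow> real) \<Rightarrow> nat \<Rightarrow> kov pmf" where
  "model_kov k \<alpha> n =
     Pi_pmf ({..<k} \<times> {..<n} \<times> {..<ov_dim \<alpha> n}) False (\<lambda>_. bernoulli_pmf (ov_prob k \<alpha> n))"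

definition plant :: "nat \<Rightarrow> real \<Rightarrow> nat \<Rightarrow> kov \<Rightarrow> (nat \<Rightarrow> nat) \<Rightarrow> kov pmf" where
  "plant k p d U s =
     map_pmf
       (\<lambda>flip (l, i, j).
          if l = k - 1 \<and> i = s (k - 1) \<and> j < d \<and> flip j then \<not> U (l, i, j) else U (l, i, j))
       (Pi_pmf {..<d} False (\<lambda>j.
          let m = card {l. l < k \<and> U (l, s l, j)} in
          if even (k - m) then bernoulli_pmf ((p / (1 - p)) ^ (k - m)) else return_pmf False))"

definition planted_kov :: "nat \<Rightarrow> (nat \<Rightarrow> real) \<Rightarrow> nat \<Rightarrow> kov pmf" where
  "planted_kov k \<alpha> n =
     bind_pmf (model_kov k \<alpha> n) (\<lambda>U.
     bind_pmf (pmf_of_set (PiE {..<k} (\<lambda>_. {..<n}))) (\<lambda>s.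
       plant k (ov_prob k \<alpha> n) (ov_dim \<alpha> n) U s))"

definition kov :: "bool \<Rightarrow> nat \<Rightarrow> (nat \<Rightarrow> real) \<Rightarrow> nat \<Rightarrow> kov pmf" where
  "kov b k \<alpha> n = (if b then planted_kov k \<alpha> n else model_kov k \<alpha> n)"


section \<open>Algorithms for the problem\<close>

text \<open>\<open>binary_digit p 0\<close> is the first digit after the binary point.\<close>

definition binary_digit :: "real \<Rightarrow> nat \<Rightarrow> nat" where
  "binary_digit p i = nat (\<lfloor>2 ^ (i + 1) * p\<rfloor> mod 2)"

text \<open>
  Array 0 holds \<open>n\<close> and \<open>d\<close>, array 1 holds the matrices one after the other in row-major order,
  and all other cells are zero. The output is read from array 2.
\<close>

definition ov_input :: "nat \<Rightarrow> nat \<Rightarrow> nat \<Rightarrow> kov \<Rightarrow> mem" where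
  "ov_input k n d U =
     (\<lambda>_ _. 0)
       (0 := (\<lambda>_. 0)(0 := n, 1 := d),
        1 := (\<lambda>c. if c < k * n * d
                    then of_bool (U (c div (n * d), c div d mod n, c mod d)) else 0))"

definition ov_output :: "config \<Rightarrow> nat \<Rightarrow> nat" where
  "ov_output \<sigma> = fst \<sigma> 2"

definition run :: "nat \<Rightarrow> (nat \<Rightarrow> real) \<Rightarrow> com \<Rightarrow> nat \<Rightarrow> kov \<Rightarrow> config spmf" where
  "run k \<alpha> A n U =
     exec (binary_digit (ov_prob k \<alpha> n)) A (ov_input k n (ov_dim \<alpha> n) U, 0)"

definition solves_decision ::
    "nat \<Rightarrow> (nat \<Rightarrow> real) \<Rightarrow> com \<Rightarrow> (nat \<Rightarrow> real) \<Rightarrow> bool" where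
  "solves_decision k \<alpha> A \<epsilon> \<longleftrightarrow>
     (\<forall>b. \<forall>\<^sub>F n in sequentially.
        spmf (bind_spmf (spmf_of_pmf (kov b k \<alpha> n)) (\<lambda>U.
                map_spmf (\<lambda>\<sigma>. ov_output \<sigma> 0 = of_bool b) (run k \<alpha> A n U))) True
          \<ge> \<epsilon> n)"

definition solves_search ::
    "nat \<Rightarrow> (nat \<Rightarrow> real) \<Rightarrow> com \<Rightarrow> (nat \<Rightarrow> real) \<Rightarrow> bool" where
  "solves_search k \<alpha> A \<epsilon> \<longleftrightarrow>
     (\<forall>\<^sub>F n in sequentially.
        spmf (bind_spmf (spmf_of_pmf (planted_kov k \<alpha> n)) (\<lambda>U.
                map_spmf (\<lambda>\<sigma>. (\<forall>l<k. ov_output \<sigma> l < n) \<and>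
                               orthogonal_rows k (ov_dim \<alpha> n) U (ov_output \<sigma>))
                  (run k \<alpha> A n U))) True
          \<ge> \<epsilon> n)"

text \<open>Time bounds hold for every instance, not only on average over the distributions above.\<close>

definition runs_in_time :: "nat \<Rightarrow> (nat \<Rightarrow> real) \<Rightarrow> com \<Rightarrow> (nat \<Rightarrow> nat) \<Rightarrow> bool" where
  "runs_in_time k \<alpha> A T \<longleftrightarrow>
     (\<forall>\<^sub>F n in sequentially. \<forall>U.
        lossless_spmf (run k \<alpha> A n U) \<and> (\<forall>\<sigma>\<in>set_spmf (run k \<alpha> A n U). snd \<sigma> \<le> T n))"

definition runs_in_expected_time :: "nat \<Rightarrow> (nat \<Rightarrow> real) \<Rightarrow> com \<Rightarrow> (nat \<Rightarrow> real) \<Rightarrow> bool" where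
  "runs_in_expected_time k \<alpha> A T \<longleftrightarrow>
     (\<forall>\<^sub>F n in sequentially. \<forall>U. expected_time (run k \<alpha> A n U) \<le> ennreal (T n))"

definition soft_O :: "(nat \<Rightarrow> real) \<Rightarrow> (nat \<Rightarrow> real) set" where
  "soft_O f = (\<Union>c. O(\<lambda>n. f n * ln (real n) ^ c))"

definition polylog :: "(nat \<Rightarrow> real) \<Rightarrow> bool" where
  "polylog f \<longleftrightarrow> (\<exists>c. f \<in> O(\<lambda>n. ln (real n) ^ c))"

end

theory Submission
  imports Defs
begin

text \<open>
  For every matrix \<open>l < k\<close> and every bit position of row indices, the search algorithm tosses a
  coin \<open>c\<close>, resamples all rows of matrix \<open>l\<close> whose index differs from \<open>c\<close> in that bit, and runs
  the decision algorithm. If the planted row \<open>s l\<close> is not touched, the new instance is again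
  planted at \<open>s\<close>. If it is touched, the new instance follows the model distribution, because any
  \<open>k - 1\<close> of the \<open>k\<close> planted rows are independent. Hence the answer reveals the bit of \<open>s l\<close>.
  Thanks to the coin, exactly half of the error comes from each of the two distributions for every
  \<open>s\<close>, so one query errs with probability at most \<open>\<delta>\<close>. The queries do not depend on each
  other's answers, so the union bound over the \<open>k \<lceil>log n\<rceil>\<close> queries applies directly.

  Error probability and running time are bounded together by an expected-runtime calculus: a bound
  of the form \<open>r * error + time\<close> for all \<open>r\<close> yields both.
\<close>

text \<open>The coin resolves a mismatch of guarantees: the planted error is bounded only on average
  over \<open>s\<close>, not for each single \<open>s\<close>. A query that always resampled the
  rows whose bit is 1 would charge the planted error to the \<open>s\<close> with bit 0 and the
  model error to the others. If the planted error is concentrated on bit 0, the average of the two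
  can exceed \<delta>. With the coin, every \<open>s\<close> is charged half of each error, and
  averaging over \<open>s\<close> gives at most \<delta>. The running time is only an expectation
  because bits of bias \<open>p\<close> have to be made from fair coins and the digits of
  \<open>p\<close>, which takes an unbounded number of tosses; every other loop has a fixed number
  of iterations apart from those inside the decision program. The latter may overwrite its input and
  leave anything behind, so it is confined to arrays of its own, which are cleared and refilled from
  a saved copy before each query. As cost is logarithmic, the search also has to pay for the length
  of the answer it reads, and this length needs a bound.\<close>

section \<open>Expectations over possibly diverging runs\<close>

text \<open>Divergence counts as \<open>\<infinity>\<close>, so a finite bound includes termination with probability 1.\<close>

definition expc :: "('a \<Rightarrow> ennreal) \<Rightarrow> 'a spmf \<Rightarrow> ennreal" where
  "expc f P = (\<integral>\<^sup>+x. (case x of None \<Rightarrow> \<infinity> | Some \<sigma> \<Rightarrow> f \<sigma>) \<partial>measure_pmf P)"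

lemma expc_return [simp]: "expc f (return_spmf x) = f x"
  by (simp add: expc_def)

lemma expc_bind: "expc f (bind_spmf P h) = expc (\<lambda>x. expc f (h x)) P"
  unfolding expc_def bind_spmf_def
  by (auto intro!: nn_integral_cong split: option.split)

lemma expc_map: "expc f (map_spmf h P) = expc (\<lambda>x. f (h x)) P"
  unfolding expc_def by (auto intro!: nn_integral_cong split: option.split)

lemma expc_mono: "(\<And>x. x \<in> set_spmf P \<Longrightarrow> f x \<le> g x) \<Longrightarrow> expc f P \<le> expc g P"
  unfolding expc_def
  by (intro nn_integral_mono_AE) (auto simp: AE_measure_pmf_iff in_set_spmf split: option.split)

text \<open>Exact even for runs that may diverge, because \<infinity> absorbs \<open>c\<close>. An
  integral over \<open>measure_spmf\<close> would weight \<open>c\<close> by the probability of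
  termination, and costs could not simply be added up.\<close>

lemma expc_add_const: "expc (\<lambda>x. f x + c) P = expc f P + c"
proof -
  have "expc (\<lambda>x. f x + c) P = (\<integral>\<^sup>+x. (case x of None \<Rightarrow> \<infinity> | Some \<sigma> \<Rightarrow> f \<sigma>) + c \<partial>measure_pmf P)"
    unfolding expc_def by (auto intro!: nn_integral_cong split: option.split)
  also have "\<dots> = expc f P + c"
    by (simp add: nn_integral_add expc_def)
  finally show ?thesis .
qed

lemma expc_spmf_of_pmf: "expc f (spmf_of_pmf P) = (\<integral>\<^sup>+x. f x \<partial>measure_pmf P)"
  by (simp add: expc_def spmf_of_pmf_def)

lemma expc_coin: "expc f coin_spmf = (f True + f False) / 2"
  by (simp add: expc_def spmf_of_set_def spmf_of_pmf_def nn_integral_pmf_of_set UNIV_bool add.commute)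

lemma expc_finite_imp_lossless: "expc f P < \<infinity> \<Longrightarrow> lossless_spmf P"
proof (rule ccontr)
  assume *: "expc f P < \<infinity>" "\<not> lossless_spmf P"
  then have "None \<in> set_pmf P" by (simp add: lossless_iff_set_pmf_None)
  moreover have "AE x in measure_pmf P. (case x of None \<Rightarrow> \<infinity> | Some \<sigma> \<Rightarrow> f \<sigma>) \<noteq> \<infinity>"
    using * unfolding expc_def by (intro nn_integral_PInf_AE) (auto simp: less_top)
  ultimately show False by (auto simp: AE_measure_pmf_iff)
qed

lemma expc_lossless: "lossless_spmf P \<Longrightarrow> expc f P = (\<integral>\<^sup>+x. f x \<partial>measure_spmf P)"
proof -
  assume "lossless_spmf P"
  then obtain p where P: "P = spmf_of_pmf p"
    by (metis lossless_spmf_conv_spmf_of_pmf)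
  show ?thesis by (simp add: P expc_spmf_of_pmf)
qed

text \<open>The limit of the chain has countable support, so all integrals are sums over one
  countable set and monotone convergence applies, although the chain need not be a sequence.\<close>

lemma nn_integral_lub_spmf:
  assumes "Complete_Partial_Order.chain (ord_spmf (=)) Y" "Y \<noteq> {}"
  shows "(\<integral>\<^sup>+x. f x \<partial>measure_spmf (lub_spmf Y)) = (SUP p\<in>Y. \<integral>\<^sup>+x. f x \<partial>measure_spmf p)"
proof -
  let ?M = "count_space (set_spmf (lub_spmf Y))"
  have "(\<integral>\<^sup>+x. f x \<partial>measure_spmf (lub_spmf Y)) = (\<integral>\<^sup>+x. (SUP p\<in>Y. ennreal (spmf p x) * f x) \<partial>?M)"
    using assms
    by (auto simp: nn_integral_measure_spmf' ennreal_spmf_lub_spmf SUP_mult_right_ennreal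
        intro!: nn_integral_cong)
  also have "\<dots> = (SUP p\<in>Y. \<integral>\<^sup>+x. ennreal (spmf p x) * f x \<partial>?M)"
  proof (rule nn_integral_monotone_convergence_SUP_countable)
    show "Complete_Partial_Order.chain (\<le>) ((\<lambda>p x. ennreal (spmf p x) * f x) ` Y)"
    proof (rule chainI, safe)
      fix p q assume "p \<in> Y" "q \<in> Y"
      then have "ord_spmf (=) p q \<or> ord_spmf (=) q p" using assms(1) by (blast dest: chainD)
      then show "(\<lambda>x. ennreal (spmf p x) * f x) \<le> (\<lambda>x. ennreal (spmf q x) * f x)"
        if "\<not> (\<lambda>x. ennreal (spmf q x) * f x) \<le> (\<lambda>x. ennreal (spmf p x) * f x)"
        using that by (auto simp: le_fun_def intro!: mult_right_mono ennreal_leI dest: ord_spmf_eq_leD)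
    qed
  qed (use assms in auto)
  also have "\<dots> = (SUP p\<in>Y. \<integral>\<^sup>+x. f x \<partial>measure_spmf p)"
    using assms
  proof (intro SUP_cong refl, subst nn_integral_measure_spmf, subst nn_integral_count_space_indicator)
    fix p assume p: "p \<in> Y"
    show "(\<integral>\<^sup>+x. ennreal (spmf p x) * f x * indicator (set_spmf (lub_spmf Y)) x \<partial>count_space UNIV) =
        (\<integral>\<^sup>+x. ennreal (spmf p x) * f x \<partial>count_space UNIV)"
    proof (intro nn_integral_cong)
      fix x
      show "ennreal (spmf p x) * f x * indicator (set_spmf (lub_spmf Y)) x = ennreal (spmf p x) * f x"
        using p assms(1)
        by (cases "x \<in> set_spmf p") (auto simp: set_lub_spmf spmf_eq_0_set_spmf indicator_def)
    qed
  qed simp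
  finally show ?thesis .
qed

text \<open>Upper bounds pass to limits when divergence counts as 0. For \<open>expc\<close> a
  finite bound would already fail at the bottom element; hence loops are first bounded over
  \<open>measure_spmf\<close>, and their termination is shown separately.\<close>

lemma admissible_nn_integral_spmf_le:
  "ccpo.admissible lub_spmf (ord_spmf (=)) (\<lambda>p. (\<integral>\<^sup>+x. f x \<partial>measure_spmf p) \<le> c)"
  by (rule ccpo.admissibleI) (simp add: nn_integral_lub_spmf SUP_le_iff)

lemma admissible_set_spmf:
  "ccpo.admissible lub_spmf (ord_spmf (=)) (\<lambda>p. \<forall>x\<in>set_spmf p. Q x)"
  by (rule ccpo.admissibleI) (auto simp: set_lub_spmf)

text \<open>A supermartingale argument: \<open>J\<close> does not grow in expectation during an
  iteration and dominates \<open>F\<close> on exit. Diverging runs contribute nothing.\<close>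

lemma while_spmf_nn_integral_le:
  assumes step: "\<And>s. b s \<Longrightarrow> (\<integral>\<^sup>+s'. J s' \<partial>measure_spmf (f s)) \<le> J s"
    and exit: "\<And>s. \<not> b s \<Longrightarrow> F s \<le> J s"
  shows "(\<integral>\<^sup>+s'. F s' \<partial>measure_spmf (while_spmf b f s)) \<le> J s"
proof -
  have "\<forall>s. (\<integral>\<^sup>+s'. F s' \<partial>measure_spmf (while_spmf b f s)) \<le> J s"
  proof (induction rule: while_spmf.fixp_induct)
    case 1
    show ?case
      unfolding curry_def
      by (intro admissible_all admissible_subst[OF admissible_nn_integral_spmf_le]) (intro cont_intro)
  next
    case 2
    then show ?case by simp
  next
    case (3 W)
    show ?case
    proof
      fix s
      have "(\<integral>\<^sup>+s'. F s' \<partial>measure_spmf (f s \<bind> W b f)) \<le> J s" if "b s"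
      proof -
        have "(\<integral>\<^sup>+s'. F s' \<partial>measure_spmf (f s \<bind> W b f)) =
            (\<integral>\<^sup>+x. (\<integral>\<^sup>+s'. F s' \<partial>measure_spmf (W b f x)) \<partial>measure_spmf (f s))"
          by (simp add: measure_spmf_bind nn_integral_bind[where B="count_space UNIV"] space_subprob_algebra)
        also have "\<dots> \<le> (\<integral>\<^sup>+x. J x \<partial>measure_spmf (f s))"
          using 3 by (intro nn_integral_mono) auto
        also have "\<dots> \<le> J s" by (rule step[OF that])
        finally show ?thesis .
      qed
      then show "(\<integral>\<^sup>+s'. F s' \<partial>measure_spmf (if b s then f s \<bind> W b f else return_spmf s)) \<le> J s"
        using exit by (auto simp: measure_spmf_return_spmf nn_integral_return)
    qed
  qed
  then show ?thesis by blast
qed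

lemma set_while_spmf:
  assumes step: "\<And>s s'. b s \<Longrightarrow> s' \<in> set_spmf (f s) \<Longrightarrow> R s s'"
    and refl: "\<And>s. R s s" and trans: "\<And>x y z. R x y \<Longrightarrow> R y z \<Longrightarrow> R x z"
  shows "\<forall>s'\<in>set_spmf (while_spmf b f s). R s s'"
proof -
  have "\<forall>s. \<forall>s'\<in>set_spmf (while_spmf b f s). R s s'"
  proof (induction rule: while_spmf.fixp_induct)
    case 1
    show ?case
      unfolding curry_def
      by (intro admissible_all admissible_subst[OF admissible_set_spmf]) (intro cont_intro)
  next
    case 2
    then show ?case by simp
  next
    case (3 W)
    then show ?case
      by (auto simp: set_bind_spmf refl) (meson step trans)
  qed
  then show ?thesis by blast
qed

text \<open>
  \<open>J\<close> bounds the expected final value of the clock \<open>t\<close>, and \<open>i\<close> iterations advance the clock by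
  at least \<open>i\<close>; so not having stopped after \<open>i\<close> iterations has probability at most \<open>J s / i\<close>.
\<close>

lemma while_spmf_lossless:
  fixes t :: "'s \<Rightarrow> nat"
  assumes step: "\<And>s. b s \<Longrightarrow> expc J (f s) \<le> J s"
    and time: "\<And>s s'. b s \<Longrightarrow> s' \<in> set_spmf (f s) \<Longrightarrow> t s < t s'"
    and ge: "\<And>s. of_nat (t s) \<le> J s" and fin: "J s < \<infinity>"
  shows "lossless_spmf (while_spmf b f s)"
proof -
  define W where "W s = ennreal (pmf (while_spmf b f s) None)" for s
  have W_le1: "W s \<le> 1" for s by (simp add: W_def pmf_le_1)
  have W_expc: "W s = (\<integral>\<^sup>+x. (case x of None \<Rightarrow> 1 | Some s' \<Rightarrow> W s') \<partial>measure_pmf (f s))" if "b s" for s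
  proof -
    have "while_spmf b f s = bind_spmf (f s) (while_spmf b f)"
      using that by (subst while_spmf.simps) simp
    then show ?thesis
      unfolding W_def bind_spmf_def
      by (simp add: ennreal_pmf_bind) (auto intro!: nn_integral_cong split: option.split)
  qed
  \<comment> \<open>The offset \<open>i\<close> is what makes the induction work: one iteration
    raises \<open>t\<close> by at least 1 and so pays for one unit of \<open>i\<close>.\<close>
  have "W s * of_nat (t s + i) \<le> J s" for i s
  proof (induction i arbitrary: s)
    case 0
    have "W s * of_nat (t s) \<le> 1 * J s" by (intro mult_mono W_le1 ge) auto
    then show ?case by simp
  next
    case (Suc i)
    show ?case
    proof (cases "b s")
      case False
      then have "while_spmf b f s = return_spmf s" by (subst while_spmf.simps) simp
      then have "W s = 0" by (simp add: W_def)
      then show ?thesis by simp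
    next
      case True
      have "W s * of_nat (t s + Suc i) =
         (\<integral>\<^sup>+x. (case x of None \<Rightarrow> 1 | Some s' \<Rightarrow> W s') * of_nat (t s + Suc i) \<partial>measure_pmf (f s))"
        by (subst W_expc[OF True]) (simp add: nn_integral_multc)
      also have "\<dots> \<le> expc J (f s)"
        unfolding expc_def
      proof (intro nn_integral_mono_AE, unfold AE_measure_pmf_iff, safe)
        fix x assume x: "x \<in> set_pmf (f s)"
        show "(case x of None \<Rightarrow> 1 | Some s' \<Rightarrow> W s') * of_nat (t s + Suc i)
            \<le> (case x of None \<Rightarrow> \<infinity> | Some s' \<Rightarrow> J s')"
        proof (cases x)
          case (Some s')
          then have "t s + Suc i \<le> t s' + i"
            using time[OF True, of s'] x by (auto simp: in_set_spmf)
          then have "W s' * of_nat (t s + Suc i) \<le> W s' * of_nat (t s' + i)"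
            by (intro mult_left_mono) (simp_all only: of_nat_le_iff zero_le)
          also have "\<dots> \<le> J s'" by (rule Suc.IH)
          finally show ?thesis using Some by simp
        qed simp
      qed
      also have "\<dots> \<le> J s" by (rule step[OF True])
      finally show ?thesis .
    qed
  qed
  then have *: "W s * of_nat i \<le> J s" for i
    using order_trans[of "W s * of_nat i" "W s * of_nat (t s + i)" "J s"]
    by (simp add: mult_left_mono)
  have "W s = 0"
  proof (rule ccontr)
    assume "W s \<noteq> 0"
    have "(SUP i. W s * of_nat i) \<le> J s" by (intro SUP_least *)
    moreover have "(SUP i. W s * of_nat i) = W s * (SUP i. of_nat i)"
      by (rule SUP_mult_left_ennreal[symmetric])
    ultimately show False using \<open>W s \<noteq> 0\<close> fin
      by (simp add: ennreal_SUP_of_nat_eq_top ennreal_mult_top)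
  qed
  then show ?thesis by (simp add: W_def lossless_iff_pmf_None)
qed

text \<open>A finite \<open>J s\<close> forces termination, so the bound over
  \<open>measure_spmf\<close> carries over to \<open>expc\<close>; for an infinite
  \<open>J s\<close> there is nothing to prove.\<close>

lemma expc_while_le:
  fixes t :: "'s \<Rightarrow> nat"
  assumes step: "\<And>s. b s \<Longrightarrow> expc J (f s) \<le> J s"
    and exit: "\<And>s. \<not> b s \<Longrightarrow> F s \<le> J s"
    and time: "\<And>s s'. b s \<Longrightarrow> s' \<in> set_spmf (f s) \<Longrightarrow> t s < t s'"
    and ge: "\<And>s. of_nat (t s) \<le> J s"
  shows "expc F (while_spmf b f s) \<le> J s"
proof (cases "J s < \<infinity>")
  case True
  have "(\<integral>\<^sup>+s'. J s' \<partial>measure_spmf (f s)) \<le> J s" if "b s" for s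
  proof (cases "J s < \<infinity>")
    case True
    then have "lossless_spmf (f s)"
      using step[OF that] by (intro expc_finite_imp_lossless[of J]) auto
    then show ?thesis using step[OF that] by (simp add: expc_lossless)
  qed (simp add: not_less top_unique)
  then have "(\<integral>\<^sup>+s'. F s' \<partial>measure_spmf (while_spmf b f s)) \<le> J s"
    by (rule while_spmf_nn_integral_le) (use exit in auto)
  then show ?thesis
    using while_spmf_lossless[of b J f t s, OF step time ge True] by (simp add: expc_lossless)
qed (simp add: not_less top_unique)

section \<open>Programs and the arrays they touch\<close>

primrec ereads :: "(nat \<Rightarrow> bool) \<Rightarrow> exp \<Rightarrow> bool" where
  "ereads P (Const c) = True"
| "ereads P (Read a e) = (P a \<and> ereads P e)"
| "ereads P (Digit e) = ereads P e"
| "ereads P (Bin f e1 e2) = (ereads P e1 \<and> ereads P e2)"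

primrec uses :: "(nat \<Rightarrow> bool) \<Rightarrow> com \<Rightarrow> bool" where
  "uses P Skip = True"
| "uses P (Assign a e1 e2) = (P a \<and> ereads P e1 \<and> ereads P e2)"
| "uses P (Flip a e) = (P a \<and> ereads P e)"
| "uses P (Clear a) = P a"
| "uses P (Seq c1 c2) = (uses P c1 \<and> uses P c2)"
| "uses P (If e c1 c2) = (ereads P e \<and> uses P c1 \<and> uses P c2)"
| "uses P (While e c) = (ereads P e \<and> uses P c)"

lemma ereads_mono: "ereads P e \<Longrightarrow> (\<And>a. P a \<Longrightarrow> Q a) \<Longrightarrow> ereads Q e"
  by (induction e) auto

lemma uses_mono: "uses P c \<Longrightarrow> (\<And>a. P a \<Longrightarrow> Q a) \<Longrightarrow> uses Q c"
  by (induction c) (auto intro: ereads_mono)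

lemma ereads_le: "ereads (\<lambda>a. a < N) e \<Longrightarrow> N \<le> M \<Longrightarrow> ereads (\<lambda>a. a < M) e"
  by (erule ereads_mono) simp

lemma uses_le: "uses (\<lambda>a. a < N) c \<Longrightarrow> N \<le> M \<Longrightarrow> uses (\<lambda>a. a < M) c"
  by (erule uses_mono) simp

lemma ereads_bounded: "\<exists>N. ereads (\<lambda>a. a < N) e"
proof (induction e)
  case (Read a e)
  then obtain N where N: "ereads (\<lambda>a. a < N) e" by blast
  show ?case by (intro exI[of _ "max N (Suc a)"]) (simp add: ereads_le[OF N])
next
  case (Bin f e1 e2)
  then obtain N M where N: "ereads (\<lambda>a. a < N) e1" and M: "ereads (\<lambda>a. a < M) e2" by blast
  show ?case by (intro exI[of _ "max N M"]) (simp add: ereads_le[OF N] ereads_le[OF M])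
qed auto

text \<open>Source of fresh arrays: a finite program text names only finitely many, so everything
  from \<open>N\<close> on is free for the search program.\<close>

lemma uses_bounded: "\<exists>N. uses (\<lambda>a. a < N) c"
proof (induction c)
  case (Assign a e1 e2)
  obtain N M where N: "ereads (\<lambda>a. a < N) e1" and M: "ereads (\<lambda>a. a < M) e2"
    using ereads_bounded by metis
  show ?case
    by (intro exI[of _ "max (Suc a) (max N M)"]) (simp add: ereads_le[OF N] ereads_le[OF M])
next
  case (Flip a e)
  obtain N where N: "ereads (\<lambda>a. a < N) e" using ereads_bounded by blast
  show ?case by (intro exI[of _ "max (Suc a) N"]) (simp add: ereads_le[OF N])
next
  case (Clear a)
  show ?case by (intro exI[of _ "Suc a"]) simp
next
  case (Seq c1 c2)
  then obtain N M where N: "uses (\<lambda>a. a < N) c1" and M: "uses (\<lambda>a. a < M) c2" by blast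
  show ?case by (intro exI[of _ "max N M"]) (simp add: uses_le[OF N] uses_le[OF M])
next
  case (If e c1 c2)
  then obtain N M where N: "uses (\<lambda>a. a < N) c1" and M: "uses (\<lambda>a. a < M) c2" by blast
  obtain K where K: "ereads (\<lambda>a. a < K) e" using ereads_bounded by blast
  show ?case
    by (intro exI[of _ "max K (max N M)"])
      (simp add: uses_le[OF N] uses_le[OF M] ereads_le[OF K] le_max_iff_disj)
next
  case (While e c)
  then obtain N where N: "uses (\<lambda>a. a < N) c" by blast
  obtain K where K: "ereads (\<lambda>a. a < K) e" using ereads_bounded by blast
  show ?case by (intro exI[of _ "max K N"]) (simp add: uses_le[OF N] ereads_le[OF K])
qed simp

text \<open>Both sides solve the same unfolding equation, and each comes from a least fixpoint.
  Fixpoint induction on either loop puts it below the other side; antisymmetry of the approximation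
  order concludes.\<close>

lemma while_spmf_simulation:
  assumes b: "\<And>s. b' (h s) = b s" and f: "\<And>s. f' (h s) = map_spmf h (f s)"
  shows "while_spmf b' f' (h s) = map_spmf h (while_spmf b f s)"
proof -
  define V where "V s = map_spmf h (while_spmf b f s)" for s
  have V: "V s = (if b s then bind_spmf (f s) V else return_spmf (h s))" for s
    unfolding V_def[abs_def] by (subst while_spmf.simps) (simp add: map_spmf_bind_spmf o_def)
  define V' where "V' s = while_spmf b' f' (h s)" for s
  have V': "V' s = (if b s then bind_spmf (f s) V' else return_spmf (h s))" for s
    unfolding V'_def[abs_def] by (subst while_spmf.simps) (simp add: b f bind_map_spmf o_def)
  have "\<forall>s. ord_spmf (=) (while_spmf b' f' (h s)) (V s)"
  proof (induction rule: while_spmf.fixp_induct)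
    case 1
    show ?case unfolding curry_def by (intro admissible_all) (intro cont_intro)
  next
    case 2
    then show ?case by simp
  next
    case (3 W)
    show ?case
    proof
      fix s
      show "ord_spmf (=) (if b' (h s) then f' (h s) \<bind> W b' f' else return_spmf (h s)) (V s)"
        using 3 by (subst V) (auto simp: b f bind_map_spmf o_def intro!: ord_spmf_bind_reflI)
    qed
  qed
  moreover have "\<forall>s. ord_spmf (=) (map_spmf h (while_spmf b f s)) (V' s)"
  proof (induction rule: while_spmf.fixp_induct)
    case 1
    show ?case unfolding curry_def by (intro admissible_all) (intro cont_intro)
  next
    case 2
    then show ?case by simp
  next
    case (3 W)
    show ?case
    proof
      fix s
      show "ord_spmf (=) (map_spmf h (if b s then f s \<bind> W b f else return_spmf s)) (V' s)"
        using 3 by (subst V') (auto simp: map_spmf_bind_spmf o_def intro!: ord_spmf_bind_reflI)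
    qed
  qed
  ultimately show ?thesis unfolding V_def V'_def by (meson spmf.leq_antisym)
qed

lemma val_frame:
  assumes "\<And>a. P a \<Longrightarrow> m' a = m a" "ereads P e"
  shows "val w m' e = val w m e" "ecost w m' e = ecost w m e"
  using assms(2)
  by (induction e) (auto simp: assms(1))

text \<open>\<open>H\<close> is abstract so that one induction serves two purposes: the identity
  gives shifts of the clock, and embedding into a larger memory shows that a run neither sees nor
  changes foreign arrays.\<close>

lemma exec_frame:
  assumes H: "\<And>m a. P a \<Longrightarrow> H m a = m a"
    and upd: "\<And>m a f. P a \<Longrightarrow> H (m(a := f)) = (H m)(a := f)"
    and c: "uses P c"
  shows "exec w c (H m, s + t) = map_spmf (\<lambda>(m, t). (H m, s + t)) (exec w c (m, t))"
  using c
proof (induction c arbitrary: m t)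
  case Skip
  then show ?case by simp
next
  case (Assign a e1 e2)
  then show ?case by (simp add: store_def upd H val_frame[of P "H m" m, OF H])
next
  case (Flip a e)
  then show ?case
    by (simp add: store_def upd H val_frame[of P "H m" m, OF H] spmf.map_comp o_def add.assoc)
next
  case (Clear a)
  then show ?case by (simp add: upd)
next
  case (Seq c1 c2)
  then show ?case
    by (simp add: map_spmf_bind_spmf bind_map_spmf o_def case_prod_unfold)
next
  case (If e c1 c2)
  then show ?case
    by (simp add: charge_def val_frame[of P "H m" m, OF H] add.assoc)
next
  case (While e c)
  let ?h = "\<lambda>(m, t). (H m, s + t)"
  have *: "val w (H m) e = val w m e" "ecost w (H m) e = ecost w m e" for m
    using While.prems by (simp_all add: val_frame[of P "H m" m, OF H])
  have "while_spmf (\<lambda>\<sigma>. val w (fst \<sigma>) e \<noteq> 0) (\<lambda>\<sigma>. exec w c (charge w e \<sigma>)) (?h (m, t)) =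
     map_spmf ?h (while_spmf (\<lambda>\<sigma>. val w (fst \<sigma>) e \<noteq> 0) (\<lambda>\<sigma>. exec w c (charge w e \<sigma>)) (m, t))"
    by (rule while_spmf_simulation)
      (use While in \<open>auto simp: * charge_def add.assoc\<close>)
  then show ?case
    by (simp add: spmf.map_comp o_def charge_def case_prod_unfold * add.assoc)
qed

lemma exec_shift: "exec w c (m, t) = map_spmf (\<lambda>(m', t'). (m', t + t')) (exec w c (m, 0))"
proof -
  have "uses (\<lambda>_. True) c" using uses_bounded[of c] by (blast intro: uses_mono)
  from exec_frame[of "\<lambda>_. True" "\<lambda>m. m", OF _ _ this, of w m t 0] show ?thesis by simp
qed

text \<open>The arrays below \<open>N\<close> belong to the decision algorithm, the others to the search algorithm.\<close>

definition join :: "nat \<Rightarrow> mem \<Rightarrow> mem \<Rightarrow> mem" where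
  "join N lo hi = (\<lambda>a. if a < N then lo a else hi (a - N))"

lemma exec_join:
  "uses (\<lambda>a. a < N) c \<Longrightarrow>
   exec w c (join N lo hi, 0) = map_spmf (\<lambda>(m, t). (join N m hi, t)) (exec w c (lo, 0))"
  using exec_frame[of "\<lambda>a. a < N" "\<lambda>m. join N m hi" c w lo 0 0]
  by (auto simp: join_def fun_eq_iff)

section \<open>Bit lengths\<close>

lemma bits_0 [simp]: "bits 0 = 1" and bits_1 [simp]: "bits (Suc 0) = 1"
  by (simp_all add: bits_def)

lemma bits_pos [simp]: "0 < bits x" "Suc 0 \<le> bits x"
  by (simp_all add: bits_def)

text \<open>A program pays for the bits it writes, so the answer of the decision algorithm is short.\<close>

definition paid :: "config \<Rightarrow> config \<Rightarrow> bool" where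
  "paid \<sigma> \<sigma>' \<longleftrightarrow> snd \<sigma> \<le> snd \<sigma>' \<and>
     (\<forall>a i. bits (fst \<sigma>' a i) + snd \<sigma> \<le> snd \<sigma>' + bits (fst \<sigma> a i))"

lemma paid_refl: "paid \<sigma> \<sigma>"
  by (simp add: paid_def)

lemma paid_trans:
  assumes "paid x y" "paid y z"
  shows "paid x z"
  unfolding paid_def
proof (intro conjI allI)
  show "snd x \<le> snd z" using assms by (simp add: paid_def)
  fix a i
  have "bits (fst y a i) + snd x \<le> snd y + bits (fst x a i)"
    "bits (fst z a i) + snd y \<le> snd z + bits (fst y a i)"
    using assms by (simp_all add: paid_def)
  then show "bits (fst z a i) + snd x \<le> snd z + bits (fst x a i)" by linarith
qed

lemma paid_charge: "paid \<sigma> (charge w e \<sigma>)"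
  by (auto simp: paid_def charge_def split: prod.splits)

text \<open>Used twice: the monotone clock drives the loop rule for costs, and the bound on bit
  lengths limits the price of reading the answer of the decision program.\<close>

lemma exec_paid: "\<forall>\<sigma>'\<in>set_spmf (exec w c \<sigma>). paid \<sigma> \<sigma>'"
proof (induction c arbitrary: \<sigma>)
  case (Seq c1 c2)
  show ?case
  proof
    fix \<sigma>' assume "\<sigma>' \<in> set_spmf (exec w (Seq c1 c2) \<sigma>)"
    then obtain \<sigma>1 where \<sigma>1: "\<sigma>1 \<in> set_spmf (exec w c1 \<sigma>)" "\<sigma>' \<in> set_spmf (exec w c2 \<sigma>1)"
      by (auto simp: set_bind_spmf bind_UNION simp del: split_paired_Ex)
    from \<sigma>1(1) have "paid \<sigma> \<sigma>1" by (rule Seq.IH(1)[rule_format])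
    moreover from \<sigma>1(2) have "paid \<sigma>1 \<sigma>'" by (rule Seq.IH(2)[rule_format])
    ultimately show "paid \<sigma> \<sigma>'" by (rule paid_trans)
  qed
next
  case (If e c1 c2)
  then show ?case unfolding exec.simps using paid_trans[OF paid_charge[of \<sigma> w e]]
    by (simp del: split_paired_All)
next
  case (While e c)
  have "\<forall>s'\<in>set_spmf (while_spmf (\<lambda>\<sigma>. val w (fst \<sigma>) e \<noteq> 0) (\<lambda>\<sigma>. exec w c (charge w e \<sigma>)) \<sigma>). paid \<sigma> s'"
  proof (rule set_while_spmf)
    fix s s' assume "s' \<in> set_spmf (exec w c (charge w e s))"
    then have "paid (charge w e s) s'" by (rule While.IH[rule_format])
    with paid_charge show "paid s s'" by (rule paid_trans)
  qed (rule paid_refl, rule paid_trans)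
  moreover have "paid \<sigma> (charge w e s)" if "paid \<sigma> s" for s
    using that paid_charge by (rule paid_trans)
  ultimately show ?case by (auto simp del: split_paired_All)
qed (auto simp: paid_def store_def of_bool_def split: prod.splits)

section \<open>Expected running times\<close>

text \<open>An expected-runtime transformer in the style of weakest preexpectations:
  \<open>g\<close> is the cost to go after \<open>c\<close>. Keeping the clock out of
  \<open>g\<close> turns sequencing into composition.\<close>

definition ert :: "(nat \<Rightarrow> nat) \<Rightarrow> com \<Rightarrow> (mem \<Rightarrow> ennreal) \<Rightarrow> mem \<Rightarrow> ennreal" where
  "ert w c g m = expc (\<lambda>(m', t). g m' + of_nat t) (exec w c (m, 0))"

text \<open>Assignments, coin flips and tests all charge for an expression by this sum.\<close>

definition tcost :: "(nat \<Rightarrow> nat) \<Rightarrow> mem \<Rightarrow> exp \<Rightarrow> nat" where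
  "tcost w m e = ecost w m e + bits (val w m e)"

lemma charge_eq: "charge w e (m, t) = (m, t + tcost w m e)"
  by (simp add: charge_def tcost_def)

lemma charge_tc: "fst (charge w e s) = fst s" "snd (charge w e s) = snd s + tcost w (fst s) e"
  by (cases s; simp add: charge_eq)+

lemma expc_exec: "expc (\<lambda>(m', t'). g m' + of_nat t') (exec w c (m, t)) = ert w c g m + of_nat t"
  using expc_add_const[of "\<lambda>(m, t). g m + of_nat t" "of_nat t" "exec w c (m, 0)"]
  unfolding ert_def by (subst exec_shift) (simp add: expc_map case_prod_unfold ac_simps)

lemma ert_Skip: "ert w Skip g m = g m + 1"
  by (simp add: ert_def)

lemma ert_Assign: "ert w (Assign a e1 e2) g m =
    g (store m a (val w m e1) (val w m e2)) + of_nat (tcost w m e1 + tcost w m e2)"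
  by (simp add: ert_def tcost_def ac_simps)

lemma ert_Flip: "ert w (Flip a e) g m =
    (g (store m a (val w m e) 1) + g (store m a (val w m e) 0)) / 2 + of_nat (tcost w m e + 1)"
  using expc_add_const[of "\<lambda>c. g (store m a (val w m e) (of_bool c))" "of_nat (tcost w m e + 1)" coin_spmf]
  by (simp add: ert_def tcost_def ac_simps expc_map expc_coin)

lemma ert_Clear: "ert w (Clear a) g m = g (m(a := (\<lambda>_. 0))) + 1"
  by (simp add: ert_def)

lemma ert_Seq: "ert w (Seq c1 c2) g m = ert w c1 (ert w c2 g) m"
  unfolding ert_def[of w "Seq c1 c2"] ert_def[of w c1]
  by (simp add: expc_bind expc_exec case_prod_unfold flip: expc_exec[unfolded case_prod_unfold])

lemma ert_If: "ert w (If e c1 c2) g m =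
    (if val w m e \<noteq> 0 then ert w c1 g m else ert w c2 g m) + of_nat (tcost w m e)"
  using expc_exec[of g w c1 m "tcost w m e"] expc_exec[of g w c2 m "tcost w m e"]
  unfolding ert_def[of w "If e c1 c2"] by (simp add: charge_eq)

text \<open>
  The loop states of interest are parametrised by \<open>st\<close>. The premise on \<open>h\<close> is the invariant for
  the states after one iteration; other states implicitly carry the invariant \<open>\<infinity>\<close>.
\<close>

lemma ert_While_le:
  assumes step: "\<And>x h. x \<in> X \<Longrightarrow> (\<And>y. y \<in> X \<Longrightarrow> h (st y) \<le> J y) \<Longrightarrow>
      (if val w (st x) e \<noteq> 0 then ert w c h (st x) else g (st x)) + of_nat (tcost w (st x) e) \<le> J x"
    and x: "x \<in> X"
  shows "ert w (While e c) g (st x) \<le> J x"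
proof -
  \<comment> \<open>Several parameters may describe the same memory, so the best of their bounds is
    taken.\<close>
  define h where "h m = (INF y\<in>{y\<in>X. st y = m}. J y)" for m
  have h_le: "h (st y) \<le> J y" if "y \<in> X" for y
    unfolding h_def using that by (intro INF_lower) auto
  have h: "(if val w m e \<noteq> 0 then ert w c h m else g m) + of_nat (tcost w m e) \<le> h m" for m
    unfolding h_def[of m] using step[of _ h] h_le by (intro INF_greatest) blast
  have "expc (\<lambda>(m', t'). g m' + of_nat (t' + tcost w m' e))
     (while_spmf (\<lambda>\<sigma>. val w (fst \<sigma>) e \<noteq> 0) (\<lambda>\<sigma>. exec w c (charge w e \<sigma>)) (st x, 0)) \<le>
     (\<lambda>(m, t). h m + of_nat t) (st x, 0)"
  proof (rule expc_while_le)
    fix s :: config assume s: "val w (fst s) e \<noteq> 0"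
    obtain m t where [simp]: "s = (m, t)" by (cases s)
    have "expc (\<lambda>(m, t). h m + of_nat t) (exec w c (charge w e s)) =
        ert w c h m + of_nat (tcost w m e) + of_nat t"
      by (simp add: charge_eq expc_exec)
    also have "\<dots> \<le> h m + of_nat t"
      using h[of m] s by (intro add_right_mono) simp
    finally show "expc (\<lambda>(m, t). h m + of_nat t) (exec w c (charge w e s)) \<le>
        (case s of (m, t) \<Rightarrow> h m + of_nat t)" by simp
  next
    fix s :: config assume s: "\<not> val w (fst s) e \<noteq> 0"
    obtain m t where [simp]: "s = (m, t)" by (cases s)
    have "g m + of_nat (tcost w m e) + of_nat t \<le> h m + of_nat t"
      using h[of m] s by (intro add_right_mono) simp
    then show "(case s of (m', t') \<Rightarrow> g m' + of_nat (t' + tcost w m' e)) \<le>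
        (case s of (m, t) \<Rightarrow> h m + of_nat t)" by (simp add: ac_simps)
  next
    fix s s' :: config assume s': "s' \<in> set_spmf (exec w c (charge w e s))"
    have "snd s < snd (charge w e s)" by (cases s) (simp add: charge_def)
    also have "\<dots> \<le> snd s'" using exec_paid[of w c "charge w e s"] s' by (auto simp: paid_def)
    finally show "snd s < snd s'" .
  qed (auto split: prod.splits)
  also have "\<dots> = h (st x)" by simp
  also have "\<dots> \<le> J x" by (rule h_le[OF x])
  finally show ?thesis
    by (simp add: ert_def expc_map charge_eq case_prod_unfold charge_tc)
qed

lemma expected_time_le:
  assumes "ert w c (\<lambda>_. 0) m \<le> B" "B < \<infinity>"
  shows "expected_time (exec w c (m, 0)) \<le> B"
proof -
  have *: "expc (\<lambda>\<sigma>. of_nat (snd \<sigma>)) (exec w c (m, 0)) \<le> B"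
    using assms(1) by (simp add: ert_def case_prod_unfold)
  then have l: "lossless_spmf (exec w c (m, 0))"
    using assms(2) by (intro expc_finite_imp_lossless) (auto intro: le_less_trans)
  show ?thesis using * l by (simp add: expected_time_def expc_lossless)
qed

text \<open>Letting \<open>r\<close> grow removes the running time \<open>B\<close> from the bound.\<close>

lemma ert_scaled_imp_le:
  assumes "\<And>r. ert w c (\<lambda>m. of_nat r * g m) m \<le> of_nat r * E + B" "B < \<infinity>"
  shows "expc (\<lambda>\<sigma>. g (fst \<sigma>)) (exec w c (m, 0)) \<le> E"
proof -
  have l: "lossless_spmf (exec w c (m, 0))"
    using assms(1)[of 0] assms(2) unfolding ert_def
    by (intro expc_finite_imp_lossless) (auto intro: le_less_trans)
  define e where "e = expc (\<lambda>\<sigma>. g (fst \<sigma>)) (exec w c (m, 0))"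
  have *: "of_nat r * e \<le> of_nat r * E + B" for r
  proof -
    have "of_nat r * e = expc (\<lambda>\<sigma>. of_nat r * g (fst \<sigma>)) (exec w c (m, 0))"
      unfolding e_def by (simp add: expc_lossless[OF l] nn_integral_cmult)
    also have "\<dots> \<le> ert w c (\<lambda>m. of_nat r * g m) m"
      unfolding ert_def by (intro expc_mono) (auto intro: add_increasing2)
    finally show ?thesis using assms(1)[of r] by (rule order_trans)
  qed
  show ?thesis
    unfolding e_def[symmetric]
  proof (rule ennreal_le_epsilon)
    fix \<epsilon> :: real assume "E < \<top>" and \<epsilon>: "\<epsilon> > 0"
    obtain b where b: "B = ennreal b" "b \<ge> 0" using assms(2) by (cases B) auto
    obtain E' where E': "E = ennreal E'" "E' \<ge> 0" using \<open>E < \<top>\<close> by (cases E) auto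
    obtain r :: nat where r: "b / \<epsilon> < real r" using reals_Archimedean2 by blast
    have "r > 0" using r b \<epsilon> by (metis divide_nonneg_pos gr0I not_le of_nat_0)
    have "e < \<infinity>" using *[of 1] b E' by (auto simp: less_top[symmetric] top_unique simp flip: ennreal_plus)
    then obtain e' where e': "e = ennreal e'" "e' \<ge> 0" by (cases e) auto
    have "real r * e' \<le> real r * E' + b"
      using *[of r] b E' e'
      by (simp add: ennreal_of_nat_eq_real_of_nat flip: ennreal_mult ennreal_plus)
    also have "b \<le> real r * \<epsilon>" using r \<epsilon> by (simp add: field_simps)
    finally have "e' \<le> E' + \<epsilon>" using \<open>r > 0\<close> by (simp flip: distrib_left)
    then show "e \<le> E + ennreal \<epsilon>" using e' E' \<epsilon> by (simp flip: ennreal_plus)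
  qed
qed

section \<open>Resampling a row of the planted distribution\<close>

text \<open>The coordinates are independent, so all first-stage values may be drawn before any
  second-stage value. The defaults \<open>d1\<close> and \<open>d2\<close> are free because only
  coordinates in \<open>A\<close> are read.\<close>

lemma Pi_pmf_bind_map:
  assumes "finite A"
  shows "Pi_pmf A d (\<lambda>x. bind_pmf (P x) (\<lambda>a. map_pmf (h x a) (K x a))) =
    bind_pmf (Pi_pmf A d1 P) (\<lambda>f.
      map_pmf (\<lambda>g x. if x \<in> A then h x (f x) (g x) else d) (Pi_pmf A d2 (\<lambda>x. K x (f x))))"
  using assms
  by (simp add: map_pmf_def Pi_pmf_bind[OF assms, of d _ _ d1] Pi_pmf_bind[OF assms, of d _ _ d2])

definition ovr :: "'a set \<Rightarrow> ('a \<Rightarrow> 'b) \<Rightarrow> ('a \<Rightarrow> 'b) \<Rightarrow> 'a \<Rightarrow> 'b" where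
  "ovr B f g = (\<lambda>x. if x \<in> B then g x else f x)"

text \<open>Each coordinate keeps either its old or its fresh value, and both have the same
  law.\<close>

lemma Pi_pmf_ovr:
  assumes "finite A"
  shows "bind_pmf (Pi_pmf A d q) (\<lambda>f. map_pmf (ovr B f) (Pi_pmf A d q)) = Pi_pmf A d q"
proof -
  have "Pi_pmf A d q = Pi_pmf A d (\<lambda>x. bind_pmf (q x) (\<lambda>a. map_pmf (\<lambda>b. if x \<in> B then b else a) (q x)))"
    by (intro Pi_pmf_cong refl, case_tac "x \<in> B") (simp_all add: bind_return_pmf' pmf.map_ident)
  also have "\<dots> = bind_pmf (Pi_pmf A d q) (\<lambda>f.
      map_pmf (\<lambda>g x. if x \<in> A then (if x \<in> B then g x else f x) else d) (Pi_pmf A d q))"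
    by (rule Pi_pmf_bind_map[OF assms])
  also have "\<dots> = bind_pmf (Pi_pmf A d q) (\<lambda>f. map_pmf (ovr B f) (Pi_pmf A d q))"
    using set_Pi_pmf_subset[OF assms, of d q]
    by (intro bind_pmf_cong map_pmf_cong refl) (auto simp: ovr_def fun_eq_iff)
  finally show ?thesis ..
qed

text \<open>Resampling forgets the old entry \<open>l\<close>, so \<open>Q\<close> enters only
  through its sum over the two columns that agree with \<open>y\<close> elsewhere. In this form,
  averaging out an entry becomes a cancellation of two terms.\<close>

lemma pmf_bind_resample_coordinate:
  fixes Q :: "('a \<Rightarrow> bool) pmf"
  shows "pmf (bind_pmf Q (\<lambda>c. map_pmf (\<lambda>b. c(l := b)) B)) y =
    pmf B (y l) * (pmf Q (y(l := True)) + pmf Q (y(l := False)))"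
proof -
  have inner: "pmf (map_pmf (\<lambda>b. c(l := b)) B) y = (if c(l := y l) = y then pmf B (y l) else 0)" for c
  proof (cases "c(l := y l) = y")
    case True
    have "pmf (map_pmf (\<lambda>b. c(l := b)) B) (c(l := y l)) = pmf B (y l)"
      by (rule pmf_map_inj') (auto simp: inj_def fun_upd_eqD)
    then show ?thesis using True by simp
  next
    case False
    then have "y \<notin> set_pmf (map_pmf (\<lambda>b. c(l := b)) B)"
      by auto
    then show ?thesis using False by (simp add: pmf_eq_0_set_pmf)
  qed
  have "pmf (bind_pmf Q (\<lambda>c. map_pmf (\<lambda>b. c(l := b)) B)) y =
      (\<Sum>c\<in>{y(l := True), y(l := False)}. (if c(l := y l) = y then pmf B (y l) else 0) * pmf Q c)"
    unfolding pmf_bind inner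
  proof (subst integral_measure_pmf[of "{y(l := True), y(l := False)}"])
    fix c assume "(if c(l := y l) = y then pmf B (y l) else 0) \<noteq> 0"
    then have "c(l := y l) = y" by (auto split: if_splits)
    then have "c = y(l := c l)" by (metis fun_upd_triv fun_upd_upd)
    then show "c \<in> {y(l := True), y(l := False)}" by (cases "c l") auto
  qed (simp_all add: mult.commute)
  also have "\<dots> = pmf B (y l) * (pmf Q (y(l := True)) + pmf Q (y(l := False)))"
    by (subst sum.insert) (auto simp: fun_eq_iff distrib_left)
  finally show ?thesis .
qed

abbreviation column :: "nat \<Rightarrow> real \<Rightarrow> (nat \<Rightarrow> bool) pmf" where
  "column k p \<equiv> Pi_pmf {..<k} False (\<lambda>_. bernoulli_pmf p)"

definition flip_coin :: "nat \<Rightarrow> real \<Rightarrow> (nat \<Rightarrow> bool) \<Rightarrow> bool pmf" where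
  "flip_coin k p c = (let m = card {l. l < k \<and> c l} in
     if even (k - m) then bernoulli_pmf ((p / (1 - p)) ^ (k - m)) else return_pmf False)"

definition flip_last :: "nat \<Rightarrow> (nat \<Rightarrow> bool) \<Rightarrow> bool \<Rightarrow> nat \<Rightarrow> bool" where
  "flip_last k c b = c(k - 1 := (c (k - 1) \<noteq> b))"

definition planted_column :: "nat \<Rightarrow> real \<Rightarrow> (nat \<Rightarrow> bool) pmf" where
  "planted_column k p = bind_pmf (column k p) (\<lambda>c. map_pmf (flip_last k c) (flip_coin k p c))"

definition zeros :: "nat \<Rightarrow> (nat \<Rightarrow> bool) \<Rightarrow> nat" where
  "zeros k c = k - card {l. l < k \<and> c l}"

definition cells :: "nat \<Rightarrow> nat \<Rightarrow> nat \<Rightarrow> (nat \<times> nat \<times> nat) set" where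
  "cells k n d = {..<k} \<times> {..<n} \<times> {..<d}"

definition coin_matrices :: "nat \<Rightarrow> real \<Rightarrow> nat \<Rightarrow> nat \<Rightarrow> kov pmf" where
  "coin_matrices k p n d = Pi_pmf (cells k n d) False (\<lambda>_. bernoulli_pmf p)"

text \<open>Columns come first in \<open>C j l\<close> because planting is independent across
  columns but couples the \<open>k\<close> entries of each one.\<close>

definition set_columns ::
    "nat \<Rightarrow> nat \<Rightarrow> (nat \<Rightarrow> nat) \<Rightarrow> (nat \<Rightarrow> nat \<Rightarrow> bool) \<Rightarrow> kov \<Rightarrow> kov" where
  "set_columns k d s C R = (\<lambda>(l, i, j). if l < k \<and> j < d \<and> i = s l then C j l else R (l, i, j))"

definition rows :: "nat \<Rightarrow> nat set \<Rightarrow> (nat \<times> nat \<times> nat) set" where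
  "rows l H = {l} \<times> H \<times> UNIV"

definition resample :: "nat \<Rightarrow> real \<Rightarrow> nat \<Rightarrow> nat \<Rightarrow> nat \<Rightarrow> nat set \<Rightarrow> kov \<Rightarrow> kov pmf" where
  "resample k p n d l H U = map_pmf (ovr (rows l H) U) (coin_matrices k p n d)"

context
  fixes k :: nat and p :: real
  assumes k: "k \<ge> 1" and p: "0 \<le> p" "p \<le> 1/2"
begin

text \<open>This is where \<open>p \<le> 1/2\<close> enters: powers of the odds are genuine flip
  probabilities.\<close>

lemma odds_bounds: "0 \<le> p / (1 - p)" "p / (1 - p) \<le> 1"
  using p by (auto simp: field_simps)

lemma card_ones_upd:
  assumes "l < k" "\<not> c l"
  shows "card {l'. l' < k \<and> (c(l := True)) l'} = Suc (card {l'. l' < k \<and> c l'})"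
proof -
  have "{l'. l' < k \<and> (c(l := True)) l'} = insert l {l'. l' < k \<and> c l'}"
    using assms by auto
  then show ?thesis using assms by simp
qed

lemma card_ones_le: "card {l. l < k \<and> c l} \<le> k"
  using card_mono[of "{..<k}" "{l. l < k \<and> c l}"] by auto

lemma even_zeros_flip:
  assumes "l < k"
  shows "even (zeros k (c(l := \<not> c l))) \<longleftrightarrow> odd (zeros k c)"
proof -
  have *: "zeros k c = Suc (zeros k (c(l := True)))" if "\<not> c l" for c
    using card_ones_upd[of l c] card_ones_le[of "c(l := True)"] assms that
    by (simp add: zeros_def)
  show ?thesis
  proof (cases "c l")
    case True
    then have "(c(l := False))(l := True) = c" by (simp add: fun_upd_idem)
    with True show ?thesis using *[of "c(l := False)"] by simp
  qed (use * in simp)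
qed

text \<open>Every zero contributes a factor \<open>1 - p\<close>, which the odds turn into
  \<open>p\<close>; so the product no longer depends on the column. This explains the flip
  probability used in planting.\<close>

lemma pmf_column:
  "pmf (column k p) c * (p / (1 - p)) ^ zeros k c = (if \<forall>l\<ge>k. \<not> c l then p ^ k else 0)"
proof (cases "\<forall>l\<ge>k. \<not> c l")
  case True
  have *: "(\<Prod>l<k. pmf (bernoulli_pmf p) (c l)) =
      (\<Prod>l\<in>{..<k} \<inter> {l. c l}. p) * (\<Prod>l\<in>{..<k} \<inter> - {l. c l}. 1 - p)"
    using p by (subst prod.If_cases[symmetric]) (auto intro!: prod.cong)
  have "card ({..<k} \<inter> {l. c l}) + card ({..<k} \<inter> - {l. c l}) = card {..<k}"
    by (subst card_Un_disjoint[symmetric]) (simp_all add: disjoint_iff flip: Int_Un_distrib)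
  moreover have "{..<k} \<inter> {l. c l} = {l. l < k \<and> c l}" by auto
  ultimately have card: "card {l. l < k \<and> c l} + zeros k c = k"
    "card ({..<k} \<inter> - {l. c l}) = zeros k c" "card ({..<k} \<inter> {l. c l}) = card {l. l < k \<and> c l}"
    using card_ones_le[of c] by (auto simp: zeros_def)
  have "pmf (column k p) c = p ^ card {l. l < k \<and> c l} * (1 - p) ^ zeros k c"
    using True by (subst pmf_Pi') (auto simp: * card)
  then have "pmf (column k p) c * (p / (1 - p)) ^ zeros k c = p ^ (card {l. l < k \<and> c l} + zeros k c)"
    using p by (simp add: power_add power_divide)
  then show ?thesis using True by (simp add: card(1))
next
  case False
  then have "pmf (column k p) c = 0" by (intro pmf_Pi_outside) (auto simp: not_less)
  then show ?thesis using False by auto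
qed

text \<open>
  Planting moves mass \<open>p ^ k\<close> between columns that differ in the last entry only. The correction
  depends on the parity of the number of zeros, hence is symmetric in the rows, and it cancels when
  any one entry is averaged out.
\<close>

lemma pmf_planted_column:
  "pmf (planted_column k p) y = pmf (column k p) y +
     (if \<forall>l\<ge>k. \<not> y l then (if even (zeros k y) then - (p ^ k) else p ^ k) else 0)"
proof -
  define y' where "y' = y(k - 1 := \<not> y (k - 1))"
  have k1: "k - 1 < k" using k by simp
  have y'_ne: "y' \<noteq> y" by (metis y'_def fun_upd_same)
  \<comment> \<open>Only \<open>y\<close> left alone and \<open>y'\<close> flipped can lead to
    \<open>y\<close>.\<close>
  have inner: "pmf (map_pmf (flip_last k c) (flip_coin k p c)) y =
     (if c = y then pmf (flip_coin k p y) False else if c = y' then pmf (flip_coin k p y') True else 0)" for c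
  proof -
    have inj: "inj (flip_last k c)" by (auto simp: inj_def flip_last_def dest!: fun_upd_eqD)
    consider "c = y" | "c = y'" | "c \<noteq> y" "c \<noteq> y'" by blast
    then show ?thesis
    proof cases
      case 1
      then have "y = flip_last k c False" by (auto simp: flip_last_def)
      then show ?thesis using 1 pmf_map_inj'[OF inj, of "flip_coin k p c" False] by auto
    next
      case 2
      then have "y = flip_last k c True" by (auto simp: flip_last_def y'_def)
      then show ?thesis using 2 y'_ne pmf_map_inj'[OF inj, of "flip_coin k p c" True] by auto
    next
      case 3
      have "y \<noteq> flip_last k c b" for b
      proof
        assume "y = flip_last k c b"
        then have "c = (if b then y' else y)" by (auto simp: flip_last_def y'_def)
        with 3 show False by (auto split: if_splits)
      qed
      then have "y \<notin> set_pmf (map_pmf (flip_last k c) (flip_coin k p c))" by auto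
      then show ?thesis using 3 by (simp add: pmf_eq_0_set_pmf)
    qed
  qed
  have "pmf (planted_column k p) y = (\<Sum>c\<in>{y, y'}.
      pmf (column k p) c * (if c = y then pmf (flip_coin k p y) False else if c = y' then pmf (flip_coin k p y') True else 0))"
    unfolding planted_column_def pmf_bind inner
    by (subst integral_measure_pmf[of "{y, y'}"]) (auto split: if_splits)
  also have "\<dots> = pmf (column k p) y * pmf (flip_coin k p y) False + pmf (column k p) y' * pmf (flip_coin k p y') True"
    using y'_ne by simp
  also have "pmf (column k p) y * pmf (flip_coin k p y) False =
      pmf (column k p) y - (if even (zeros k y) then pmf (column k p) y * (p / (1 - p)) ^ zeros k y else 0)"
    using odds_bounds by (auto simp: flip_coin_def Let_def zeros_def power_le_one algebra_simps)
  also have "pmf (column k p) y' * pmf (flip_coin k p y') True =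
      (if even (zeros k y') then pmf (column k p) y' * (p / (1 - p)) ^ zeros k y' else 0)"
    using odds_bounds by (auto simp: flip_coin_def Let_def zeros_def power_le_one)
  also have "even (zeros k y') \<longleftrightarrow> odd (zeros k y)"
    unfolding y'_def by (rule even_zeros_flip[OF k1])
  also have "pmf (column k p) y' * (p / (1 - p)) ^ zeros k y' = (if \<forall>l\<ge>k. \<not> y l then p ^ k else 0)"
    unfolding pmf_column using k1 by (auto simp: y'_def)
  finally show ?thesis unfolding pmf_column by (cases "\<forall>l\<ge>k. \<not> y l") auto
qed

lemma resample_planted_column:
  assumes l: "l < k"
  shows "bind_pmf (planted_column k p) (\<lambda>c. map_pmf (\<lambda>b. c(l := b l)) (column k p)) = (column k p)"
proof -
  have comp: "map_pmf (\<lambda>b. c(l := b l)) (column k p) = map_pmf (\<lambda>b. c(l := b)) (bernoulli_pmf p)" for c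
    using l Pi_pmf_component[of "{..<k}" l False "\<lambda>_. bernoulli_pmf p"]
    by (simp add: pmf.map_comp o_def flip: pmf.map_comp[of "\<lambda>b. c(l := b)" "\<lambda>b. b l", unfolded o_def])
  have "ovr {l} c = (\<lambda>b. c(l := b l))" for c :: "nat \<Rightarrow> bool"
    by (auto simp: ovr_def fun_eq_iff)
  \<comment> \<open>The independent column is written as a resampled column too, so that both sides
    fall under the same formula.\<close>
  then have col: "bind_pmf (column k p) (\<lambda>c. map_pmf (\<lambda>b. c(l := b)) (bernoulli_pmf p)) = (column k p)"
    using Pi_pmf_ovr[of "{..<k}" False "\<lambda>_. bernoulli_pmf p" "{l}"] by (simp add: comp)
  \<comment> \<open>The two columns have opposite parities of zeros, so their corrections
    \<open>p ^ k\<close> and \<open>- (p ^ k)\<close> cancel.\<close>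
  have sum: "pmf (planted_column k p) (y(l := True)) + pmf (planted_column k p) (y(l := False)) =
      pmf (column k p) (y(l := True)) + pmf (column k p) (y(l := False))" for y
    using l even_zeros_flip[OF l, of "y(l := True)"] unfolding pmf_planted_column by auto
  show ?thesis
    unfolding comp
    by (rule pmf_eqI, subst col[symmetric]) (simp add: pmf_bind_resample_coordinate sum)
qed

section \<open>Instances as planted columns plus independent coins\<close>

lemma finite_cells [simp]: "finite (cells k n d)"
  by (simp add: cells_def)

text \<open>The cells \<open>(l, s l, j)\<close> are pairwise distinct, so the entries read off
  there are again independent coins.\<close>

lemma columns_conv:
  assumes s: "\<And>l. l < k \<Longrightarrow> s l < n"
  shows "Pi_pmf {..<d} (\<lambda>_. False) (\<lambda>_. (column k p)) =
    map_pmf (\<lambda>F j l. j < d \<and> l < k \<and> F (l, s l, j)) (coin_matrices k p n d)"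
proof -
  let ?D = "{..<d} \<times> {..<k}"
  let ?h = "\<lambda>(j, l). (l, s l, j)"
  have "Pi_pmf {..<d} (\<lambda>_. False) (\<lambda>_. (column k p)) =
      map_pmf (\<lambda>F j l. F (j, l)) (Pi_pmf ?D False (\<lambda>_. bernoulli_pmf p))"
  proof (rule pmf_eqI)
    fix g :: "nat \<Rightarrow> nat \<Rightarrow> bool"
    have "inj (\<lambda>(F :: nat \<times> nat \<Rightarrow> bool) j l. F (j, l))"
      by (auto simp: inj_def fun_eq_iff)
    then have "pmf (map_pmf (\<lambda>F j l. F (j, l)) (Pi_pmf ?D False (\<lambda>_. bernoulli_pmf p)))
        ((\<lambda>F j l. F (j, l)) (case_prod g)) = pmf (Pi_pmf ?D False (\<lambda>_. bernoulli_pmf p)) (case_prod g)"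
      by (rule pmf_map_inj')
    then have "pmf (map_pmf (\<lambda>F j l. F (j, l)) (Pi_pmf ?D False (\<lambda>_. bernoulli_pmf p))) g =
        pmf (Pi_pmf ?D False (\<lambda>_. bernoulli_pmf p)) (case_prod g)" by simp
    also have "\<dots> = pmf (Pi_pmf {..<d} (\<lambda>_. False) (\<lambda>_. (column k p))) g"
    proof (cases "\<forall>j l. (j, l) \<notin> ?D \<longrightarrow> \<not> g j l")
      case True
      have "pmf (Pi_pmf {..<d} (\<lambda>_. False) (\<lambda>_. (column k p))) g = (\<Prod>j<d. pmf (column k p) (g j))"
        using True by (intro pmf_Pi') (auto simp: fun_eq_iff)
      also have "\<dots> = (\<Prod>j<d. \<Prod>l<k. pmf (bernoulli_pmf p) (g j l))"
        using True by (intro prod.cong refl pmf_Pi') auto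
      also have "\<dots> = (\<Prod>x\<in>?D. pmf (bernoulli_pmf p) (case_prod g x))"
        unfolding prod.cartesian_product by (intro prod.cong refl) auto
      also have "\<dots> = pmf (Pi_pmf ?D False (\<lambda>_. bernoulli_pmf p)) (case_prod g)"
      proof (rule pmf_Pi'[symmetric])
        fix x assume "x \<notin> ?D"
        then show "case_prod g x = False" using True[rule_format, of "fst x" "snd x"]
          by (simp add: case_prod_unfold)
      qed simp
      finally show ?thesis ..
    next
      case False
      then obtain j l where jl: "(j, l) \<notin> ?D" "g j l" by blast
      then have "pmf (Pi_pmf ?D False (\<lambda>_. bernoulli_pmf p)) (case_prod g) = 0"
        by (intro pmf_Pi_outside exI[of _ "(j, l)"]) simp_all
      moreover have "pmf (Pi_pmf {..<d} (\<lambda>_. False) (\<lambda>_. (column k p))) g = 0"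
      proof (cases "j < d")
        case False
        moreover have "g j \<noteq> (\<lambda>_. False)" using jl(2) by auto
        ultimately show ?thesis by (intro pmf_Pi_outside exI[of _ j]) simp_all
      next
        case True
        with jl have "pmf (column k p) (g j) = 0" by (intro pmf_Pi_outside exI[of _ l]) simp_all
        with True have "(\<Prod>j<d. pmf (column k p) (g j)) = 0" by (intro prod_zero bexI[of _ j]) simp_all
        then show ?thesis by (simp add: pmf_Pi)
      qed
      ultimately show ?thesis by simp
    qed
    finally show "pmf (Pi_pmf {..<d} (\<lambda>_. False) (\<lambda>_. (column k p))) g =
      pmf (map_pmf (\<lambda>F j l. F (j, l)) (Pi_pmf ?D False (\<lambda>_. bernoulli_pmf p))) g" by simp
  qed
  also have "Pi_pmf ?D False (\<lambda>_. bernoulli_pmf p) =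
      map_pmf (\<lambda>F. F \<circ> ?h) (Pi_pmf (?h ` ?D) False (\<lambda>_. bernoulli_pmf p))"
    by (rule Pi_pmf_bij_betw) (auto simp: bij_betw_def inj_on_def)
  also have "Pi_pmf (?h ` ?D) False (\<lambda>_. bernoulli_pmf p) =
      map_pmf (\<lambda>F x. if x \<in> ?h ` ?D then F x else False) (coin_matrices k p n d)"
    unfolding coin_matrices_def using s by (intro Pi_pmf_subset) (auto simp: cells_def)
  finally show ?thesis
    by (simp add: pmf.map_comp o_def) (rule map_pmf_cong, auto simp: fun_eq_iff)
qed

text \<open>Overwriting the planted cells by fresh coins changes nothing, and the fresh matrices
  matter only through their columns at \<open>s\<close>.\<close>

lemma coin_matrices_columns:
  assumes s: "\<And>l. l < k \<Longrightarrow> s l < n"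
  shows "coin_matrices k p n d =
    bind_pmf (Pi_pmf {..<d} (\<lambda>_. False) (\<lambda>_. (column k p))) (\<lambda>C. map_pmf (set_columns k d s C) (coin_matrices k p n d))"
proof -
  let ?B = "{(l, i, j). l < k \<and> j < d \<and> i = s l}"
  have "coin_matrices k p n d = bind_pmf (coin_matrices k p n d) (\<lambda>R. map_pmf (ovr ?B R) (coin_matrices k p n d))"
    unfolding coin_matrices_def by (rule Pi_pmf_ovr[symmetric]) simp
  also have "\<dots> = bind_pmf (coin_matrices k p n d) (\<lambda>F. map_pmf (\<lambda>R. ovr ?B R F) (coin_matrices k p n d))"
    unfolding map_pmf_def by (rule bind_commute_pmf)
  also have "(\<lambda>F R. ovr ?B R F) = (\<lambda>F. set_columns k d s (\<lambda>j l. j < d \<and> l < k \<and> F (l, s l, j)))"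
    by (auto simp: fun_eq_iff ovr_def set_columns_def)
  finally show ?thesis by (simp add: columns_conv[OF s] bind_map_pmf)
qed

text \<open>Once the columns at \<open>s\<close> are split off, planting acts on them alone, on each
  one independently.\<close>

lemma plant_coin_matrices:
  assumes s: "\<And>l. l < k \<Longrightarrow> s l < n"
  shows "bind_pmf (coin_matrices k p n d) (\<lambda>U. plant k p d U s) =
    bind_pmf (Pi_pmf {..<d} (\<lambda>_. False) (\<lambda>_. (planted_column k p))) (\<lambda>C.
      map_pmf (set_columns k d s C) (coin_matrices k p n d))"
proof -
  have plant: "plant k p d (set_columns k d s C R) s =
     map_pmf (\<lambda>f. set_columns k d s (\<lambda>j. if j \<in> {..<d} then flip_last k (C j) (f j) else (\<lambda>_. False)) R)
       (Pi_pmf {..<d} False (\<lambda>j. flip_coin k p (C j)))" for C R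
  proof -
    have "card {l. l < k \<and> set_columns k d s C R (l, s l, j)} = card {l. l < k \<and> C j l}" if "j < d" for j
      using that by (intro arg_cong[of _ _ card]) (auto simp: set_columns_def)
    then have "Pi_pmf {..<d} False (\<lambda>j. let m = card {l. l < k \<and> set_columns k d s C R (l, s l, j)} in
          if even (k - m) then bernoulli_pmf ((p / (1 - p)) ^ (k - m)) else return_pmf False) =
        Pi_pmf {..<d} False (\<lambda>j. flip_coin k p (C j))"
      by (intro Pi_pmf_cong) (auto simp: flip_coin_def)
    then show ?thesis
      unfolding plant_def using k
      by (auto intro!: map_pmf_cong simp: fun_eq_iff set_columns_def flip_last_def)
  qed
  have "Pi_pmf {..<d} (\<lambda>_. False) (\<lambda>_. (planted_column k p)) =
    bind_pmf (Pi_pmf {..<d} (\<lambda>_. False) (\<lambda>_. (column k p))) (\<lambda>C.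
      map_pmf (\<lambda>f j. if j \<in> {..<d} then flip_last k (C j) (f j) else (\<lambda>_. False))
        (Pi_pmf {..<d} False (\<lambda>j. flip_coin k p (C j))))"
    unfolding planted_column_def by (rule Pi_pmf_bind_map) simp
  then have "bind_pmf (Pi_pmf {..<d} (\<lambda>_. False) (\<lambda>_. (planted_column k p))) (\<lambda>C.
      map_pmf (set_columns k d s C) (coin_matrices k p n d)) =
    bind_pmf (Pi_pmf {..<d} (\<lambda>_. False) (\<lambda>_. (column k p))) (\<lambda>C.
      bind_pmf (Pi_pmf {..<d} False (\<lambda>j. flip_coin k p (C j))) (\<lambda>f. bind_pmf (coin_matrices k p n d) (\<lambda>R.
        return_pmf (set_columns k d s (\<lambda>j. if j \<in> {..<d} then flip_last k (C j) (f j) else (\<lambda>_. False)) R))))"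
    by (simp add: bind_assoc_pmf bind_map_pmf map_pmf_def bind_return_pmf)
  also have "\<dots> = bind_pmf (Pi_pmf {..<d} (\<lambda>_. False) (\<lambda>_. (column k p))) (\<lambda>C.
      bind_pmf (coin_matrices k p n d) (\<lambda>R. plant k p d (set_columns k d s C R) s))"
    unfolding plant map_pmf_def by (subst bind_commute_pmf) simp
  also have "\<dots> = bind_pmf (coin_matrices k p n d) (\<lambda>U. plant k p d U s)"
    by (subst (2) coin_matrices_columns[OF s]) (simp_all add: bind_assoc_pmf bind_map_pmf)
  finally show ?thesis ..
qed

text \<open>The resampled rows avoid the planted cells, so only the independent coins around them
  are redrawn.\<close>

lemma resample_plant_miss:
  assumes s: "\<And>l. l < k \<Longrightarrow> s l < n" and l: "s l \<notin> H"
  shows "bind_pmf (bind_pmf (coin_matrices k p n d) (\<lambda>U. plant k p d U s)) (resample k p n d l H) =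
    bind_pmf (coin_matrices k p n d) (\<lambda>U. plant k p d U s)"
proof -
  have *: "ovr (rows l H) (set_columns k d s C R) = (\<lambda>F. set_columns k d s C (ovr (rows l H) R F))" for C R
    using l by (auto simp: ovr_def rows_def set_columns_def fun_eq_iff)
  have "bind_pmf (bind_pmf (coin_matrices k p n d) (\<lambda>U. plant k p d U s)) (resample k p n d l H) =
    bind_pmf (Pi_pmf {..<d} (\<lambda>_. False) (\<lambda>_. (planted_column k p))) (\<lambda>C. map_pmf (set_columns k d s C)
      (bind_pmf (coin_matrices k p n d) (\<lambda>R. map_pmf (ovr (rows l H) R) (coin_matrices k p n d))))"
    by (simp add: plant_coin_matrices[OF s] resample_def bind_assoc_pmf bind_map_pmf map_bind_pmf
        pmf.map_comp o_def *)
  also have "bind_pmf (coin_matrices k p n d) (\<lambda>R. map_pmf (ovr (rows l H) R) (coin_matrices k p n d)) =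
      coin_matrices k p n d"
    unfolding coin_matrices_def by (rule Pi_pmf_ovr) simp
  finally show ?thesis by (simp add: plant_coin_matrices[OF s])
qed

text \<open>Resampling redraws entry \<open>l\<close> of every planted column, which turns each into
  an independent column, and some of the coins around them. No trace of planting is left.\<close>

lemma resample_plant_hit:
  assumes s: "\<And>l. l < k \<Longrightarrow> s l < n" and l: "l < k" "s l \<in> H"
  shows "bind_pmf (bind_pmf (coin_matrices k p n d) (\<lambda>U. plant k p d U s)) (resample k p n d l H) =
    coin_matrices k p n d"
proof -
  let ?M = "coin_matrices k p n d" and ?PC = "Pi_pmf {..<d} (\<lambda>_. False) (\<lambda>_. (planted_column k p))"
    and ?CC = "Pi_pmf {..<d} (\<lambda>_. False) (\<lambda>_. (column k p))"
  have *: "ovr (rows l H) (set_columns k d s C R) (set_columns k d s C' R') =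
      set_columns k d s (\<lambda>j. if j \<in> {..<d} then (C j)(l := C' j l) else (\<lambda>_. False)) (ovr (rows l H) R R')"
    for C R C' R'
    using l by (auto simp: ovr_def rows_def set_columns_def fun_eq_iff)
  have "bind_pmf (bind_pmf ?M (\<lambda>U. plant k p d U s)) (resample k p n d l H) =
    bind_pmf ?PC (\<lambda>C. bind_pmf ?M (\<lambda>R. bind_pmf ?CC (\<lambda>C'. bind_pmf ?M (\<lambda>R'.
      return_pmf (ovr (rows l H) (set_columns k d s C R) (set_columns k d s C' R'))))))"
  \<comment> \<open>The fresh matrices are decomposed at the same \<open>s\<close>, so that their
    columns line up with the planted ones.\<close>
  proof -
    have "resample k p n d l H U = bind_pmf ?CC (\<lambda>C'. bind_pmf ?M (\<lambda>R'.
        return_pmf (ovr (rows l H) U (set_columns k d s C' R'))))" for U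
      unfolding resample_def
      by (subst coin_matrices_columns[OF s]) (simp_all add: map_pmf_def bind_assoc_pmf bind_return_pmf)
    then show ?thesis
      by (simp add: plant_coin_matrices[OF s] bind_assoc_pmf bind_map_pmf)
  qed
  also have "\<dots> = bind_pmf ?PC (\<lambda>C. bind_pmf ?CC (\<lambda>C'. bind_pmf ?M (\<lambda>R. bind_pmf ?M (\<lambda>R'.
      return_pmf (set_columns k d s (\<lambda>j. if j \<in> {..<d} then (C j)(l := C' j l) else (\<lambda>_. False))
        (ovr (rows l H) R R'))))))"
    unfolding * by (subst bind_commute_pmf) simp
  also have "\<dots> = bind_pmf (bind_pmf ?PC (\<lambda>C. map_pmf (\<lambda>C' j. if j \<in> {..<d} then (C j)(l := C' j l) else (\<lambda>_. False)) ?CC))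
      (\<lambda>C. map_pmf (set_columns k d s C) (bind_pmf ?M (\<lambda>R. map_pmf (ovr (rows l H) R) ?M)))"
    by (simp add: bind_assoc_pmf bind_map_pmf map_bind_pmf map_pmf_def bind_return_pmf)
  also have "bind_pmf ?PC (\<lambda>C. map_pmf (\<lambda>C' j. if j \<in> {..<d} then (C j)(l := C' j l) else (\<lambda>_. False)) ?CC) =
      Pi_pmf {..<d} (\<lambda>_. False) (\<lambda>_. bind_pmf (planted_column k p) (\<lambda>c. map_pmf (\<lambda>b. c(l := b l)) (column k p)))"
    by (rule Pi_pmf_bind_map[symmetric]) simp
  also have "\<dots> = ?CC" by (simp add: resample_planted_column[OF l(1)])
  also have "bind_pmf ?M (\<lambda>R. map_pmf (ovr (rows l H) R) ?M) = ?M"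
    unfolding coin_matrices_def by (rule Pi_pmf_ovr) simp
  finally show ?thesis by (simp flip: coin_matrices_columns[OF s])
qed

text \<open>An all-one column has no zeros and is flipped with probability 1. A column whose only
  zero is the last entry has an odd number of zeros and is never flipped. So planting never produces
  an all-one column.\<close>

lemma plant_orthogonal:
  assumes s: "\<And>l. l < k \<Longrightarrow> s l < n" and V: "V \<in> set_pmf (plant k p d U s)"
  shows "orthogonal_rows k d V s"
  unfolding orthogonal_rows_def
proof (intro allI impI)
  fix j assume j: "j < d"
  let ?m = "card {l. l < k \<and> U (l, s l, j)}"
  obtain flip where flip: "flip \<in> set_pmf (Pi_pmf {..<d} False (\<lambda>j. flip_coin k p (\<lambda>l. U (l, s l, j))))"
    and V: "V = (\<lambda>(l, i, j). if l = k - 1 \<and> i = s (k - 1) \<and> j < d \<and> flip j then \<not> U (l, i, j) else U (l, i, j))"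
    using V unfolding plant_def flip_coin_def by auto
  have fj: "flip j \<in> set_pmf (flip_coin k p (\<lambda>l. U (l, s l, j)))"
    using flip j by (auto simp: set_Pi_pmf PiE_dflt_def)
  have k1: "k - 1 < k" using k by simp
  have "\<exists>l<k. \<not> V (l, s l, j)"
  proof (rule ccontr)
    assume "\<not> ?thesis"
    then have all: "V (l, s l, j)" if "l < k" for l using that by blast
    then have U: "U (l, s l, j)" if "l < k - 1" for l
      using that all[of l] by (simp add: V)
    show False
    proof (cases "U (k - 1, s (k - 1), j)")
      case True
      then have *: "{l. l < k \<and> U (l, s l, j)} = {..<k}"
        using U k by (auto, metis One_nat_def Suc_pred less_SucE not_gr_zero not_less_eq not_le)
      have "flip j"
        using fj by (cases "flip j") (simp_all add: flip_coin_def Let_def * set_pmf_iff)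
      then show False using all[OF k1] True j by (simp add: V)
    next
      case False
      then have *: "{l. l < k \<and> U (l, s l, j)} = {..<k - 1}"
        using U k by (auto, metis One_nat_def Suc_pred less_SucE not_gr_zero not_less_eq not_le)
      have "\<not> k < k - Suc 0" by simp
      then have "\<not> flip j" using fj * k by (simp add: flip_coin_def Let_def)
      then show False using all[OF k1] False j by (simp add: V)
    qed
  qed
  then show "(\<Prod>l<k. of_bool (V (l, s l, j)) :: nat) = 0" by (auto intro!: prod_zero)
qed

end

section \<open>Costs of expressions and binary expansions\<close>

lemma bits_mono: "x \<le> y \<Longrightarrow> bits x \<le> bits y"
  by (simp add: bits_def floor_log_mono monoD)

lemma bits_le_Suc: "bits x \<le> Suc x"
proof (cases "x = 0")
  case False
  have "floor_log x < 2 ^ floor_log x" by (rule less_exp)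
  also have "\<dots> \<le> x" using False by (intro floor_log_exp2_le) simp
  finally show ?thesis by (simp add: bits_def)
qed simp

lemma less_exp_bits: "x < 2 ^ bits x"
  using floor_log_exp2_gt[of x] by (cases "x = 0") (simp_all add: bits_def)

lemma bits_power_le:
  assumes "x \<le> X ^ s" "1 \<le> s"
  shows "bits x \<le> s * bits X"
proof (cases "x = 0")
  case True
  then show ?thesis using assms(2) by (simp add: Suc_le_eq)
next
  case False
  have "2 ^ floor_log x \<le> x" using False by (intro floor_log_exp2_le) simp
  also note assms(1)
  also have "X ^ s < (2 ^ bits X) ^ s"
    using assms(2) by (intro power_strict_mono less_exp_bits) auto
  also have "\<dots> = 2 ^ (s * bits X)" by (simp add: power_mult[symmetric] mult.commute)
  finally show ?thesis by (simp add: bits_def)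
qed

primrec esize :: "exp \<Rightarrow> nat" where
  "esize (Const c) = 1"
| "esize (Read a e) = esize e + 1"
| "esize (Digit e) = esize e + 1"
| "esize (Bin f e1 e2) = esize e1 + esize e2 + 1"

text \<open>Side condition for cost bounds that depend on the expression's size only: constants and
  cells read are bounded by \<open>X\<close>, intermediate results then by a power of
  \<open>X\<close>. \<open>Digit\<close> is excluded because it costs as much as the index itself,
  not its bit length.\<close>

primrec small :: "nat \<Rightarrow> (nat \<Rightarrow> nat) \<Rightarrow> mem \<Rightarrow> exp \<Rightarrow> bool" where
  "small X w m (Const c) = (c \<le> X)"
| "small X w m (Read a e) = (small X w m e \<and> m a (val w m e) \<le> X)"
| "small X w m (Digit e) = False"
| "small X w m (Bin f e1 e2) = (small X w m e1 \<and> small X w m e2)"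

text \<open>In units of \<open>bits X\<close>: the square pays for the evaluation, the linear term
  for the bits of the result.\<close>

definition ebound :: "exp \<Rightarrow> nat" where
  "ebound e = (esize e)\<^sup>2 + esize e"

lemma esize_pos: "1 \<le> esize e"
  by (induction e) auto

lemma val_small:
  assumes "2 \<le> X" "small X w m e"
  shows "val w m e \<le> X ^ esize e"
  using assms(2)
proof (induction e)
  case (Bin f e1 e2)
  let ?a = "X ^ esize e1" and ?b = "X ^ esize e2"
  have ab: "1 \<le> ?a" "1 \<le> ?b" using assms(1) by auto
  \<comment> \<open>The operator node counts 1 in \<open>esize\<close>, and the resulting extra
    factor \<open>X \<ge> 2\<close> absorbs the 2.\<close>
  have "x + y \<le> 2 * (x * y)" if "1 \<le> x" "1 \<le> y" for x y :: nat
  proof -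
    have "x \<le> x * y" "y \<le> x * y" using that by (cases y; cases x; simp)+
    then show ?thesis by linarith
  qed
  from this[OF ab] have "?a + ?b \<le> 2 * (?a * ?b)" .
  also have "\<dots> \<le> X * (?a * ?b)" using assms(1) by (intro mult_right_mono) auto
  finally have sum: "?a + ?b \<le> X ^ esize (Bin f e1 e2)" by (simp add: power_add)
  have prod: "?a * ?b \<le> X ^ esize (Bin f e1 e2)" using assms(1) by (simp add: power_add)
  have IH: "val w m e1 \<le> ?a" "val w m e2 \<le> ?b" using Bin by auto
  have "binval f (val w m e1) (val w m e2) \<le> max (?a + ?b) (?a * ?b)"
    using IH mult_le_mono[OF IH] le_trans[OF div_le_dividend[of "val w m e1" "val w m e2"] IH(1)]
    by (cases f) auto
  then show ?case using sum prod by simp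
next
  case (Read a e)
  have "X \<le> X * X ^ esize e" using assms(1) by simp
  then show ?case using Read by (auto intro: order_trans)
qed (use assms in auto)

lemma ecost_small:
  assumes "2 \<le> X" "small X w m e"
  shows "ecost w m e \<le> (esize e)\<^sup>2 * bits X"
  using assms(2)
proof (induction e)
  case (Bin f e1 e2)
  have b: "bits (val w m e1) \<le> esize e1 * bits X" "bits (val w m e2) \<le> esize e2 * bits X"
    using Bin.prems assms(1) by (auto intro!: bits_power_le val_small esize_pos)
  have "ecost w m (Bin f e1 e2) \<le> ((esize e1)\<^sup>2 + (esize e2)\<^sup>2 + esize e1 + esize e2) * bits X"
    using Bin b by (simp add: algebra_simps)
  also have "\<dots> \<le> (esize (Bin f e1 e2))\<^sup>2 * bits X"
    by (intro mult_right_mono) (auto simp: power2_eq_square algebra_simps)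
  finally show ?case .
next
  case (Read a e)
  have "bits (val w m e) \<le> esize e * bits X"
    using Read.prems assms(1) by (auto intro!: bits_power_le val_small esize_pos)
  moreover have "bits (m a (val w m e)) \<le> bits X"
    using Read.prems by (intro bits_mono) auto
  ultimately have "ecost w m (Read a e) \<le> ((esize e)\<^sup>2 + esize e + 1) * bits X"
    using Read by (simp add: algebra_simps)
  also have "\<dots> \<le> (esize (Read a e))\<^sup>2 * bits X"
    by (intro mult_right_mono) (auto simp: power2_eq_square algebra_simps)
  finally show ?case .
qed (auto intro: bits_mono)

lemma tcost_small:
  assumes "2 \<le> X" "small X w m e"
  shows "tcost w m e \<le> ebound e * bits X"
  using ecost_small[OF assms] bits_power_le[OF val_small[OF assms] esize_pos]
  by (simp add: tcost_def ebound_def algebra_simps)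

text \<open>Cost bookkeeping for a fair coin. The premise is doubled so that it stays within the
  natural numbers.\<close>

lemma ennreal_half_le:
  assumes "a + b + 2 * c \<le> 2 * e"
  shows "((x + of_nat a) + (y + of_nat b)) / 2 + of_nat c \<le> (x + y) / 2 + (of_nat e :: ennreal)"
proof -
  have half: "(of_nat (2 * i) :: ennreal) / 2 = of_nat i" for i
    by (simp add: ennreal_mult_divide_eq mult.commute)
  have "((x + of_nat a) + (y + of_nat b)) / 2 + of_nat c =
      (x + y) / 2 + (of_nat a + of_nat b) / 2 + of_nat (2 * c) / 2"
    unfolding half by (simp add: add_divide_distrib_ennreal ac_simps)
  also have "\<dots> = (x + y) / 2 + (of_nat (a + b + 2 * c) / 2 :: ennreal)"
    by (simp add: add_divide_distrib_ennreal ac_simps)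
  also have "\<dots> \<le> (x + y) / 2 + of_nat (2 * e) / 2"
    by (intro divide_right_mono_ennreal of_nat_mono assms add_left_mono)
  finally show ?thesis unfolding half .
qed

text \<open>The number whose binary expansion starts with digit \<open>j\<close> of
  \<open>p\<close>: the chance of outcome 1 once the first \<open>j\<close> digits have been matched
  by coins.\<close>

definition binary_tail :: "real \<Rightarrow> nat \<Rightarrow> real" where
  "binary_tail p j = frac (2 ^ j * p)"

lemma binary_digit_cases: "binary_digit p j = 0 \<or> binary_digit p j = 1"
  by (auto simp: binary_digit_def)

lemma binary_tail_bounds: "0 \<le> binary_tail p j" "binary_tail p j \<le> 1"
  by (simp_all add: binary_tail_def less_imp_le[OF frac_lt_1])

lemma binary_tail_step: "binary_tail p j = (real (binary_digit p j) + binary_tail p (Suc j)) / 2"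
proof -
  define x where "x = 2 ^ j * p"
  have "\<lfloor>2 * x\<rfloor> = 2 * \<lfloor>x\<rfloor> \<or> \<lfloor>2 * x\<rfloor> = 2 * \<lfloor>x\<rfloor> + 1" by linarith
  then have "real_of_int \<lfloor>2 * x\<rfloor> = 2 * \<lfloor>x\<rfloor> + real (nat (\<lfloor>2 * x\<rfloor> mod 2))" by auto
  then show ?thesis
    by (simp add: binary_tail_def binary_digit_def frac_def x_def field_simps)
qed

text \<open>One toss of the sampler: with probability 1/2 the coin agrees with digit
  \<open>j\<close> and the next digit is examined; otherwise the digit itself is the
  outcome.\<close>

lemma ennreal_binary_tail_step:
  fixes G0 G1 :: ennreal
  shows "((ennreal (binary_tail p (Suc j)) * G1 + ennreal (1 - binary_tail p (Suc j)) * G0) +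
      (if binary_digit p j = 1 then G1 else G0)) / 2 =
    ennreal (binary_tail p j) * G1 + ennreal (1 - binary_tail p j) * G0"
proof -
  define t where "t = binary_tail p (Suc j)"
  have t: "0 \<le> t" "t \<le> 1" by (simp_all add: t_def binary_tail_bounds)
  have h: "ennreal (x / 2) * G = (ennreal x * G) / 2" if "0 \<le> x" for x G
    using that by (simp add: divide_ennreal[of x 2, symmetric, simplified] ennreal_times_divide mult.commute)
  show ?thesis
  proof (cases "binary_digit p j = 0")
    case 1: True
    then have *: "binary_tail p j = t / 2" "1 - binary_tail p j = ((1 - t) + 1) / 2"
      using binary_tail_step[of p j] by (simp_all add: t_def field_simps)
    have "ennreal ((1 - t) + 1) = ennreal (1 - t) + 1" using t by (subst ennreal_plus) simp_all
    with 1 t show ?thesis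
      unfolding *(2) unfolding *(1) by (subst (1 2) h) (simp_all add: t_def distrib_right add_divide_distrib_ennreal add.assoc)
  next
    case False
    then have 2: "binary_digit p j = 1" using binary_digit_cases[of p j] by simp
    then have *: "binary_tail p j = (t + 1) / 2" "1 - binary_tail p j = (1 - t) / 2"
      using binary_tail_step[of p j] by (simp_all add: t_def field_simps)
    have "ennreal (t + 1) = ennreal t + 1" using t by (subst ennreal_plus) simp_all
    with 2 t show ?thesis
      unfolding *(2) unfolding *(1) by (subst (1 2) h) (simp_all add: t_def distrib_left distrib_right add_divide_distrib_ennreal ac_simps)
  qed
qed

section \<open>The search program\<close>

definition cell :: "nat \<Rightarrow> nat \<Rightarrow> nat" where
  "cell x = (\<lambda>_. 0)(0 := x)"

text \<open>
  The arrays of the search algorithm: a copy of the matrices, \<open>n\<close>, \<open>d\<close>, the current cell, the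
  weight \<open>2 ^ b\<close> of the bit that is asked for, the coin, the index of the next binary digit of \<open>p\<close>,
  and the row indices found so far. Scalars live in cell 0.
\<close>

definition regs :: "(nat \<Rightarrow> nat) \<Rightarrow> nat \<Rightarrow> nat \<Rightarrow> nat \<Rightarrow> nat \<Rightarrow> nat \<Rightarrow> nat \<Rightarrow> (nat \<Rightarrow> nat) \<Rightarrow> mem" where
  "regs S n d i pw c j out = (\<lambda>_ _. 0)(0 := S, 1 := cell n, 2 := cell d, 3 := cell i,
     4 := cell pw, 5 := cell c, 6 := cell j, 7 := out)"

definition buf :: "nat \<Rightarrow> nat \<Rightarrow> (nat \<Rightarrow> nat) \<Rightarrow> mem" where
  "buf n d f = (\<lambda>_ _. 0)(0 := (\<lambda>_. 0)(0 := n, 1 := d), 1 := f)"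

lemma cell_0 [simp]: "cell x 0 = x"
  by (simp add: cell_def)

lemma cell_zero: "cell 0 = (\<lambda>_. 0)"
  by (simp add: cell_def fun_eq_iff)

lemma regs_read [simp]:
  "regs S n d i pw c j out 0 = S" "regs S n d i pw c j out (Suc 0) = cell n"
  "regs S n d i pw c j out 2 = cell d" "regs S n d i pw c j out 3 = cell i"
  "regs S n d i pw c j out 4 = cell pw" "regs S n d i pw c j out 5 = cell c"
  "regs S n d i pw c j out 6 = cell j" "regs S n d i pw c j out 7 = out"
  by (simp_all add: regs_def)

lemma regs_store [simp]:
  "store (regs S n d i pw c j out) 0 x y = regs (S(x := y)) n d i pw c j out"
  "store (regs S n d i pw c j out) (Suc 0) 0 y = regs S y d i pw c j out"
  "store (regs S n d i pw c j out) 2 0 y = regs S n y i pw c j out"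
  "store (regs S n d i pw c j out) 3 0 y = regs S n d y pw c j out"
  "store (regs S n d i pw c j out) 4 0 y = regs S n d i y c j out"
  "store (regs S n d i pw c j out) 5 0 y = regs S n d i pw y j out"
  "store (regs S n d i pw c j out) 6 0 y = regs S n d i pw c y out"
  "store (regs S n d i pw c j out) 7 x y = regs S n d i pw c j (out(x := y))"
  by (auto simp: store_def regs_def cell_def fun_eq_iff)

lemma regs_clear [simp]:
  "(regs S n d i pw c j out)(6 := (\<lambda>_. 0)) = regs S n d i pw c 0 out"
  by (auto simp: regs_def cell_zero fun_eq_iff)

lemma buf_read [simp]:
  "buf n d f 0 0 = n" "buf n d f 0 (Suc 0) = d" "buf n d f (Suc 0) = f"
  by (simp_all add: buf_def)

lemma buf_store [simp]: "store (buf n d f) (Suc 0) x y = buf n d (f(x := y))"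
  by (auto simp: store_def buf_def fun_eq_iff)

lemma join_read [simp]:
  "a < N \<Longrightarrow> join N lo hi a = lo a"
  "join N lo hi N = hi 0" "join N lo hi (Suc N) = hi 1" "join N lo hi (Suc (Suc N)) = hi 2" "join N lo hi (N + b) = hi b"
  by (simp_all add: join_def eval_nat_numeral)

lemma join_upd [simp]:
  "a < N \<Longrightarrow> (join N lo hi)(a := f) = join N (lo(a := f)) hi"
  "(join N lo hi)(N := f) = join N lo (hi(0 := f))"
  "(join N lo hi)(Suc N := f) = join N lo (hi(1 := f))"
  "(join N lo hi)(Suc (Suc N) := f) = join N lo (hi(2 := f))"
  "(join N lo hi)(N + b := f) = join N lo (hi(b := f))"
  by (auto simp: join_def fun_eq_iff eval_nat_numeral)

lemma join_store [simp]:
  "a < N \<Longrightarrow> store (join N lo hi) a x y = join N (store lo a x y) hi"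
  "store (join N lo hi) N x y = join N lo (store hi 0 x y)"
  "store (join N lo hi) (Suc N) x y = join N lo (store hi 1 x y)"
  "store (join N lo hi) (Suc (Suc N)) x y = join N lo (store hi 2 x y)"
  "store (join N lo hi) (N + b) x y = join N lo (store hi b x y)"
  by (simp_all add: store_def)

abbreviation reg :: "nat \<Rightarrow> nat \<Rightarrow> exp" where
  "reg N a \<equiv> Read (N + a) (Const 0)"

abbreviation set_reg :: "nat \<Rightarrow> nat \<Rightarrow> exp \<Rightarrow> com" where
  "set_reg N a e \<equiv> Assign (N + a) (Const 0) e"

text \<open>The absolute difference, as one of the truncated subtractions is 0; it tests for
  inequality.\<close>

definition gap :: "exp \<Rightarrow> exp \<Rightarrow> exp" where
  "gap e1 e2 = Bin Plus (Bin Minus e1 e2) (Bin Minus e2 e1)"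

definition remaining :: "nat \<Rightarrow> nat \<Rightarrow> exp" where
  "remaining k N = Bin Minus (Bin Times (Const k) (Bin Times (reg N 1) (reg N 2))) (reg N 3)"

definition step :: "nat \<Rightarrow> com" where
  "step N = set_reg N 3 (Bin Plus (reg N 3) (Const 1))"

text \<open>Compare fair coins with the binary digits of \<open>p\<close> until they differ.\<close>

definition digit_test :: "nat \<Rightarrow> exp" where
  "digit_test N = Bin Minus (Const 1) (gap (Read 1 (reg N 3)) (Digit (reg N 6)))"

text \<open>The target cell doubles as the coin. At the first disagreement the coin is the
  complement of the digit, so \<open>1 - coin\<close> stores the digit: 1 iff the random number with
  the coins as digits is below \<open>p\<close>.\<close>

definition toss :: "nat \<Rightarrow> com" where
  "toss N = Seq (Flip 1 (reg N 3))
    (Seq (While (digit_test N)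
       (Seq (set_reg N 6 (Bin Plus (reg N 6) (Const 1))) (Flip 1 (reg N 3))))
    (Seq (Assign 1 (reg N 3) (Bin Minus (Const 1) (Read 1 (reg N 3)))) (Clear (N + 6))))"

text \<open>Nonzero iff the current cell is copied instead of resampled.\<close>

definition keep :: "nat \<Rightarrow> nat \<Rightarrow> exp" where
  "keep N l =
    (let row = Bin Div (reg N 3) (reg N 2);
         mat = Bin Div row (reg N 1);
         q = Bin Div (Bin Minus row (Bin Times mat (reg N 1))) (reg N 4);
         bit = Bin Minus q (Bin Times (Const 2) (Bin Div q (Const 2)))
     in Bin Plus (gap mat (Const l)) (Bin Minus (Const 1) (gap bit (reg N 5))))"

definition fill :: "nat \<Rightarrow> nat \<Rightarrow> nat \<Rightarrow> com" where
  "fill k N l = While (remaining k N)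
     (Seq (If (keep N l) (Assign 1 (reg N 3) (Read N (reg N 3))) (toss N)) (step N))"

text \<open>Guarantees on running time and error hold only for memories of the form
  \<open>ov_input\<close>, so leftovers of the previous run have to go.\<close>

primrec clears :: "nat \<Rightarrow> com" where
  "clears 0 = Skip"
| "clears (Suc a) = Seq (clears a) (Clear a)"

definition vote :: "nat \<Rightarrow> nat \<Rightarrow> exp \<Rightarrow> com" where
  "vote N l b = Assign (N + 7) (Const l) (Bin Plus (Read (N + 7) (Const l)) (Bin Times b (reg N 4)))"

definition query :: "nat \<Rightarrow> nat \<Rightarrow> com \<Rightarrow> nat \<Rightarrow> com" where
  "query k N A l =
    Seq (clears N)
    (Seq (Assign 0 (Const 0) (reg N 1))
    (Seq (Assign 0 (Const 1) (reg N 2))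
    (Seq (Flip (N + 5) (Const 0))
    (Seq (set_reg N 3 (Const 0))
    (Seq (fill k N l)
    (Seq A
    (Seq (If (Read 2 (Const 0)) (vote N l (reg N 5)) (vote N l (Bin Minus (Const 1) (reg N 5))))
      (set_reg N 4 (Bin Times (Const 2) (reg N 4))))))))))"

definition block :: "nat \<Rightarrow> nat \<Rightarrow> com \<Rightarrow> nat \<Rightarrow> com" where
  "block k N A l = Seq (set_reg N 4 (Const 1)) (While (Bin Minus (reg N 1) (reg N 4)) (query k N A l))"

primrec blocks :: "nat \<Rightarrow> nat \<Rightarrow> com \<Rightarrow> nat \<Rightarrow> com" where
  "blocks k N A 0 = Skip"
| "blocks k N A (Suc l) = Seq (blocks k N A l) (block k N A l)"

primrec outputs :: "nat \<Rightarrow> nat \<Rightarrow> com" where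
  "outputs N 0 = Clear 2"
| "outputs N (Suc l) = Seq (outputs N l) (Assign 2 (Const l) (Read (N + 7) (Const l)))"

text \<open>The decision program may destroy its input, so every query refills it from this
  copy.\<close>

definition save :: "nat \<Rightarrow> nat \<Rightarrow> com" where
  "save k N =
    Seq (set_reg N 1 (Read 0 (Const 0)))
    (Seq (set_reg N 2 (Read 0 (Const 1)))
      (While (remaining k N) (Seq (Assign N (reg N 3) (Read 1 (reg N 3))) (step N))))"

definition search :: "nat \<Rightarrow> nat \<Rightarrow> com \<Rightarrow> com" where
  "search k N A = Seq (save k N) (Seq (blocks k N A k) (outputs N k))"

lemma ert_clears:
  "M \<le> N \<Longrightarrow> ert w (clears M) g (join N lo hi) =
     g (join N (\<lambda>a. if a < M then (\<lambda>_. 0) else lo a) hi) + of_nat (M + 1)"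
proof (induction M arbitrary: g)
  case 0
  then show ?case by (simp add: ert_Skip)
next
  case (Suc M)
  have "(\<lambda>a. if a < Suc M then (\<lambda>_. 0) else lo a) = (\<lambda>a. if a < M then (\<lambda>_. 0) else lo a)(M := (\<lambda>_. 0))"
    by (auto simp: fun_eq_iff)
  then show ?case using Suc by (simp add: ert_Seq ert_Clear ac_simps)
qed

lemma ert_clears_all: "ert w (clears N) g (join N lo hi) = g (join N (\<lambda>_ _. 0) hi) + of_nat (N + 1)"
proof -
  have "join N (\<lambda>a. if a < N then (\<lambda>_. 0) else lo a) hi = join N (\<lambda>_ _. 0) hi"
    by (auto simp: join_def)
  then show ?thesis by (simp add: ert_clears)
qed

text \<open>\<open>X\<close> bounds the numbers stored by the search program, except for the digit
  index, and \<open>bits X\<close> is the unit of cost. It covers \<open>2 * n\<close> because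
  weights and wrong row indices can go past \<open>n\<close>. Arrays 0 to 2 hold input and output,
  hence \<open>3 \<le> N\<close>.\<close>

locale machine =
  fixes k N n d X :: nat and p :: real
  assumes N: "3 \<le> N" and p: "0 \<le> p" "p < 1"
    and X: "2 \<le> X" "k \<le> X" "2 * n \<le> X" "d \<le> X" "k * n * d \<le> X"
begin

abbreviation w :: "nat \<Rightarrow> nat" where "w \<equiv> binary_digit p"
abbreviation L :: nat where "L \<equiv> bits X"
abbreviation sz :: nat where "sz \<equiv> k * n * d"

lemma N_simps [simp]: "0 < N" "Suc 0 < N" "2 < N"
  using N by auto

lemma L_pos: "1 \<le> L" by simp

lemma bits_le_L: "x \<le> X \<Longrightarrow> bits x \<le> L"
  by (rule bits_mono)

definition toss_cost :: nat where "toss_cost = 10000 * L"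

text \<open>The number of tosses is unbounded, but digit \<open>j\<close> is examined with
  probability only \<open>1 / 2 ^ j\<close>, at a price linear in \<open>j\<close>. The potentials
  \<open>E\<close> and \<open>e\<close>, for going on and for stopping, express that this series
  converges.\<close>

lemma ert_toss:
  assumes i: "i < sz"
  shows "ert w (toss N) g (join N (buf n d f) (regs S n d i pw c 0 out)) \<le>
    ennreal p * g (join N (buf n d (f(i := 1))) (regs S n d i pw c 0 out)) +
    ennreal (1 - p) * g (join N (buf n d (f(i := 0))) (regs S n d i pw c 0 out)) + of_nat toss_cost"
proof -
  define st where "st = (\<lambda>(b, j). join N (buf n d (f(i := b))) (regs S n d i pw c j out))"
  define G where "G b = g (join N (buf n d (f(i := b))) (regs S n d i pw c 0 out))" for b
  define P where "P j = ennreal (binary_tail p j) * G 1 + ennreal (1 - binary_tail p j) * G 0" for j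
  define e where "e j = (100 + 10 * j) * L" for j
  \<comment> \<open>Chosen so that \<open>E (Suc j) + e (Suc j)\<close> plus twice the price of one
    iteration is at most \<open>2 * E j\<close>.\<close>
  define E where "E j = (560 + 50 * j) * L" for j
  \<comment> \<open>Agreement of coin \<open>b\<close> with digit \<open>j\<close> leaves the tail
    from \<open>Suc j\<close>; disagreement settles the outcome as the digit.\<close>
  define J where "J = (\<lambda>(b, j). if b = w j then P (Suc j) + of_nat (E j)
      else G (if w j = 1 then 1 else 0) + of_nat (e j))"
  let ?end = "Seq (Assign 1 (reg N 3) (Bin Minus (Const 1) (Read 1 (reg N 3)))) (Clear (N + 6))"
  have bi: "bits i \<le> L" using i X(5) by (intro bits_le_L) simp
  have bit: "b = 0 \<or> b = 1" if "b \<le> 1" for b :: nat using that by auto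
  have w_bit: "w j = 0 \<or> w j = 1" for j by (rule binary_digit_cases)
  have lin: "a + b * j \<le> a * L + b * j * L" for a b j
    using mult_le_mono2[OF L_pos, of "a + b * j"] by (simp add: distrib_right)
  have vals: "val w (st (b, j)) (reg N 3) = i" "val w (st (b, j)) (Read 1 (reg N 3)) = b"
      "val w (st (b, j)) (reg N 6) = j" "val w (st (b, j)) (Digit (reg N 6)) = w j" for b j
    by (simp_all add: st_def)
  have costs: "ecost w (st (b, j)) (reg N 3) = 2 + bits i"
      "ecost w (st (b, j)) (Read 1 (reg N 3)) = 2 + 2 * bits i + bits b"
      "ecost w (st (b, j)) (reg N 6) = 2 + bits j"
      "ecost w (st (b, j)) (Digit (reg N 6)) = 3 + bits j + j" for b j
    by (simp_all add: st_def)
  have test_val: "val w (st (b, j)) (digit_test N) = 1 - ((b - w j) + (w j - b))" for b j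
    unfolding digit_test_def gap_def val.simps(1,4) binval.simps vals ..
  have test: "val w (st (b, j)) (digit_test N) \<noteq> 0 \<longleftrightarrow> b = w j" if "b \<le> 1" for b j
    unfolding test_val using that w_bit[of j] by arith
  have test_cost: "tcost w (st (b, j)) (digit_test N) \<le> (30 + 4 * j) * L" if "b \<le> 1" for b j
  proof -
    have bw: "b - w j \<le> 1" "w j - b \<le> 1" "b - w j + (w j - b) \<le> 1" "1 - (b - w j + (w j - b)) \<le> 1"
      "w j \<le> 1"
      using that w_bit[of j] by arith+
    have one: "bits x = 1" if "x \<le> 1" for x using bit[OF that] by auto
    have "tcost w (st (b, j)) (digit_test N) = 22 + 4 * bits i + 2 * bits j + 2 * j"
      unfolding tcost_def test_val
      unfolding digit_test_def gap_def ecost.simps(1,4) val.simps(1,4) binval.simps vals costs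
        one[OF that] one[OF bw(1)] one[OF bw(2)] one[OF bw(3)] one[OF bw(4)] one[OF bw(5)] one[OF order_refl]
      by simp
    then show ?thesis
      using bi bits_le_Suc[of j] lin[of 24 4 j] unfolding distrib_right by linarith
  qed
  have half: "(J (1, j) + J (0, j)) / 2 + of_nat c \<le> P j + of_nat e'"
    if "E j + e j + 2 * c \<le> 2 * e'" for j c e'
  proof -
    let ?b = "if w j = 1 then 1 else 0"
    have sum: "J (1, j) + J (0, j) = (P (Suc j) + of_nat (E j)) + (G ?b + of_nat (e j))"
      using w_bit[of j] by (auto simp: J_def ac_simps)
    have avg: "(P (Suc j) + G ?b) / 2 = P j"
      using ennreal_binary_tail_step[of p j "G 1" "G 0"] unfolding P_def if_distrib[of G] .
    show ?thesis
      unfolding sum using ennreal_half_le[OF that, of "P (Suc j)" "G ?b"] unfolding avg .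
  qed
  have flip: "ert w (Flip 1 (reg N 3)) h (st (b, j)) \<le> (h (st (1, j)) + h (st (0, j))) / 2 + of_nat (5 * L)"
    for h b j
  proof -
    have "tcost w (st (b, j)) (reg N 3) + 1 \<le> 5 * L"
      using bi L_pos unfolding tcost_def vals costs by linarith
    then have "of_nat (tcost w (st (b, j)) (reg N 3) + 1) \<le> (of_nat (5 * L) :: ennreal)"
      by (rule of_nat_mono)
    then show ?thesis
      unfolding ert_Flip by (intro add_mono order_refl) (simp_all add: st_def)
  qed
  have loop: "ert w (While (digit_test N)
       (Seq (set_reg N 6 (Bin Plus (reg N 6) (Const 1))) (Flip 1 (reg N 3)))) (ert w ?end g) (st x) \<le> J x"
    if "x \<in> {(b, j). b \<le> 1}" for x
  proof (rule ert_While_le[OF _ that])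
    fix x h assume "x \<in> {(b :: nat, j :: nat). b \<le> 1}" and h: "\<And>y. y \<in> {(b, j). b \<le> 1} \<Longrightarrow> h (st y) \<le> J y"
    then obtain b j where x: "x = (b, j)" and b: "b \<le> 1" by auto
    show "(if val w (st x) (digit_test N) \<noteq> 0
          then ert w (Seq (set_reg N 6 (Bin Plus (reg N 6) (Const 1))) (Flip 1 (reg N 3))) h (st x)
          else ert w ?end g (st x)) + of_nat (tcost w (st x) (digit_test N)) \<le> J x"
    proof (cases "b = w j")
      case True
      let ?c = "tcost w (st (b, j)) (Const 0) + tcost w (st (b, j)) (Bin Plus (reg N 6) (Const 1))"
      have c: "?c \<le> (20 + 10 * j) * L"
        unfolding tcost_def ecost.simps(1,4) val.simps(1,4) binval.simps vals costs
        using bits_le_Suc[of j] bits_le_Suc[of "Suc j"] lin[of 20 10 j]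
        unfolding distrib_right by (simp del: bits_pos)
      have "ert w (Seq (set_reg N 6 (Bin Plus (reg N 6) (Const 1))) (Flip 1 (reg N 3))) h (st (b, j)) =
          ert w (Flip 1 (reg N 3)) h (st (b, Suc j)) + of_nat ?c"
        by (simp add: ert_Seq ert_Assign) (simp add: st_def)
      also have "\<dots> \<le> (J (1, Suc j) + J (0, Suc j)) / 2 + of_nat (5 * L) + of_nat ?c"
        by (intro add_right_mono order_trans[OF flip] divide_right_mono_ennreal add_mono h) simp_all
      finally have "ert w (Seq (set_reg N 6 (Bin Plus (reg N 6) (Const 1))) (Flip 1 (reg N 3))) h (st (b, j)) +
          of_nat (tcost w (st (b, j)) (digit_test N)) \<le>
          (J (1, Suc j) + J (0, Suc j)) / 2 + of_nat (5 * L) + of_nat ?c + of_nat (tcost w (st (b, j)) (digit_test N))"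
        by (rule add_right_mono)
      also have "\<dots> = (J (1, Suc j) + J (0, Suc j)) / 2 + of_nat (5 * L + ?c + tcost w (st (b, j)) (digit_test N))"
        by (simp add: ac_simps)
      also have "\<dots> \<le> P (Suc j) + of_nat (E j)"
        using c test_cost[OF b, of j] by (intro half) (simp add: E_def e_def algebra_simps)
      finally show ?thesis using True test[OF b] by (simp add: x J_def)
    next
      case False
      let ?c = "tcost w (st (b, j)) (reg N 3) +
        tcost w (st (b, j)) (Bin Minus (Const 1) (Read 1 (reg N 3))) + 1"
      have c: "?c \<le> 30 * L"
        unfolding tcost_def ecost.simps(1,4) val.simps(1,4) binval.simps vals costs
        using bit[OF b] bi L_pos by (auto simp del: bits_pos)
      have b': "Suc 0 - b = (if w j = 1 then 1 else 0)" using bit[OF b] w_bit[of j] False by auto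
      have "ert w ?end g (st (b, j)) = G (if w j = 1 then 1 else 0) + of_nat ?c"
        by (simp add: ert_Seq ert_Assign ert_Clear) (simp add: st_def G_def b' ac_simps)
      then have "ert w ?end g (st (b, j)) + of_nat (tcost w (st (b, j)) (digit_test N)) =
          G (if w j = 1 then 1 else 0) + of_nat (?c + tcost w (st (b, j)) (digit_test N))"
        by (simp add: ac_simps)
      also have "\<dots> \<le> G (if w j = 1 then 1 else 0) + of_nat (e j)"
        using c test_cost[OF b, of j] by (intro add_left_mono of_nat_mono) (simp add: e_def algebra_simps)
      finally show ?thesis using False test[OF b] by (simp add: x J_def)
    qed
  qed
  have "join N (buf n d f) (regs S n d i pw c 0 out) = st (f i, 0)"
    by (simp add: st_def)
  then have "ert w (toss N) g (join N (buf n d f) (regs S n d i pw c 0 out)) \<le>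
      (J (1, 0) + J (0, 0)) / 2 + of_nat (5 * L)"
    unfolding toss_def ert_Seq
    by (simp del: One_nat_def) (intro order_trans[OF flip] add_right_mono divide_right_mono_ennreal add_mono loop[unfolded ert_Seq]; simp)
  also have "\<dots> \<le> P 0 + of_nat toss_cost"
    by (intro half) (simp add: E_def e_def toss_cost_def)
  also have "P 0 = ennreal p * G 1 + ennreal (1 - p) * G 0"
    using p by (simp add: P_def binary_tail_def frac_eq)
  finally show ?thesis by (simp add: G_def)
qed

end

definition content :: "nat \<Rightarrow> nat \<Rightarrow> nat \<Rightarrow> kov \<Rightarrow> nat \<Rightarrow> nat" where
  "content k n d U = (\<lambda>x. if x < k * n * d
     then of_bool (U (x div (n * d), x div d mod n, x mod d)) else 0)"

lemma ov_input_buf: "ov_input k n d U = buf n d (content k n d U)"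
  by (simp add: ov_input_def buf_def content_def)

lemma content_le: "content k n d U x \<le> 1"
  by (simp add: content_def)

definition bitmap :: "nat \<Rightarrow> (nat \<Rightarrow> bool) \<Rightarrow> nat \<Rightarrow> nat" where
  "bitmap m V = (\<lambda>x. if x < m then of_bool (V x) else 0)"

section \<open>Refilling the input of the decision program\<close>

context machine
begin

lemma two_X: "1 \<le> X" "n \<le> X" "0 \<le> X"
  using X by auto

lemma tcost_le:
  assumes "small X w m e" "ebound e \<le> b"
  shows "tcost w m e \<le> b * L"
  using tcost_small[OF X(1) assms(1)] mult_le_mono1[OF assms(2), of L] by linarith

definition regular :: "(nat \<Rightarrow> nat) \<Rightarrow> nat \<Rightarrow> nat \<Rightarrow> nat \<Rightarrow> bool" where
  "regular S i pw c \<longleftrightarrow> (\<forall>x. S x \<le> 1) \<and> i \<le> sz \<and> pw \<le> X \<and> c \<le> 1"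

lemma remaining_val:
  "val w (join N lo (regs S n d i pw c j out)) (remaining k N) = sz - i"
  by (simp add: remaining_def)

lemma remaining_cost:
  assumes "i \<le> sz"
  shows "tcost w (join N lo (regs S n d i pw c j out)) (remaining k N) \<le> 200 * L"
  using assms X two_X by (intro tcost_le) (auto simp: remaining_def ebound_def numeral_2_eq_2[symmetric])

lemma ert_step:
  assumes "i < sz"
  shows "ert w (step N) g (join N lo (regs S n d i pw c j out)) \<le>
    g (join N lo (regs S n d (Suc i) pw c j out)) + of_nat (30 * L)"
proof -
  let ?m = "join N lo (regs S n d i pw c j out)"
  have "tcost w ?m (Const 0) \<le> 2 * L"
    using two_X by (intro tcost_le) (auto simp: ebound_def numeral_2_eq_2[symmetric])
  moreover have "tcost w ?m (Bin Plus (reg N 3) (Const 1)) \<le> 28 * L"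
    using two_X X assms by (intro tcost_le) (auto simp: ebound_def numeral_2_eq_2[symmetric])
  ultimately have "of_nat (tcost w ?m (Const 0) + tcost w ?m (Bin Plus (reg N 3) (Const 1))) \<le>
      (of_nat (30 * L) :: ennreal)"
    by (intro of_nat_mono) simp
  then show ?thesis
    unfolding step_def ert_Assign by (intro add_mono) simp_all
qed

lemma keep_val:
  assumes "c \<le> 1"
  shows "val w (join N lo (regs S n d i pw c j out)) (keep N l) \<noteq> 0 \<longleftrightarrow>
    \<not> (i div (n * d) = l \<and> (i div d mod n) div pw mod 2 \<noteq> c)"
proof -
  define mat where "mat = i div d div n"
  define bit where "bit = (i div d mod n) div pw mod 2"
  have "val w (join N lo (regs S n d i pw c j out)) (keep N l) =
      (mat - l + (l - mat)) + (1 - (bit - c + (c - bit)))"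
    unfolding keep_def Let_def gap_def
    by (simp add: mat_def bit_def minus_div_mult_eq_mod minus_mult_div_eq_mod)
  moreover have "bit \<le> 1" by (simp add: bit_def)
  ultimately have "val w (join N lo (regs S n d i pw c j out)) (keep N l) \<noteq> 0 \<longleftrightarrow>
      \<not> (mat = l \<and> bit \<noteq> c)"
    using assms by arith
  then show ?thesis by (simp add: mat_def bit_def div_mult2_eq mult.commute)
qed

lemma keep_cost:
  assumes "i \<le> sz" "pw \<le> X" "c \<le> 1" "l \<le> X"
  shows "tcost w (join N lo (regs S n d i pw c j out)) (keep N l) \<le> 15000 * L"
  using assms X two_X
  by (intro tcost_le) (auto simp: keep_def Let_def gap_def ebound_def numeral_2_eq_2[symmetric])

definition fill_dist :: "(nat \<Rightarrow> nat) \<Rightarrow> nat \<Rightarrow> nat \<Rightarrow> nat \<Rightarrow> nat \<Rightarrow> bool pmf" where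
  "fill_dist S l pw c x = (if x div (n * d) = l \<and> (x div d mod n) div pw mod 2 \<noteq> c
     then bernoulli_pmf p else return_pmf (S x \<noteq> 0))"

definition fill_cost :: nat where "fill_cost = (sz + 1) * (30000 * L)"

text \<open>The invariant \<open>K v i\<close> takes the first \<open>i\<close> cells from
  \<open>v\<close> and integrates over the remaining ones; each iteration fixes one more coordinate
  of the product distribution.\<close>

lemma ert_fill:
  assumes S: "\<And>x. S x \<le> 1" and pw: "pw \<le> X" and c: "c \<le> 1" and l: "l \<le> X"
  shows "ert w (fill k N l) g (join N (buf n d (\<lambda>_. 0)) (regs S n d 0 pw c 0 out)) \<le>
    (\<integral>\<^sup>+V. g (join N (buf n d (bitmap sz V)) (regs S n d sz pw c 0 out))
       \<partial>Pi_pmf {0..<sz} False (fill_dist S l pw c)) + of_nat fill_cost"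
proof -
  define f where "f = (\<lambda>(v :: nat \<Rightarrow> bool, i :: nat) x. if x < i then of_bool (v x) else (0::nat))"
  define st where "st = (\<lambda>x. join N (buf n d (f x)) (regs S n d (snd x) pw c 0 out))"
  define G where "G V = g (join N (buf n d (bitmap sz V)) (regs S n d sz pw c 0 out))" for V
  define K where "K v i = (\<integral>\<^sup>+V. G (\<lambda>x. if x < i then v x else V x)
    \<partial>Pi_pmf {i..<sz} False (fill_dist S l pw c))" for v i
  define J where "J = (\<lambda>(v, i). K v i + of_nat ((sz - i + 1) * (30000 * L)))"
  have K_step: "K v i = (\<integral>\<^sup>+b. K (v(i := b)) (Suc i) \<partial>fill_dist S l pw c i)" if "i < sz" for v i
  proof -
    have "{i..<sz} = insert i {Suc i..<sz}" using that by auto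
    then have "K v i = (\<integral>\<^sup>+b. \<integral>\<^sup>+V. G (\<lambda>x. if x < i then v x else (V(i := b)) x)
        \<partial>Pi_pmf {Suc i..<sz} False (fill_dist S l pw c) \<partial>fill_dist S l pw c i)"
      unfolding K_def by (simp add: Pi_pmf_insert')
    also have "\<dots> = (\<integral>\<^sup>+b. K (v(i := b)) (Suc i) \<partial>fill_dist S l pw c i)"
      unfolding K_def
      by (intro nn_integral_cong arg_cong[of _ _ G]) (auto simp: fun_eq_iff)
    finally show ?thesis .
  qed
  have "ert w (fill k N l) g (st (v, 0)) \<le> J (v, 0)" for v
    unfolding fill_def
  proof (rule ert_While_le[where X = "{(v, i). i \<le> sz}"])
    fix x h assume "x \<in> {(v :: nat \<Rightarrow> bool, i). i \<le> sz}"
      and h: "\<And>y. y \<in> {(v, i). i \<le> sz} \<Longrightarrow> h (st y) \<le> J y"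
    then obtain v i where x: "x = (v, i)" and i: "i \<le> sz" by auto
    have rc: "tcost w (st (v, i)) (remaining k N) \<le> 200 * L"
      using remaining_cost[OF i] by (simp add: st_def)
    show "(if val w (st x) (remaining k N) \<noteq> 0
          then ert w (Seq (If (keep N l) (Assign 1 (reg N 3) (Read N (reg N 3))) (toss N)) (step N)) h (st x)
          else g (st x)) + of_nat (tcost w (st x) (remaining k N)) \<le> J x"
    proof (cases "i < sz")
      case False
      with i have i: "i = sz" by simp
      have "g (st x) = G v" by (simp add: x i st_def f_def G_def bitmap_def)
      also have "G v = K v sz"
        unfolding K_def G_def by (simp add: bitmap_def cong: if_cong)
      finally have g: "g (st x) = K v sz" .
      have "of_nat (tcost w (st (v, i)) (remaining k N)) \<le> (of_nat (30000 * L) :: ennreal)"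
        using rc by (intro of_nat_mono) linarith
      then show ?thesis
        using i unfolding x J_def st_def by (simp add: remaining_val add_left_mono g[unfolded x st_def i, simplified])
    next
      case True
      define D where "D = 30 * L + (sz - i) * (30000 * L)"
      let ?h = "ert w (step N) h"
      have upd: "(f (v, i))(i := of_bool b) = f (v(i := b), Suc i)" for b
        by (auto simp: f_def fun_eq_iff)
      have step: "?h (join N (buf n d ((f (v, i))(i := of_bool b))) (regs S n d i pw c 0 out)) \<le>
          K (v(i := b)) (Suc i) + of_nat D" for b
      proof -
        have "?h (join N (buf n d ((f (v, i))(i := of_bool b))) (regs S n d i pw c 0 out)) \<le>
          h (st (v(i := b), Suc i)) + of_nat (30 * L)"
          unfolding upd using ert_step[OF True] by (simp add: st_def)
        also have "\<dots> \<le> J (v(i := b), Suc i) + of_nat (30 * L)"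
          using True by (intro add_right_mono h) simp
        also have "\<dots> = K (v(i := b)) (Suc i) + of_nat D"
        proof -
          have "sz - Suc i + 1 = sz - i" using True by simp
          then show ?thesis unfolding J_def D_def prod.case by (simp only: of_nat_add ac_simps)
        qed
        finally show ?thesis .
      qed
      have kv: "val w (st x) (keep N l) \<noteq> 0 \<longleftrightarrow>
          \<not> (i div (n * d) = l \<and> (i div d mod n) div pw mod 2 \<noteq> c)"
        using keep_val[OF c, of "buf n d (f (v, i))" S i pw 0 out l] by (simp add: x st_def)
      have body: "(if val w (st x) (keep N l) \<noteq> 0
          then ert w (Assign 1 (reg N 3) (Read N (reg N 3))) ?h (st x) else ert w (toss N) ?h (st x)) \<le>
          K v i + of_nat (D + 10000 * L)"
      proof (cases "val w (st x) (keep N l) \<noteq> 0")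
        case T: True
        then have q: "fill_dist S l pw c i = return_pmf (S i \<noteq> 0)"
          using kv by (auto simp: fill_dist_def)
        have "S i \<le> X" using S[of i] two_X by linarith
        then have "tcost w (st x) (reg N 3) + tcost w (st x) (Read N (reg N 3)) \<le> 6 * L + 12 * L"
          using two_X X True
          by (intro add_mono tcost_le) (auto simp: x st_def ebound_def numeral_2_eq_2[symmetric])
        then have le: "of_nat (tcost w (st x) (reg N 3) + tcost w (st x) (Read N (reg N 3))) \<le>
            (of_nat (10000 * L) :: ennreal)"
          by (intro of_nat_mono) linarith
        have Si: "S i = of_bool (S i \<noteq> 0)" using S[of i] by (cases "S i") auto
        have "ert w (Assign 1 (reg N 3) (Read N (reg N 3))) ?h (st x) \<le>
            ?h (join N (buf n d ((f (v, i))(i := of_bool (S i \<noteq> 0)))) (regs S n d i pw c 0 out)) +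
            of_nat (10000 * L)"
          unfolding ert_Assign
          by (intro add_mono le) (subst Si[symmetric], simp add: x st_def)
        also have "\<dots> \<le> K (v(i := S i \<noteq> 0)) (Suc i) + of_nat D + of_nat (10000 * L)"
          by (intro add_right_mono step)
        also have "K (v(i := S i \<noteq> 0)) (Suc i) = K v i"
          by (simp add: K_step[OF True] q)
        finally show ?thesis using T by (simp add: ac_simps)
      next
        case F: False
        then have q: "fill_dist S l pw c i = bernoulli_pmf p"
          using kv by (auto simp: fill_dist_def)
        have "ert w (toss N) ?h (st x) \<le>
          ennreal p * ?h (join N (buf n d ((f (v, i))(i := of_bool True))) (regs S n d i pw c 0 out)) +
          ennreal (1 - p) * ?h (join N (buf n d ((f (v, i))(i := of_bool False))) (regs S n d i pw c 0 out)) +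
          of_nat (10000 * L)"
          using ert_toss[OF True, of ?h "f (v, i)" S pw c out] by (simp add: x st_def toss_cost_def)
        also have "\<dots> \<le> ennreal p * (K (v(i := True)) (Suc i) + of_nat D) +
            ennreal (1 - p) * (K (v(i := False)) (Suc i) + of_nat D) + of_nat (10000 * L)"
          by (intro add_mono mult_left_mono step) simp_all
        also have "\<dots> = (ennreal p * K (v(i := True)) (Suc i) + ennreal (1 - p) * K (v(i := False)) (Suc i)) +
            (ennreal p + ennreal (1 - p)) * of_nat D + of_nat (10000 * L)"
          by (simp only: distrib_left distrib_right ac_simps)
        also have "ennreal p + ennreal (1 - p) = 1"
          using p by (simp flip: ennreal_plus)
        also have "ennreal p * K (v(i := True)) (Suc i) + ennreal (1 - p) * K (v(i := False)) (Suc i) = K v i"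
          using p by (simp add: K_step[OF True] q mult.commute)
        finally show ?thesis using F by (simp add: ac_simps)
      qed
      have "tcost w (st x) (keep N l) + tcost w (st x) (remaining k N) \<le> 15200 * L"
      proof -
        have "tcost w (st (v, i)) (keep N l) \<le> 15000 * L"
          using keep_cost[OF i pw c l] by (simp add: st_def)
        with rc show ?thesis unfolding x by linarith
      qed
      then have "(D + 10000 * L) + (tcost w (st x) (keep N l) + tcost w (st x) (remaining k N)) \<le>
          (sz - i + 1) * (30000 * L)"
        by (simp add: D_def algebra_simps)
      then have cost: "of_nat ((D + 10000 * L) + (tcost w (st x) (keep N l) + tcost w (st x) (remaining k N))) \<le>
          (of_nat ((sz - i + 1) * (30000 * L)) :: ennreal)"
        by (rule of_nat_mono)
      have "ert w (Seq (If (keep N l) (Assign 1 (reg N 3) (Read N (reg N 3))) (toss N)) (step N)) h (st x) +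
          of_nat (tcost w (st x) (remaining k N)) \<le>
        K v i + of_nat ((D + 10000 * L) + (tcost w (st x) (keep N l) + tcost w (st x) (remaining k N)))"
        unfolding ert_Seq ert_If using body by (simp add: ac_simps add_left_mono)
      also have "\<dots> \<le> K v i + of_nat ((sz - i + 1) * (30000 * L))"
        by (intro add_left_mono cost)
      finally show ?thesis using True by (simp add: x J_def st_def remaining_val)
    qed
  qed simp
  from this[of "\<lambda>_. False"] show ?thesis
    by (simp add: st_def f_def J_def K_def G_def fill_cost_def)
qed

end

section \<open>A single query\<close>

definition row_class :: "nat \<Rightarrow> nat \<Rightarrow> nat set" where
  "row_class pw c = {i. i div pw mod 2 \<noteq> c}"

context machine
begin

lemma bij_betw_cells:
  "bij_betw (\<lambda>x. (x div (n * d), x div d mod n, x mod d)) {0..<sz} (cells k n d)"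
proof (rule bij_betw_byWitness[where f' = "\<lambda>(l, i, j). (l * n + i) * d + j"])
  have dm: "x div (n * d) * n + x div d mod n = x div d" for x
    by (metis div_mult2_eq div_mult_mod_eq mult.commute)
  show "\<forall>x\<in>{0..<sz}. (\<lambda>(l, i, j). (l * n + i) * d + j) (x div (n * d), x div d mod n, x mod d) = x"
    by (simp add: dm)
  have inv: "((l * n + i) * d + j) div (n * d) = l" "((l * n + i) * d + j) div d mod n = i"
    "((l * n + i) * d + j) mod d = j" if "i < n" "j < d" for l i j
    using that by (simp_all add: div_mult2_eq mult.commute[of n d])
  then show "\<forall>x\<in>cells k n d. (\<lambda>x. (x div (n * d), x div d mod n, x mod d)) ((\<lambda>(l, i, j). (l * n + i) * d + j) x) = x"
    by (auto simp: cells_def)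
  show "(\<lambda>x. (x div (n * d), x div d mod n, x mod d)) ` {0..<sz} \<subseteq> cells k n d"
  proof safe
    fix x assume x: "x \<in> {0..<sz}"
    then have "0 < d" "0 < n" by (auto intro: Nat.gr0I)
    moreover have "x div (n * d) < k"
      using x by (simp add: less_mult_imp_div_less mult.assoc)
    ultimately show "(x div (n * d), x div d mod n, x mod d) \<in> cells k n d"
      by (simp add: cells_def)
  qed
  show "(\<lambda>(l, i, j). (l * n + i) * d + j) ` cells k n d \<subseteq> {0..<sz}"
  proof (safe, unfold cells_def, clarsimp)
    fix l i j assume "l < k" "i < n" "j < d"
    have "(l * n + i) * d + j < Suc (l * n + i) * d" using \<open>j < d\<close> by simp
    also have "\<dots> \<le> (Suc l * n) * d" using \<open>i < n\<close> by (intro mult_right_mono) simp_all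
    also have "\<dots> \<le> (k * n) * d" using \<open>l < k\<close> by (intro mult_right_mono) simp_all
    finally show "(l * n + i) * d + j < sz" .
  qed
qed

text \<open>Decoding row-major addresses is a bijection onto the index triples, so coins per address
  are coins per matrix entry. This links the program to the distributions studied above.\<close>

lemma fill_resample:
  "map_pmf (bitmap sz) (Pi_pmf {0..<sz} False (fill_dist (content k n d U) l pw c)) =
   map_pmf (content k n d) (resample k p n d l (row_class pw c) U)"
proof -
  let ?dec = "\<lambda>x. (x div (n * d), x div d mod n, x mod d)"
  let ?hit = "\<lambda>x. x div (n * d) = l \<and> x div d mod n div pw mod 2 \<noteq> c"
  have "Pi_pmf {0..<sz} False (fill_dist (content k n d U) l pw c) =
      Pi_pmf {0..<sz} False (\<lambda>x. bind_pmf (bernoulli_pmf p) (\<lambda>b. return_pmf (if ?hit x then b else U (?dec x))))"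
    by (intro Pi_pmf_cong refl) (auto simp: fill_dist_def content_def bind_return_pmf')
  also have "\<dots> = map_pmf (\<lambda>F x. if x \<in> {0..<sz} then if ?hit x then F x else U (?dec x) else False)
      (Pi_pmf {0..<sz} False (\<lambda>_. bernoulli_pmf p))"
    by (subst Pi_pmf_bind[where d' = False]) (simp_all add: map_pmf_def)
  also have "Pi_pmf {0..<sz} False (\<lambda>_. bernoulli_pmf p) = map_pmf (\<lambda>g. g \<circ> ?dec) (coin_matrices k p n d)"
    unfolding coin_matrices_def
  proof (rule Pi_pmf_bij_betw)
    fix x assume x: "x \<notin> {0..<sz}"
    show "?dec x \<notin> cells k n d"
    proof
      assume c: "?dec x \<in> cells k n d"
      then have "x div (n * d) < k" "n * d > 0" by (auto simp: cells_def intro!: Nat.gr0I)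
      then have "x < k * (n * d)" by (simp add: div_less_iff_less_mult)
      with x show False by (simp add: mult.assoc)
    qed
  qed (simp_all add: bij_betw_cells)
  finally show ?thesis
    unfolding resample_def
    by (simp add: pmf.map_comp)
      (intro map_pmf_cong refl, auto simp: fun_eq_iff bitmap_def content_def ovr_def rows_def row_class_def)
qed

end

text \<open>\<open>q\<close> is \<lceil>log 2 n\<rceil>, described by the outcomes of the loop test
  \<open>2 ^ b < n\<close>. Termination and time are demanded for every instance, since each query
  runs on an instance of its own.\<close>

locale reduction = machine k N n d X p for k N n d X p +
  fixes A :: com and T :: nat and U :: kov and q :: nat
  assumes A: "uses (\<lambda>a. a < N) A"
    and lossless: "\<And>V. lossless_spmf (exec (binary_digit p) A (ov_input k n d V, 0))"
    and time: "\<And>V \<sigma>. \<sigma> \<in> set_spmf (exec (binary_digit p) A (ov_input k n d V, 0)) \<Longrightarrow> snd \<sigma> \<le> T"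
    and n: "1 \<le> n"
    and q: "\<And>b. b < q \<Longrightarrow> 2 ^ b < n" "n \<le> 2 ^ q"
begin

abbreviation run_A :: "kov \<Rightarrow> config spmf" where
  "run_A V \<equiv> exec w A (ov_input k n d V, 0)"

abbreviation S :: "nat \<Rightarrow> nat" where
  "S \<equiv> content k n d U"

abbreviation state :: "mem \<Rightarrow> nat \<Rightarrow> nat \<Rightarrow> nat \<Rightarrow> (nat \<Rightarrow> nat) \<Rightarrow> mem" where
  "state lo i pw c out \<equiv> join N lo (regs S n d i pw c 0 out)"

lemma answer_bits:
  assumes "\<sigma> \<in> set_spmf (run_A V)"
  shows "bits (fst \<sigma> 2 0) \<le> T + 1"
proof -
  have "paid (ov_input k n d V, 0) \<sigma>" using exec_paid assms by blast
  then have "bits (fst \<sigma> 2 0) \<le> snd \<sigma> + bits (ov_input k n d V 2 0)"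
    by (auto simp: paid_def)
  also have "\<dots> \<le> T + 1" using time[OF assms] by (simp add: ov_input_def)
  finally show ?thesis .
qed

lemma vote_cost:
  assumes "pw \<le> X" "c \<le> 1" "l \<le> X" "out l \<le> X" "esize b \<le> 4" "small X w (state lo i pw c out) b"
  shows "tcost w (state lo i pw c out) (Const l) +
    tcost w (state lo i pw c out) (Bin Plus (Read (N + 7) (Const l)) (Bin Times b (reg N 4))) \<le> 150 * L"
proof -
  have "(esize b + 6)\<^sup>2 \<le> 10\<^sup>2" using assms(5) by (intro power_mono) auto
  then have "ebound (Bin Plus (Read (N + 7) (Const l)) (Bin Times b (reg N 4))) \<le> 148"
    using assms(5) by (simp add: ebound_def eval_nat_numeral)
  then have "tcost w (state lo i pw c out) (Bin Plus (Read (N + 7) (Const l)) (Bin Times b (reg N 4))) \<le> 148 * L"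
    using assms by (intro tcost_le) auto
  moreover have "tcost w (state lo i pw c out) (Const l) \<le> 2 * L"
    using assms by (intro tcost_le) (auto simp: ebound_def numeral_2_eq_2[symmetric])
  ultimately show ?thesis by linarith
qed

text \<open>Rows whose bit differs from \<open>c\<close> were resampled, so a nonzero answer,
  meaning planted, says that the bit of the planted row is \<open>c\<close>.\<close>

definition ans :: "config \<Rightarrow> nat \<Rightarrow> nat" where
  "ans \<sigma> c = (if fst \<sigma> 2 0 \<noteq> 0 then c else 1 - c)"

definition conclude :: "nat \<Rightarrow> com" where
  "conclude l = Seq (If (Read 2 (Const 0)) (vote N l (reg N 5)) (vote N l (Bin Minus (Const 1) (reg N 5))))
      (set_reg N 4 (Bin Times (Const 2) (reg N 4)))"

lemma ert_conclude:
  assumes "pw \<le> X" "c \<le> 1" "l \<le> X" "\<And>x. out x \<le> X" "\<sigma> \<in> set_spmf (run_A V)"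
  shows "ert w (conclude l) g (state (fst \<sigma>) i pw c out) \<le>
    g (state (fst \<sigma>) i (2 * pw) c (out(l := out l + ans \<sigma> c * pw))) + of_nat (300 * L + 2 * T)"
proof -
  let ?s = "state (fst \<sigma>) i pw c out"
  let ?out = "out(l := out l + ans \<sigma> c * pw)"
  define b where "b = (if fst \<sigma> 2 0 \<noteq> 0 then reg N 5 else Bin Minus (Const 1) (reg N 5))"
  have b: "esize b \<le> 4" "small X w ?s b" "val w ?s b = ans \<sigma> c"
    using assms two_X X by (auto simp: b_def ans_def)
  have set4: "ert w (set_reg N 4 (Bin Times (Const 2) (reg N 4))) g (state (fst \<sigma>) i pw c ?out) =
     g (state (fst \<sigma>) i (2 * pw) c ?out) +
     of_nat (tcost w (state (fst \<sigma>) i pw c ?out) (Const 0) +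
       tcost w (state (fst \<sigma>) i pw c ?out) (Bin Times (Const 2) (reg N 4)))"
    by (simp add: ert_Assign)
  have set4_cost: "tcost w (state (fst \<sigma>) i pw c ?out) (Const 0) +
       tcost w (state (fst \<sigma>) i pw c ?out) (Bin Times (Const 2) (reg N 4)) \<le> 2 * L + 20 * L"
    using assms two_X X
    by (intro add_mono tcost_le) (auto simp: ebound_def numeral_2_eq_2[symmetric])
  have test_cost: "tcost w ?s (Read 2 (Const 0)) \<le> 4 + 2 * T"
    using answer_bits[OF assms(5)] by (simp add: tcost_def)
  have "ert w (conclude l) g ?s =
      ert w (vote N l b) (ert w (set_reg N 4 (Bin Times (Const 2) (reg N 4))) g) ?s +
      of_nat (tcost w ?s (Read 2 (Const 0)))"
    unfolding conclude_def ert_Seq ert_If by (simp add: b_def)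
  also have "\<dots> = g (state (fst \<sigma>) i (2 * pw) c ?out) +
     of_nat ((tcost w ?s (Const l) + tcost w ?s (Bin Plus (Read (N + 7) (Const l)) (Bin Times b (reg N 4)))) +
       (tcost w (state (fst \<sigma>) i pw c ?out) (Const 0) +
       tcost w (state (fst \<sigma>) i pw c ?out) (Bin Times (Const 2) (reg N 4))) +
       tcost w ?s (Read 2 (Const 0)))" (is "_ = _ + of_nat ?c")
  proof -
    have st: "store ?s (N + 7) (val w ?s (Const l))
        (val w ?s (Bin Plus (Read (N + 7) (Const l)) (Bin Times b (reg N 4)))) = state (fst \<sigma>) i pw c ?out"
      by (simp add: b(3))
    then show ?thesis
      unfolding vote_def ert_Assign[of w "N + 7"] st set4 by (simp only: of_nat_add ac_simps)
  qed
  also have "\<dots> \<le> g (state (fst \<sigma>) i (2 * pw) c ?out) + of_nat (300 * L + 2 * T)"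
    using vote_cost[OF assms(1-3) assms(4) b(1,2)] set4_cost test_cost L_pos
    by (intro add_left_mono of_nat_mono) linarith
  finally show ?thesis .
qed

definition query_dist :: "nat \<Rightarrow> nat \<Rightarrow> nat \<Rightarrow> kov pmf" where
  "query_dist l pw c = resample k p n d l (row_class pw c) U"

text \<open>One \<open>T\<close> is the run itself. The other two pay for the answer, whose at most
  \<open>T + 1\<close> bits are charged once when it is read and once when it is tested.\<close>

definition query_cost :: nat where
  "query_cost = 1000 * L + N + fill_cost + 3 * T"

text \<open>\<open>G\<close> sees only the row indices found so far: the memory \<open>lo\<close>
  left by the decision program is arbitrary, and the next query clears it.\<close>

lemma ert_ask:
  assumes "pw \<le> X" "c \<le> 1" "l \<le> X" "\<And>x. out x \<le> X"
    and g: "\<And>lo b. b \<le> 1 \<Longrightarrow> g (state lo sz (2 * pw) c (out(l := out l + b * pw))) \<le> G (out(l := out l + b * pw))"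
  shows "ert w (fill k N l) (ert w A (ert w (conclude l) g)) (state (buf n d (\<lambda>_. 0)) 0 pw c out) \<le>
    (\<integral>\<^sup>+V. \<integral>\<^sup>+\<sigma>. G (out(l := out l + ans \<sigma> c * pw)) \<partial>measure_spmf (run_A V) \<partial>query_dist l pw c) +
    of_nat (fill_cost + 300 * L + 3 * T)"
proof -
  let ?F = "\<lambda>f. ert w A (ert w (conclude l) g) (state (buf n d f) sz pw c out)"
  have "ert w (fill k N l) (ert w A (ert w (conclude l) g)) (state (buf n d (\<lambda>_. 0)) 0 pw c out) \<le>
      (\<integral>\<^sup>+f. ?F f \<partial>map_pmf (bitmap sz) (Pi_pmf {0..<sz} False (fill_dist S l pw c))) + of_nat fill_cost"
    using ert_fill[OF content_le assms(1-3)] by simp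
  also have "\<dots> = (\<integral>\<^sup>+V. ?F (content k n d V) \<partial>query_dist l pw c) + of_nat fill_cost"
    unfolding fill_resample query_dist_def by simp
  also have "\<dots> \<le> (\<integral>\<^sup>+V. (\<integral>\<^sup>+\<sigma>. G (out(l := out l + ans \<sigma> c * pw)) \<partial>measure_spmf (run_A V)) +
      of_nat (300 * L + 3 * T) \<partial>query_dist l pw c) + of_nat fill_cost"
  proof (intro add_right_mono nn_integral_mono)
    fix V
    have "?F (content k n d V) = expc (\<lambda>\<sigma>. ert w (conclude l) g (state (fst \<sigma>) sz pw c out) + of_nat (snd \<sigma>)) (run_A V)"
      unfolding ert_def[of w A] ov_input_buf[symmetric] exec_join[OF A] expc_map
      by (simp add: case_prod_unfold)
    also have "\<dots> \<le> expc (\<lambda>\<sigma>. G (out(l := out l + ans \<sigma> c * pw)) + of_nat (300 * L + 3 * T)) (run_A V)"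
    proof (rule expc_mono)
      have sum: "of_nat (300 * L + 2 * T) + of_nat T = (of_nat (300 * L + 3 * T) :: ennreal)"
        unfolding of_nat_add[symmetric] by (rule arg_cong) simp
      fix \<sigma> assume \<sigma>: "\<sigma> \<in> set_spmf (run_A V)"
      have "ert w (conclude l) g (state (fst \<sigma>) sz pw c out) + of_nat (snd \<sigma>) \<le>
          G (out(l := out l + ans \<sigma> c * pw)) + of_nat (300 * L + 2 * T) + of_nat T"
        using assms(2) time[OF \<sigma>]
        by (intro add_mono order_trans[OF ert_conclude[OF assms(1-4) \<sigma>]] g add_right_mono of_nat_mono)
          (auto simp: ans_def)
      then show "ert w (conclude l) g (state (fst \<sigma>) sz pw c out) + of_nat (snd \<sigma>) \<le>
          G (out(l := out l + ans \<sigma> c * pw)) + of_nat (300 * L + 3 * T)"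
        by (simp only: add.assoc sum)
    qed
    also have "\<dots> = (\<integral>\<^sup>+\<sigma>. G (out(l := out l + ans \<sigma> c * pw)) \<partial>measure_spmf (run_A V)) +
        of_nat (300 * L + 3 * T)"
      by (simp add: expc_add_const expc_lossless[OF lossless])
    finally show "?F (content k n d V) \<le> \<dots>" .
  qed
  also have "\<dots> = (\<integral>\<^sup>+V. \<integral>\<^sup>+\<sigma>. G (out(l := out l + ans \<sigma> c * pw)) \<partial>measure_spmf (run_A V) \<partial>query_dist l pw c) +
    of_nat (fill_cost + 300 * L + 3 * T)"
    by (simp add: nn_integral_add ac_simps)
  finally show ?thesis .
qed

lemma ert_query:
  assumes "pw \<le> X" "l \<le> X" "\<And>x. out x \<le> X"
    and g: "\<And>lo b c. b \<le> 1 \<Longrightarrow> c \<le> 1 \<Longrightarrow>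
      g (state lo sz (2 * pw) c (out(l := out l + b * pw))) \<le> G (out(l := out l + b * pw))"
  shows "ert w (query k N A l) g (state lo i pw c0 out) \<le>
    ((\<integral>\<^sup>+V. \<integral>\<^sup>+\<sigma>. G (out(l := out l + ans \<sigma> 1 * pw)) \<partial>measure_spmf (run_A V) \<partial>query_dist l pw 1) +
     (\<integral>\<^sup>+V. \<integral>\<^sup>+\<sigma>. G (out(l := out l + ans \<sigma> 0 * pw)) \<partial>measure_spmf (run_A V) \<partial>query_dist l pw 0)) / 2 +
    of_nat query_cost"
proof -
  define Q where "Q c = (\<integral>\<^sup>+V. \<integral>\<^sup>+\<sigma>. G (out(l := out l + ans \<sigma> c * pw)) \<partial>measure_spmf (run_A V) \<partial>query_dist l pw c)" for c
  let ?g = "ert w (fill k N l) (ert w A (ert w (conclude l) g))"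
  let ?m0 = "state (\<lambda>_ _. 0) i pw c0 out"
  let ?m1 = "state (store (\<lambda>_ _. 0) 0 0 n) i pw c0 out"
  let ?m2 = "state (buf n d (\<lambda>_. 0)) i pw c0 out"
  let ?m3 = "\<lambda>c. state (buf n d (\<lambda>_. 0)) i pw c out"
  let ?c = "fill_cost + 300 * L + 3 * T"
  have buf: "store (store (\<lambda>_ _. 0) 0 0 n) 0 (Suc 0) d = buf n d (\<lambda>_. 0)"
    by (auto simp: store_def buf_def fun_eq_iff)
  have ask: "?g (state (buf n d (\<lambda>_. 0)) 0 pw c out) \<le> Q c + of_nat ?c" if "c \<le> 1" for c
    unfolding Q_def by (rule ert_ask[OF assms(1) that assms(2,3)]) (rule g[OF _ that])
  have set3: "ert w (set_reg N 3 (Const 0)) ?g (?m3 c) \<le> Q c + of_nat (?c + 4 * L)" if "c \<le> 1" for c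
  proof -
    have "tcost w (?m3 c) (Const 0) + tcost w (?m3 c) (Const 0) \<le> 2 * L + 2 * L"
      using two_X by (intro add_mono tcost_le) (auto simp: ebound_def numeral_2_eq_2[symmetric])
    then have "of_nat (tcost w (?m3 c) (Const 0) + tcost w (?m3 c) (Const 0)) \<le> (of_nat (4 * L) :: ennreal)"
      by (intro of_nat_mono) simp
    then have "ert w (set_reg N 3 (Const 0)) ?g (?m3 c) \<le> (Q c + of_nat ?c) + of_nat (4 * L)"
      unfolding ert_Assign using ask[OF that] by (intro add_mono) simp_all
    then show ?thesis by (simp only: of_nat_add add.assoc)
  qed
  have flip_cost: "tcost w ?m2 (Const 0) + 1 \<le> 3 * L"
    using tcost_le[of ?m2 "Const 0" 2] L_pos
    by (simp add: ebound_def numeral_2_eq_2[symmetric] del: bits_pos)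
  have "ert w (Flip (N + 5) (Const 0)) (ert w (set_reg N 3 (Const 0)) ?g) ?m2 =
      (ert w (set_reg N 3 (Const 0)) ?g (?m3 1) + ert w (set_reg N 3 (Const 0)) ?g (?m3 0)) / 2 +
      of_nat (tcost w ?m2 (Const 0) + 1)"
    unfolding ert_Flip by simp
  also have "\<dots> \<le> ((Q 1 + of_nat (?c + 4 * L)) + (Q 0 + of_nat (?c + 4 * L))) / 2 + of_nat (3 * L)"
    by (intro add_mono divide_right_mono_ennreal set3 of_nat_mono flip_cost) simp_all
  also have "\<dots> \<le> (Q 1 + Q 0) / 2 + of_nat (?c + 7 * L)"
    by (rule ennreal_half_le) simp
  finally have flip: "ert w (Flip (N + 5) (Const 0)) (ert w (set_reg N 3 (Const 0)) ?g) ?m2 \<le>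
    (Q 1 + Q 0) / 2 + of_nat (?c + 7 * L)" .
  have init_cost: "(tcost w ?m1 (Const 1) + tcost w ?m1 (reg N 2)) +
      (tcost w ?m0 (Const 0) + tcost w ?m0 (reg N 1)) \<le> (2 * L + 6 * L) + (2 * L + 6 * L)"
    using two_X X
    by (intro add_mono tcost_le) (auto simp: ebound_def numeral_2_eq_2[symmetric])
  have "ert w (query k N A l) g (state lo i pw c0 out) =
     ert w (Flip (N + 5) (Const 0)) (ert w (set_reg N 3 (Const 0)) ?g) ?m2 +
     of_nat ((tcost w ?m1 (Const 1) + tcost w ?m1 (reg N 2)) +
      (tcost w ?m0 (Const 0) + tcost w ?m0 (reg N 1)) + (N + 1))"
    unfolding query_def conclude_def[symmetric] ert_Seq ert_clears_all
    by (simp add: ert_Assign buf ac_simps)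
  also have "\<dots> \<le> ((Q 1 + Q 0) / 2 + of_nat (?c + 7 * L)) + of_nat (16 * L + N + 1)"
    by (rule add_mono[OF flip of_nat_mono]) (use init_cost in linarith)
  also have "\<dots> = (Q 1 + Q 0) / 2 + of_nat (?c + 7 * L + (16 * L + N + 1))"
    by (simp only: of_nat_add ac_simps)
  also have "\<dots> \<le> (Q 1 + Q 0) / 2 + of_nat query_cost"
    using L_pos by (intro add_left_mono of_nat_mono) (simp add: query_cost_def del: bits_pos)
  finally show ?thesis unfolding Q_def .
qed

end

section \<open>The whole search\<close>

context reduction
begin

text \<open>Bits are determined from the lowest upwards, so after \<open>b\<close> queries row
  \<open>l\<close> should be known modulo \<open>2 ^ b\<close>, with all earlier rows
  complete.\<close>

definition wrong :: "(nat \<Rightarrow> nat) \<Rightarrow> nat \<Rightarrow> nat \<Rightarrow> (nat \<Rightarrow> nat) \<Rightarrow> bool" where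
  "wrong s l b out \<longleftrightarrow> (\<exists>l'<l. out l' \<noteq> s l') \<or> out l \<noteq> s l mod 2 ^ b"

definition misled :: "(nat \<Rightarrow> nat) \<Rightarrow> nat \<Rightarrow> nat \<Rightarrow> nat \<Rightarrow> config \<Rightarrow> bool" where
  "misled s l pw c \<sigma> \<longleftrightarrow> (fst \<sigma> 2 0 \<noteq> 0) \<noteq> (c = s l div pw mod 2)"

definition half_error :: "(nat \<Rightarrow> nat) \<Rightarrow> nat \<Rightarrow> nat \<Rightarrow> nat \<Rightarrow> ennreal" where
  "half_error s l pw c = (\<integral>\<^sup>+V. \<integral>\<^sup>+\<sigma>. of_bool (misled s l pw c \<sigma>) \<partial>measure_spmf (run_A V) \<partial>query_dist l pw c)"

definition query_error :: "(nat \<Rightarrow> nat) \<Rightarrow> nat \<Rightarrow> nat \<Rightarrow> ennreal" where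
  "query_error s l pw = (half_error s l pw 1 + half_error s l pw 0) / 2"

text \<open>The union bound in one step: an answer that does not mislead adds exactly bit
  \<open>b\<close> of \<open>s l\<close>, so a new mistake is always due to a misleading
  answer.\<close>

lemma wrong_step:
  assumes "c \<le> 1" "wrong s l (Suc b) (out(l := out l + ans \<sigma> c * 2 ^ b))"
  shows "wrong s l b out \<or> misled s l (2 ^ b) c \<sigma>"
proof (rule ccontr)
  assume *: "\<not> ?thesis"
  let ?bit = "s l div 2 ^ b mod 2"
  have "?bit \<le> 1" by simp
  with * assms(1) have "ans \<sigma> c = ?bit"
    unfolding ans_def misled_def by auto
  moreover have "s l mod 2 ^ Suc b = s l mod 2 ^ b + ?bit * 2 ^ b"
    using mod_mult2_eq[of "s l" "2 ^ b" 2] by (simp add: mult.commute)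
  ultimately show False using * assms(2) by (auto simp: wrong_def)
qed

text \<open>Only the last weight can reach or exceed \<open>n\<close>, and half of it is still below
  \<open>n\<close>.\<close>

lemma two_power_le: "b \<le> q \<Longrightarrow> 2 ^ b \<le> 2 * n"
proof (cases b)
  case 0
  then show ?thesis using n by simp
next
  case (Suc b')
  assume "b \<le> q"
  with Suc q(1)[of b'] show ?thesis by simp
qed

lemma half_vote_le:
  assumes c: "c \<le> 1"
    and G: "\<And>out'. G out' = r * of_bool (wrong s l (Suc b) out') + R"
  shows "(\<integral>\<^sup>+V. \<integral>\<^sup>+\<sigma>. G (out(l := out l + ans \<sigma> c * 2 ^ b)) \<partial>measure_spmf (run_A V) \<partial>query_dist l (2 ^ b) c) \<le>
    r * of_bool (wrong s l b out) + R + r * half_error s l (2 ^ b) c"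
proof -
  have "(\<integral>\<^sup>+V. \<integral>\<^sup>+\<sigma>. G (out(l := out l + ans \<sigma> c * 2 ^ b)) \<partial>measure_spmf (run_A V) \<partial>query_dist l (2 ^ b) c) \<le>
    (\<integral>\<^sup>+V. r * (\<integral>\<^sup>+\<sigma>. of_bool (misled s l (2 ^ b) c \<sigma>) \<partial>measure_spmf (run_A V)) +
      (r * of_bool (wrong s l b out) + R) \<partial>query_dist l (2 ^ b) c)"
  proof (rule nn_integral_mono)
    fix V
    have "(\<integral>\<^sup>+\<sigma>. G (out(l := out l + ans \<sigma> c * 2 ^ b)) \<partial>measure_spmf (run_A V)) \<le>
        (\<integral>\<^sup>+\<sigma>. r * of_bool (misled s l (2 ^ b) c \<sigma>) + (r * of_bool (wrong s l b out) + R) \<partial>measure_spmf (run_A V))"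
    proof (rule nn_integral_mono)
      fix \<sigma>
      show "G (out(l := out l + ans \<sigma> c * 2 ^ b)) \<le>
          r * of_bool (misled s l (2 ^ b) c \<sigma>) + (r * of_bool (wrong s l b out) + R)"
        using wrong_step[OF c, of s l b out \<sigma>] unfolding G
        by (cases "wrong s l b out"; cases "misled s l (2 ^ b) c \<sigma>";
            cases "wrong s l (Suc b) (out(l := out l + ans \<sigma> c * 2 ^ b))")
          (simp_all add: add_increasing add_increasing2 del: One_nat_def)
    qed
    also have "\<dots> = r * (\<integral>\<^sup>+\<sigma>. of_bool (misled s l (2 ^ b) c \<sigma>) \<partial>measure_spmf (run_A V)) +
        (r * of_bool (wrong s l b out) + R)"
      unfolding expc_lossless[OF lossless, symmetric] expc_add_const
      by (simp add: expc_lossless[OF lossless] nn_integral_cmult)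
    finally show "(\<integral>\<^sup>+\<sigma>. G (out(l := out l + ans \<sigma> c * 2 ^ b)) \<partial>measure_spmf (run_A V)) \<le> \<dots>" .
  qed
  also have "\<dots> = r * half_error s l (2 ^ b) c + (r * of_bool (wrong s l b out) + R)"
    by (simp add: nn_integral_add nn_integral_cmult half_error_def)
  finally show ?thesis by (simp add: ac_simps)
qed

definition block_cost :: nat where "block_cost = q * (query_cost + 30 * L) + 40 * L"

text \<open>\<open>query_error\<close> does not mention the row indices found so far. Hence the
  errors still to come form a fixed sum inside \<open>E b\<close>, to which the invariant adds the
  mistakes already made and the remaining time \<open>C b\<close>.\<close>

lemma ert_block:
  assumes l: "l \<le> X" and out: "out l = 0" "\<And>x. out x \<le> 2 * n" and s: "s l < n"
    and g: "\<And>lo i pw c out'. (\<And>x. out' x \<le> 2 * n) \<Longrightarrow> (\<And>x. x \<noteq> l \<Longrightarrow> out' x = out x) \<Longrightarrow>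
      g (state lo i pw c out') \<le> r * of_bool (\<exists>l'<Suc l. out' l' \<noteq> s l') + R"
  shows "ert w (block k N A l) g (state lo i pw c out) \<le>
    r * of_bool (\<exists>l'<l. out l' \<noteq> s l') + r * (\<Sum>b<q. query_error s l (2 ^ b)) + R + of_nat block_cost"
proof -
  \<comment> \<open>Wrong answers may push the current index past \<open>n\<close>, but as it is
    below \<open>2 ^ b\<close> it stays within \<open>2 * n\<close>.\<close>
  define XX where "XX = {(b :: nat, lo :: mem, i :: nat, c :: nat, out'). b \<le> q \<and> out' l < 2 ^ b \<and>
    (\<forall>x. out' x \<le> 2 * n) \<and> (\<forall>x. x \<noteq> l \<longrightarrow> out' x = out x)}"
  define st where "st = (\<lambda>(b :: nat, lo, i, c, out'). state lo i (2 ^ b) c out')"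
  define E where "E b = r * (\<Sum>b'\<in>{b..<q}. query_error s l (2 ^ b')) + R" for b
  define C where "C b = (q - b) * (query_cost + 30 * L) + 30 * L" for b
  define J where "J = (\<lambda>(b, lo :: mem, i :: nat, c :: nat, out'). r * of_bool (wrong s l b out') + E b + of_nat (C b))"
  let ?test = "Bin Minus (reg N 1) (reg N 4)"
  have loop: "ert w (While ?test (query k N A l)) g (st x) \<le> J x" if "x \<in> XX" for x
  proof (rule ert_While_le[OF _ that])
    fix x h assume x: "x \<in> XX" and h: "\<And>y. y \<in> XX \<Longrightarrow> h (st y) \<le> J y"
    obtain b lo i c out' where xeq: "x = (b, lo, i, c, out')" by (metis surj_pair)
    have b: "b \<le> q" and out': "out' l < 2 ^ b" "\<And>x. out' x \<le> 2 * n" "\<And>x. x \<noteq> l \<Longrightarrow> out' x = out x"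
      using x by (auto simp: XX_def xeq)
    have bX: "2 ^ b \<le> X" using two_power_le[OF b] X by linarith
    have "tcost w (st x) ?test \<le> 30 * L"
      using bX two_X by (intro tcost_le) (auto simp: xeq st_def ebound_def numeral_2_eq_2[symmetric])
    then have cost: "of_nat (tcost w (st x) ?test) \<le> (of_nat (30 * L) :: ennreal)"
      by (rule of_nat_mono)
    have val: "val w (st x) ?test = n - 2 ^ b" by (simp add: xeq st_def)
    show "(if val w (st x) ?test \<noteq> 0 then ert w (query k N A l) h (st x) else g (st x)) +
        of_nat (tcost w (st x) ?test) \<le> J x"
    proof (cases "b < q")
      case False
      with b have b: "b = q" by simp
      have "s l mod 2 ^ q = s l" using s q(2) by simp
      then have "wrong s l b out' \<longleftrightarrow> (\<exists>l'<Suc l. out' l' \<noteq> s l')"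
        by (auto simp: wrong_def b less_Suc_eq)
      then have "g (st x) \<le> r * of_bool (wrong s l b out') + R"
        using g[OF out'(2,3)] by (simp add: xeq st_def)
      then have "g (st x) + of_nat (tcost w (st x) ?test) \<le> r * of_bool (wrong s l b out') + R + of_nat (30 * L)"
        by (intro add_mono cost)
      then show ?thesis unfolding val using q(2) by (simp add: xeq J_def E_def C_def b)
    next
      case True
      then have n: "2 ^ b < n" by (rule q(1))
      define G where "G out'' = r * of_bool (wrong s l (Suc b) out'') + (E (Suc b) + of_nat (C (Suc b)))" for out''
      let ?Q = "\<lambda>c. \<integral>\<^sup>+V. \<integral>\<^sup>+\<sigma>. G (out'(l := out' l + ans \<sigma> c * 2 ^ b)) \<partial>measure_spmf (run_A V) \<partial>query_dist l (2 ^ b) c"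
      let ?W = "r * of_bool (wrong s l b out') + (E (Suc b) + of_nat (C (Suc b)))"
      have Q: "?Q c \<le> ?W + r * half_error s l (2 ^ b) c" if "c \<le> 1" for c
        by (rule half_vote_le[OF that]) (simp add: G_def)
      have "ert w (query k N A l) h (state lo i (2 ^ b) c out') \<le> (?Q 1 + ?Q 0) / 2 + of_nat query_cost"
      proof (rule ert_query[OF bX l])
        show "out' x \<le> X" for x using out'(2)[of x] X by linarith
        fix lo' :: mem and a c' :: nat assume a: "a \<le> 1"
        let ?o = "out'(l := out' l + a * 2 ^ b)"
        have "out' l + a * 2 ^ b < 2 ^ Suc b" using out'(1) a by (cases a) auto
        moreover have "(2 :: nat) ^ Suc b \<le> 2 * n" using n by simp
        ultimately have l_bound: "out' l + a * 2 ^ b < 2 ^ Suc b" "out' l + a * 2 ^ b \<le> 2 * n"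
          by linarith+
        have "?o x \<le> 2 * n" for x using l_bound(2) out'(2)[of x] by simp
        with l_bound(1) have "(Suc b, lo', sz, c', ?o) \<in> XX"
          using True out'(3) by (simp add: XX_def)
        from h[OF this] show "h (state lo' sz (2 * 2 ^ b) c' ?o) \<le> G ?o"
          by (simp add: st_def J_def G_def ac_simps)
      qed
      also have "\<dots> \<le> ((?W + r * half_error s l (2 ^ b) 1) + (?W + r * half_error s l (2 ^ b) 0)) / 2 + of_nat query_cost"
        by (intro add_right_mono divide_right_mono_ennreal add_mono Q) simp_all
      also have "\<dots> = ?W + r * query_error s l (2 ^ b) + of_nat query_cost"
      proof -
        have "((?W + r * half_error s l (2 ^ b) 1) + (?W + r * half_error s l (2 ^ b) 0)) =
            2 * ?W + r * (half_error s l (2 ^ b) 1 + half_error s l (2 ^ b) 0)"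
          by (simp only: mult_2 distrib_left add_ac)
        moreover have "(2 * W + Y) / 2 = W + Y / 2" for W Y :: ennreal
          by (simp add: add_divide_distrib_ennreal ennreal_mult_divide_eq mult.commute[of 2])
        ultimately show ?thesis
          by (simp only: query_error_def ennreal_times_divide)
      qed
      finally have "ert w (query k N A l) h (st x) + of_nat (tcost w (st x) ?test) \<le>
          ?W + r * query_error s l (2 ^ b) + of_nat query_cost + of_nat (30 * L)"
        by (intro add_mono cost) (simp add: xeq st_def)
      also have "\<dots> = r * of_bool (wrong s l b out') +
         (r * (query_error s l (2 ^ b) + (\<Sum>b'\<in>{Suc b..<q}. query_error s l (2 ^ b'))) + R) +
         of_nat (C (Suc b) + query_cost + 30 * L)"
        by (simp only: E_def distrib_left of_nat_add ac_simps)
      also have "query_error s l (2 ^ b) + (\<Sum>b'\<in>{Suc b..<q}. query_error s l (2 ^ b')) =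
          (\<Sum>b'\<in>{b..<q}. query_error s l (2 ^ b'))"
        using True by (simp add: sum.atLeast_Suc_lessThan)
      also have "C (Suc b) + query_cost + 30 * L = C b"
      proof -
        have "q - b = Suc (q - Suc b)" using True by simp
        then show ?thesis unfolding C_def by simp
      qed
      finally show ?thesis using n unfolding val by (simp add: xeq J_def E_def)
    qed
  qed
  let ?m = "state lo i pw c out"
  have "tcost w ?m (Const 0) + tcost w ?m (Const 1) \<le> 2 * L + 2 * L"
    using two_X by (intro add_mono tcost_le) (auto simp: ebound_def numeral_2_eq_2[symmetric])
  then have cost: "of_nat (tcost w ?m (Const 0) + tcost w ?m (Const 1)) \<le> (of_nat (4 * L) :: ennreal)"
    by (intro of_nat_mono) simp
  have "(0, lo, i, c, out) \<in> XX" using out by (simp add: XX_def)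
  from loop[OF this] have "ert w (While ?test (query k N A l)) g (state lo i 1 c out) \<le> J (0, lo, i, c, out)"
    by (simp add: st_def)
  then have "ert w (block k N A l) g ?m \<le> J (0, lo, i, c, out) + of_nat (4 * L)"
    unfolding block_def ert_Seq ert_Assign by (intro add_mono cost) simp
  also have "\<dots> = r * of_bool (\<exists>l'<l. out l' \<noteq> s l') + r * (\<Sum>b<q. query_error s l (2 ^ b)) + R + of_nat (C 0 + 4 * L)"
    by (simp add: J_def E_def wrong_def out atLeast0LessThan ac_simps)
  also have "\<dots> \<le> r * of_bool (\<exists>l'<l. out l' \<noteq> s l') + r * (\<Sum>b<q. query_error s l (2 ^ b)) + R + of_nat block_cost"
    by (intro add_left_mono of_nat_mono) (simp add: C_def block_cost_def)
  finally show ?thesis .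
qed

lemma ert_blocks:
  assumes "l \<le> k" and s: "\<And>l. l < k \<Longrightarrow> s l < n"
    and "\<And>lo i pw c out. (\<And>x. out x \<le> 2 * n) \<Longrightarrow> (\<And>x. l \<le> x \<Longrightarrow> out x = 0) \<Longrightarrow>
      g (state lo i pw c out) \<le> r * of_bool (\<exists>l'<l. out l' \<noteq> s l') + R"
  shows "ert w (blocks k N A l) g (state lo i pw c (\<lambda>_. 0)) \<le>
    r * (\<Sum>l'<l. \<Sum>b<q. query_error s l' (2 ^ b)) + R + of_nat (l * block_cost + 1)"
  using assms(1,3)
proof (induction l arbitrary: g R)
  case 0
  have "g (state lo i pw c (\<lambda>_. 0)) \<le> r * of_bool (\<exists>l'<0. (\<lambda>_. 0) l' \<noteq> s l') + R"
    by (intro 0) simp_all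
  then show ?case by (simp add: ert_Skip add_right_mono)
next
  case (Suc l)
  \<comment> \<open>For the earlier blocks the last one is part of the continuation, so its error
    and cost move into the constant.\<close>
  let ?R = "r * (\<Sum>b<q. query_error s l (2 ^ b)) + R + of_nat block_cost"
  have "ert w (blocks k N A l) (ert w (block k N A l) g) (state lo i pw c (\<lambda>_. 0)) \<le>
      r * (\<Sum>l'<l. \<Sum>b<q. query_error s l' (2 ^ b)) + ?R + of_nat (l * block_cost + 1)"
  proof (rule Suc.IH)
    fix lo i pw c and out :: "nat \<Rightarrow> nat"
    assume out: "\<And>x. out x \<le> 2 * n" "\<And>x. l \<le> x \<Longrightarrow> out x = 0"
    have "ert w (block k N A l) g (state lo i pw c out) \<le>
      r * of_bool (\<exists>l'<l. out l' \<noteq> s l') + r * (\<Sum>b<q. query_error s l (2 ^ b)) + R + of_nat block_cost"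
    proof (rule ert_block)
      fix lo i pw c and out' :: "nat \<Rightarrow> nat"
      assume out': "\<And>x. out' x \<le> 2 * n" "\<And>x. x \<noteq> l \<Longrightarrow> out' x = out x"
      show "g (state lo i pw c out') \<le> r * of_bool (\<exists>l'<Suc l. out' l' \<noteq> s l') + R"
        using out' out(2) by (intro Suc.prems(2)) auto
    qed (use out Suc.prems(1) X s in auto)
    then show "ert w (block k N A l) g (state lo i pw c out) \<le> r * of_bool (\<exists>l'<l. out l' \<noteq> s l') + ?R"
      by (simp add: ac_simps)
  qed (use Suc.prems in simp)
  then show ?case by (simp add: ert_Seq distrib_left ac_simps)
qed

lemma ert_outputs:
  assumes "l \<le> k" "\<And>x. out x \<le> X"
  shows "ert w (outputs N l) g (state lo i pw c out) \<le>
    g (state (lo(2 := (\<lambda>x. if x < l then out x else 0))) i pw c out) + of_nat (l * (10 * L) + 1)"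
  using assms(1)
proof (induction l arbitrary: g)
  case 0
  have *: "(state lo i pw c out)(2 := (\<lambda>_. 0)) = state (lo(2 := (\<lambda>x. if x < 0 then out x else 0))) i pw c out"
    by (auto simp: fun_eq_iff join_def)
  show ?case unfolding outputs.simps ert_Clear *
    by (simp only: mult_zero_left add_0 of_nat_1 order_refl)
next
  case (Suc l)
  let ?m = "state (lo(2 := (\<lambda>x. if x < l then out x else 0))) i pw c out"
  have st: "store ?m 2 l (out l) = state (lo(2 := (\<lambda>x. if x < Suc l then out x else 0))) i pw c out"
    by (auto simp: store_def fun_eq_iff less_Suc_eq join_def)
  have "tcost w ?m (Const l) + tcost w ?m (Read (N + 7) (Const l)) \<le> 2 * L + 6 * L"
    using assms(2) Suc.prems X
    by (intro add_mono tcost_le) (auto simp: ebound_def numeral_2_eq_2[symmetric])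
  then have cost: "of_nat (tcost w ?m (Const l) + tcost w ?m (Read (N + 7) (Const l))) \<le> (of_nat (10 * L) :: ennreal)"
    by (intro of_nat_mono) simp
  have "ert w (outputs N (Suc l)) g (state lo i pw c out) \<le>
      ert w (Assign 2 (Const l) (Read (N + 7) (Const l))) g ?m + of_nat (l * (10 * L) + 1)"
    unfolding outputs.simps ert_Seq using Suc by (intro Suc.IH) simp
  also have "\<dots> \<le> g (state (lo(2 := (\<lambda>x. if x < Suc l then out x else 0))) i pw c out) + of_nat (10 * L) + of_nat (l * (10 * L) + 1)"
    unfolding ert_Assign by (intro add_right_mono add_mono cost) (simp add: st)
  finally show ?case by (simp only: mult_Suc of_nat_add add_ac)
qed

definition save_cost :: nat where "save_cost = (sz + 1) * (300 * L) + 100 * L"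

lemma ert_save:
  "ert w (save k N) g (ov_input k n d U) \<le>
    g (state (ov_input k n d U) sz 0 0 (\<lambda>_. 0)) + of_nat save_cost"
proof -
  define st where "st i = join N (ov_input k n d U) (regs (\<lambda>x. if x < i then S x else 0) n d i 0 0 0 (\<lambda>_. 0))" for i
  define J where "J i = g (state (ov_input k n d U) sz 0 0 (\<lambda>_. 0)) + of_nat ((sz - i + 1) * (300 * L))" for i
  have "ert w (While (remaining k N) (Seq (Assign N (reg N 3) (Read 1 (reg N 3))) (step N))) g (st 0) \<le> J 0"
  proof (rule ert_While_le[where X = "{i. i \<le> sz}"])
    fix i h assume "i \<in> {i. i \<le> sz}" and h: "\<And>y. y \<in> {i. i \<le> sz} \<Longrightarrow> h (st y) \<le> J y"
    then have i: "i \<le> sz" by simp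
    have rc: "tcost w (st i) (remaining k N) \<le> 200 * L"
      using remaining_cost[OF i] by (simp add: st_def)
    show "(if val w (st i) (remaining k N) \<noteq> 0
          then ert w (Seq (Assign N (reg N 3) (Read 1 (reg N 3))) (step N)) h (st i)
          else g (st i)) + of_nat (tcost w (st i) (remaining k N)) \<le> J i"
    proof (cases "i < sz")
      case False
      with i have i: "i = sz" by simp
      have S: "(\<lambda>x. if x < sz then S x else 0) = S" by (auto simp: content_def)
      have "g (st i) + of_nat (tcost w (st i) (remaining k N)) \<le> g (st i) + of_nat (300 * L)"
        using rc by (intro add_left_mono of_nat_mono) linarith
      moreover have "st i = state (ov_input k n d U) sz 0 0 (\<lambda>_. 0)"
        unfolding st_def i S ..
      moreover have "val w (st i) (remaining k N) = 0" by (simp add: st_def i remaining_val)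
      ultimately show ?thesis unfolding J_def by (simp add: i)
    next
      case True
      let ?m = "store (st i) N i (S i)"
      have m: "?m = join N (ov_input k n d U) (regs (\<lambda>x. if x < Suc i then S x else 0) n d i 0 0 0 (\<lambda>_. 0))"
        unfolding st_def by (simp, rule arg_cong[of _ _ "\<lambda>f. join N _ (regs f n d i 0 0 0 _)"])
          (auto simp: fun_eq_iff less_Suc_eq)
      have "S i \<le> X" using content_le[of k n d U i] two_X by linarith
      then have "tcost w (st i) (reg N 3) + tcost w (st i) (Read 1 (reg N 3)) \<le> 6 * L + 12 * L"
        using two_X X True
        by (intro add_mono tcost_le) (auto simp: st_def ov_input_buf ebound_def numeral_2_eq_2[symmetric])
      then have cost: "30 * L + (tcost w (st i) (reg N 3) + tcost w (st i) (Read 1 (reg N 3))) +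
          tcost w (st i) (remaining k N) \<le> 300 * L"
        using rc by linarith
      have "ert w (step N) h ?m \<le> h (st (Suc i)) + of_nat (30 * L)"
        unfolding m using ert_step[OF True] by (simp add: st_def)
      also have "\<dots> \<le> J (Suc i) + of_nat (30 * L)"
        using True by (intro add_right_mono h) simp
      finally have "ert w (Seq (Assign N (reg N 3) (Read 1 (reg N 3))) (step N)) h (st i) +
          of_nat (tcost w (st i) (remaining k N)) \<le>
          J (Suc i) + of_nat (30 * L) + of_nat (tcost w (st i) (reg N 3) + tcost w (st i) (Read 1 (reg N 3))) +
          of_nat (tcost w (st i) (remaining k N))"
        unfolding ert_Seq ert_Assign
        by (intro add_right_mono) (simp add: st_def ov_input_buf)
      also have "\<dots> = J (Suc i) + of_nat (30 * L + (tcost w (st i) (reg N 3) + tcost w (st i) (Read 1 (reg N 3))) +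
          tcost w (st i) (remaining k N))"
        by (simp only: of_nat_add add.assoc)
      also have "\<dots> \<le> J (Suc i) + of_nat (300 * L)"
        by (intro add_left_mono of_nat_mono cost)
      also have "\<dots> = J i"
      proof -
        have "sz - i + 1 = Suc (sz - Suc i + 1)" using True by simp
        then have *: "(sz - i + 1) * (300 * L) = 300 * L + (sz - Suc i + 1) * (300 * L)"
          by (simp only: mult_Suc)
        show ?thesis unfolding J_def * by (simp only: of_nat_add ac_simps)
      qed
      finally show ?thesis using True by (simp add: st_def remaining_val)
    qed
  qed simp
  moreover define m0 where "m0 = join N (ov_input k n d U) (regs (\<lambda>_. 0) 0 0 0 0 0 0 (\<lambda>_. 0))"
  define m1 where "m1 = join N (ov_input k n d U) (regs (\<lambda>_. 0) n 0 0 0 0 0 (\<lambda>_. 0))"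
  \<comment> \<open>All arrays from \<open>N\<close> on are zero, so the input already has the
    joined form, with every register 0.\<close>
  have init: "ov_input k n d U = m0"
    using N_simps by (auto simp: m0_def join_def regs_def ov_input_def fun_eq_iff cell_zero)
  have "(tcost w m1 (Const 0) + tcost w m1 (Read 0 (Const 1))) +
      (tcost w m0 (Const 0) + tcost w m0 (Read 0 (Const 0))) \<le> (2 * L + 6 * L) + (2 * L + 6 * L)"
    using two_X X
    by (intro add_mono tcost_le) (auto simp: m0_def m1_def ov_input_buf ebound_def numeral_2_eq_2[symmetric])
  then have cost: "of_nat ((tcost w m1 (Const 0) + tcost w m1 (Read 0 (Const 1))) +
      (tcost w m0 (Const 0) + tcost w m0 (Read 0 (Const 0)))) \<le> (of_nat (100 * L) :: ennreal)"
    by (intro of_nat_mono) simp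
  have "ert w (save k N) g m0 =
     ert w (While (remaining k N) (Seq (Assign N (reg N 3) (Read 1 (reg N 3))) (step N))) g (st 0) +
     of_nat ((tcost w m1 (Const 0) + tcost w m1 (Read 0 (Const 1))) +
      (tcost w m0 (Const 0) + tcost w m0 (Read 0 (Const 0))))"
    unfolding save_def ert_Seq
    by (simp add: ert_Assign m0_def m1_def st_def ov_input_buf ac_simps)
  ultimately have "ert w (save k N) g m0 \<le> J 0 + of_nat (100 * L)"
    using cost by (simp add: add_mono)
  then show ?thesis
    unfolding init[symmetric] by (simp add: J_def save_cost_def ac_simps)
qed

definition search_cost :: nat where
  "search_cost = save_cost + (k * block_cost + 1) + (k * (10 * L) + 1)"

text \<open>True for every instance \<open>U\<close> and every admissible \<open>s\<close>. Planting
  enters only when the query errors are averaged over \<open>U\<close>.\<close>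

lemma ert_search:
  assumes s: "\<And>l. l < k \<Longrightarrow> s l < n"
  shows "ert w (search k N A) (\<lambda>m. r * of_bool (\<exists>l<k. m 2 l \<noteq> s l)) (ov_input k n d U) \<le>
    r * (\<Sum>l<k. \<Sum>b<q. query_error s l (2 ^ b)) + of_nat search_cost"
proof -
  let ?g = "\<lambda>m :: mem. r * of_bool (\<exists>l<k. m 2 l \<noteq> s l)"
  have "ert w (blocks k N A k) (ert w (outputs N k) ?g) (state (ov_input k n d U) sz 0 0 (\<lambda>_. 0)) \<le>
      r * (\<Sum>l<k. \<Sum>b<q. query_error s l (2 ^ b)) + of_nat (k * (10 * L) + 1) + of_nat (k * block_cost + 1)"
  proof (rule ert_blocks[OF order_refl s])
    fix lo i pw c and out :: "nat \<Rightarrow> nat" assume out: "\<And>x. out x \<le> 2 * n"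
    have "out x \<le> X" for x using out[of x] X by linarith
    from ert_outputs[OF order_refl this, of ?g lo i pw c]
    show "ert w (outputs N k) ?g (state lo i pw c out) \<le>
        r * of_bool (\<exists>l'<k. out l' \<noteq> s l') + of_nat (k * (10 * L) + 1)"
      by (simp cong: conj_cong)
  qed
  then have "ert w (blocks k N A k) (ert w (outputs N k) ?g) (state (ov_input k n d U) sz 0 0 (\<lambda>_. 0)) +
      of_nat save_cost \<le>
      r * (\<Sum>l<k. \<Sum>b<q. query_error s l (2 ^ b)) + of_nat (k * (10 * L) + 1) + of_nat (k * block_cost + 1) + of_nat save_cost"
    by (rule add_right_mono)
  also have "\<dots> = r * (\<Sum>l<k. \<Sum>b<q. query_error s l (2 ^ b)) + of_nat search_cost"
    by (simp only: search_cost_def of_nat_add ac_simps)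
  finally show ?thesis
    unfolding search_def ert_Seq by (rule order_trans[OF ert_save])
qed

end

section \<open>Error probability\<close>

text \<open>Any nonzero answer counts as a yes, so this is at most the failure probability behind
  \<open>solves_decision\<close>, which insists on exactly 0 or 1.\<close>

definition decision_error :: "(nat \<Rightarrow> nat) \<Rightarrow> com \<Rightarrow> nat \<Rightarrow> nat \<Rightarrow> nat \<Rightarrow> bool \<Rightarrow> kov \<Rightarrow> ennreal" where
  "decision_error w A k n d \<beta> V =
     (\<integral>\<^sup>+\<sigma>. of_bool ((fst \<sigma> 2 0 \<noteq> 0) \<noteq> \<beta>) \<partial>measure_spmf (exec w A (ov_input k n d V, 0)))"

definition bit_error ::
    "(nat \<Rightarrow> nat) \<Rightarrow> com \<Rightarrow> nat \<Rightarrow> nat \<Rightarrow> nat \<Rightarrow> real \<Rightarrow> (nat \<Rightarrow> nat) \<Rightarrow> nat \<Rightarrow> nat \<Rightarrow> nat \<Rightarrow> kov \<Rightarrow> ennreal" where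
  "bit_error w A k n d p s l pw c U = (\<integral>\<^sup>+V. decision_error w A k n d (c = s l div pw mod 2) V
     \<partial>resample k p n d l (row_class pw c) U)"

lemma (in reduction) search_error_le:
  assumes s: "\<And>l. l < k \<Longrightarrow> s l < n"
  shows "expc (\<lambda>\<sigma>. of_bool (\<exists>l<k. fst \<sigma> 2 l \<noteq> s l)) (exec w (search k N A) (ov_input k n d U, 0)) \<le>
    (\<Sum>l<k. \<Sum>b<q. (bit_error w A k n d p s l (2 ^ b) 1 U + bit_error w A k n d p s l (2 ^ b) 0 U) / 2)"
proof -
  have "half_error s l pw c = bit_error w A k n d p s l pw c U" for l pw c
    unfolding half_error_def bit_error_def decision_error_def query_dist_def misled_def ..
  then have "query_error s l pw = (bit_error w A k n d p s l pw 1 U + bit_error w A k n d p s l pw 0 U) / 2" for l pw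
    by (simp add: query_error_def)
  with ert_scaled_imp_le[of w "search k N A" "\<lambda>m. of_bool (\<exists>l<k. m 2 l \<noteq> s l)" "ov_input k n d U",
      OF ert_search[OF s]] show ?thesis
    by (simp add: of_nat_less_top)
qed

lemma (in reduction) search_time_le:
  "expected_time (exec w (search k N A) (ov_input k n d U, 0)) \<le> of_nat search_cost"
proof (rule expected_time_le)
  show "ert w (search k N A) (\<lambda>_. 0) (ov_input k n d U) \<le> of_nat search_cost"
    \<comment> \<open>Weight 0 on errors leaves only the time, and \<open>1 \<le> n\<close> makes
      the constant 0 an admissible \<open>s\<close>.\<close>
    using ert_search[of "\<lambda>_. 0" 0] n by simp
qed (simp add: of_nat_less_top)

lemma (in reduction) search_lossless: "lossless_spmf (exec w (search k N A) (ov_input k n d U, 0))"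
  using search_time_le of_nat_less_top by (auto simp: expected_time_def top_unique split: if_splits)

text \<open>Whatever the bit of \<open>s l\<close> is, one value of the coin spares that row and the
  other one resamples it. So each of the two decision errors occurs exactly once.\<close>

lemma plant_bit_error:
  fixes p :: real and n d :: nat
  assumes k: "1 \<le> k" and p: "0 \<le> p" "p \<le> 1 / 2" and s: "\<And>l. l < k \<Longrightarrow> s l < n" and l: "l < k"
  defines "M \<equiv> coin_matrices k p n d"
  defines "P \<equiv> bind_pmf M (\<lambda>U. plant k p d U s)"
  shows "(\<integral>\<^sup>+U. (bit_error w A k n d p s l pw 1 U + bit_error w A k n d p s l pw 0 U) / 2 \<partial>P) =
    ((\<integral>\<^sup>+V. decision_error w A k n d True V \<partial>P) + (\<integral>\<^sup>+V. decision_error w A k n d False V \<partial>M)) / 2"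
proof -
  define bit where "bit = s l div pw mod 2"
  have bit: "bit = 0 \<or> bit = 1" by (auto simp: bit_def)
  have int: "(\<integral>\<^sup>+U. bit_error w A k n d p s l pw c U \<partial>P) =
      (\<integral>\<^sup>+V. decision_error w A k n d (c = bit) V \<partial>bind_pmf P (resample k p n d l (row_class pw c)))" for c
    by (simp add: bit_error_def bit_def)
  have miss: "(\<integral>\<^sup>+U. bit_error w A k n d p s l pw bit U \<partial>P) = (\<integral>\<^sup>+V. decision_error w A k n d True V \<partial>P)"
    unfolding int unfolding P_def M_def
    by (subst resample_plant_miss[OF k p s]) (simp_all add: row_class_def bit_def)
  have hit: "(\<integral>\<^sup>+U. bit_error w A k n d p s l pw c U \<partial>P) = (\<integral>\<^sup>+V. decision_error w A k n d False V \<partial>M)"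
    if "c \<noteq> bit" for c
    using that unfolding int unfolding P_def M_def
    by (subst resample_plant_hit[OF k p s l]) (auto simp: row_class_def bit_def)
  have "(\<integral>\<^sup>+U. (bit_error w A k n d p s l pw 1 U + bit_error w A k n d p s l pw 0 U) / 2 \<partial>P) =
      ((\<integral>\<^sup>+U. bit_error w A k n d p s l pw 1 U \<partial>P) + (\<integral>\<^sup>+U. bit_error w A k n d p s l pw 0 U \<partial>P)) / 2"
    by (simp add: nn_integral_divide nn_integral_add)
  then show ?thesis using bit miss hit[of "1 - bit"] by (auto simp: add.commute)
qed

text \<open>For fixed \<open>s\<close> all \<open>k * q\<close> queries have the same expected
  error, so the sum over queries is a multiple of one term. Only then is \<open>s\<close> averaged,
  matching the premise \<open>e1\<close>, which is itself an average.\<close>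

lemma planted_search_error:
  fixes p :: real and \<delta> :: ennreal
  assumes k: "1 \<le> k" and p: "0 \<le> p" "p \<le> 1 / 2" and n: "1 \<le> n"
    and red: "reduction k N n d X p A T q"
  defines "w \<equiv> binary_digit p" and "M \<equiv> coin_matrices k p n d"
    and "I \<equiv> pmf_of_set (PiE {..<k} (\<lambda>_. {..<n}))"
  assumes e1: "(\<integral>\<^sup>+s. \<integral>\<^sup>+V. decision_error w A k n d True V \<partial>bind_pmf M (\<lambda>U. plant k p d U s) \<partial>I) \<le> \<delta>"
    and e0: "(\<integral>\<^sup>+V. decision_error w A k n d False V \<partial>M) \<le> \<delta>"
  shows "(\<integral>\<^sup>+s. \<integral>\<^sup>+U. expc (\<lambda>\<sigma>. of_bool (\<exists>l<k. fst \<sigma> 2 l \<noteq> s l)) (exec w (search k N A) (ov_input k n d U, 0))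
      \<partial>bind_pmf M (\<lambda>U. plant k p d U s) \<partial>I) \<le> of_nat (k * q) * \<delta>"
proof -
  have "finite (PiE {..<k} (\<lambda>_. {..<n}))" "PiE {..<k} (\<lambda>_. {..<n}) \<noteq> {}"
    using n by (auto intro!: finite_PiE simp: PiE_eq_empty_iff lessThan_empty_iff)
  then have s: "s l < n" if "s \<in> set_pmf I" "l < k" for s l
    using that by (auto simp: I_def)
  let ?P = "\<lambda>s. bind_pmf M (\<lambda>U. plant k p d U s)"
  let ?e1 = "\<lambda>s. \<integral>\<^sup>+V. decision_error w A k n d True V \<partial>?P s"
  let ?e0 = "\<integral>\<^sup>+V. decision_error w A k n d False V \<partial>M"
  have "(\<integral>\<^sup>+s. \<integral>\<^sup>+U. expc (\<lambda>\<sigma>. of_bool (\<exists>l<k. fst \<sigma> 2 l \<noteq> s l)) (exec w (search k N A) (ov_input k n d U, 0))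
      \<partial>?P s \<partial>I) \<le> (\<integral>\<^sup>+s. of_nat (k * q) * ((?e1 s + ?e0) / 2) \<partial>I)"
  proof (intro nn_integral_mono_AE, unfold AE_measure_pmf_iff, safe)
    fix s assume "s \<in> set_pmf I"
    note s' = s[OF this]
    have "(\<integral>\<^sup>+U. expc (\<lambda>\<sigma>. of_bool (\<exists>l<k. fst \<sigma> 2 l \<noteq> s l)) (exec w (search k N A) (ov_input k n d U, 0)) \<partial>?P s) \<le>
      (\<integral>\<^sup>+U. (\<Sum>l<k. \<Sum>b<q. (bit_error w A k n d p s l (2 ^ b) 1 U + bit_error w A k n d p s l (2 ^ b) 0 U) / 2) \<partial>?P s)"
      unfolding w_def by (rule nn_integral_mono, rule reduction.search_error_le[OF red s'])
    also have "\<dots> = (\<Sum>l<k. \<Sum>b<q. \<integral>\<^sup>+U. (bit_error w A k n d p s l (2 ^ b) 1 U + bit_error w A k n d p s l (2 ^ b) 0 U) / 2 \<partial>?P s)"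
      by (simp add: nn_integral_sum del: nn_integral_bind_pmf)
    also have "\<dots> = (\<Sum>l<k. \<Sum>b<q. (?e1 s + ?e0) / 2)"
      unfolding M_def by (intro sum.cong refl, rule plant_bit_error[OF k p s']) simp_all
    also have "\<dots> = of_nat (k * q) * ((?e1 s + ?e0) / 2)"
      by (simp add: mult.assoc)
    finally show "(\<integral>\<^sup>+U. expc (\<lambda>\<sigma>. of_bool (\<exists>l<k. fst \<sigma> 2 l \<noteq> s l)) (exec w (search k N A) (ov_input k n d U, 0)) \<partial>?P s)
      \<le> of_nat (k * q) * ((?e1 s + ?e0) / 2)" .
  qed
  also have "\<dots> = of_nat (k * q) * (((\<integral>\<^sup>+s. ?e1 s \<partial>I) + ?e0) / 2)"
    by (simp add: nn_integral_cmult nn_integral_divide nn_integral_add del: nn_integral_bind_pmf)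
  also have "\<dots> \<le> of_nat (k * q) * ((\<delta> + \<delta>) / 2)"
    by (intro mult_left_mono divide_right_mono_ennreal add_mono e1 e0) simp
  also have "(\<delta> + \<delta>) / 2 = \<delta>"
    by (simp add: mult_2[symmetric] ennreal_mult_divide_eq mult.commute[of 2])
  finally show ?thesis .
qed

lemma ennreal_spmf_bind_map_True:
  "ennreal (spmf (bind_spmf (spmf_of_pmf K) (\<lambda>U. map_spmf (Q U) (f U))) True) =
    (\<integral>\<^sup>+U. \<integral>\<^sup>+\<sigma>. of_bool (Q U \<sigma>) \<partial>measure_spmf (f U) \<partial>K)"
proof -
  have "ennreal (spmf (map_spmf (Q U) (f U)) True) = (\<integral>\<^sup>+\<sigma>. of_bool (Q U \<sigma>) \<partial>measure_spmf (f U))" for U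
  proof -
    have "ennreal (spmf (map_spmf (Q U) (f U)) True) = emeasure (measure_spmf (f U)) (Q U -` {True})"
      by (rule ennreal_spmf_map)
    also have "\<dots> = (\<integral>\<^sup>+\<sigma>. indicator (Q U -` {True}) \<sigma> \<partial>measure_spmf (f U))" by simp
    also have "\<dots> = (\<integral>\<^sup>+\<sigma>. of_bool (Q U \<sigma>) \<partial>measure_spmf (f U))"
      by (intro nn_integral_cong) (auto simp: indicator_def)
    finally show ?thesis .
  qed
  then show ?thesis by (simp add: ennreal_pmf_bind)
qed

text \<open>Diverging mass would be neither success nor error; losslessness rules it out.\<close>

lemma success_error_sum:
  assumes "\<And>U. lossless_spmf (f U)"
  shows "ennreal (spmf (bind_spmf (spmf_of_pmf K) (\<lambda>U. map_spmf (Q U) (f U))) True) +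
    (\<integral>\<^sup>+U. \<integral>\<^sup>+\<sigma>. of_bool (\<not> Q U \<sigma>) \<partial>measure_spmf (f U) \<partial>K) = 1"
proof -
  have "ennreal (spmf (bind_spmf (spmf_of_pmf K) (\<lambda>U. map_spmf (Q U) (f U))) True) +
    (\<integral>\<^sup>+U. \<integral>\<^sup>+\<sigma>. of_bool (\<not> Q U \<sigma>) \<partial>measure_spmf (f U) \<partial>K) =
    (\<integral>\<^sup>+U. \<integral>\<^sup>+\<sigma>. of_bool (Q U \<sigma>) + of_bool (\<not> Q U \<sigma>) \<partial>measure_spmf (f U) \<partial>K)"
    unfolding ennreal_spmf_bind_map_True by (simp add: nn_integral_add)
  also have "\<dots> = (\<integral>\<^sup>+U. \<integral>\<^sup>+\<sigma>. 1 \<partial>measure_spmf (f U) \<partial>K)"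
    by (intro nn_integral_cong) simp
  also have "\<dots> = (\<integral>\<^sup>+U. expc (\<lambda>_. 0 + 1) (f U) \<partial>K)"
    by (simp add: expc_lossless[OF assms])
  also have "\<dots> = (\<integral>\<^sup>+U. expc (\<lambda>_. 0) (f U) + 1 \<partial>K)"
    unfolding expc_add_const ..
  finally show ?thesis by (simp add: expc_lossless[OF assms])
qed

lemma ennreal_complement:
  assumes "ennreal P + E = 1" "0 \<le> P"
  shows "E = ennreal (1 - P)"
proof -
  have "E \<noteq> \<top>" using assms(1) by auto
  then obtain e where e: "E = ennreal e" "e \<ge> 0" by (cases E) auto
  have "ennreal (P + e) = ennreal 1" using assms e by simp
  then have "P + e = 1" using assms(2) e(2) by (subst (asm) ennreal_inj) simp_all
  then show ?thesis using e by (auto simp: algebra_simps)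
qed

lemma error_le_of_success_ge:
  fixes K :: "'a pmf"
  assumes "\<And>U. lossless_spmf (f U)"
    and "spmf (bind_spmf (spmf_of_pmf K) (\<lambda>U. map_spmf (Q U) (f U))) True \<ge> 1 - \<delta>"
  shows "(\<integral>\<^sup>+U. \<integral>\<^sup>+\<sigma>. of_bool (\<not> Q U \<sigma>) \<partial>measure_spmf (f U) \<partial>K) \<le> ennreal \<delta>"
  unfolding ennreal_complement[OF success_error_sum[OF assms(1)] pmf_nonneg]
  using assms(2) by (intro ennreal_leI) linarith

lemma success_ge_of_error_le:
  fixes K :: "'a pmf"
  assumes "\<And>U. lossless_spmf (f U)"
    and "(\<integral>\<^sup>+U. \<integral>\<^sup>+\<sigma>. of_bool (\<not> Q U \<sigma>) \<partial>measure_spmf (f U) \<partial>K) \<le> ennreal \<delta>" "0 \<le> \<delta>"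
  shows "spmf (bind_spmf (spmf_of_pmf K) (\<lambda>U. map_spmf (Q U) (f U))) True \<ge> 1 - \<delta>"
proof -
  have "ennreal (1 - spmf (bind_spmf (spmf_of_pmf K) (\<lambda>U. map_spmf (Q U) (f U))) True) \<le> ennreal \<delta>"
    using assms(2) unfolding ennreal_complement[OF success_error_sum[OF assms(1)] pmf_nonneg] .
  then show ?thesis using assms(3) by (subst (asm) ennreal_le_iff) auto
qed

section \<open>Polylogarithmic bounds\<close>

lemma polylog_mono:
  assumes "polylog g" "\<forall>\<^sub>F n in sequentially. norm (f n) \<le> norm (g n)"
  shows "polylog f"
proof -
  from assms(1) obtain c where "g \<in> O(\<lambda>n. ln (real n) ^ c)" by (auto simp: polylog_def)
  moreover have "f \<in> O(g)" using assms(2) by (rule landau_o.big_mono)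
  ultimately have "f \<in> O(\<lambda>n. ln (real n) ^ c)" by (rule landau_o.big_trans[rotated])
  then show ?thesis unfolding polylog_def ..
qed

lemma polylog_const: "polylog (\<lambda>_. a)"
  unfolding polylog_def by (intro exI[of _ 0]) simp

lemma polylog_ln: "polylog (\<lambda>n. ln (real n))"
  unfolding polylog_def by (intro exI[of _ 1]) simp

lemma polylog_mult:
  assumes "polylog f" "polylog g"
  shows "polylog (\<lambda>n. f n * g n)"
proof -
  from assms obtain a b where "f \<in> O(\<lambda>n. ln (real n) ^ a)" "g \<in> O(\<lambda>n. ln (real n) ^ b)"
    by (auto simp: polylog_def)
  then have "(\<lambda>n. f n * g n) \<in> O(\<lambda>n. ln (real n) ^ a * ln (real n) ^ b)"
    by (rule landau_o.big.mult)
  then have "(\<lambda>n. f n * g n) \<in> O(\<lambda>n. ln (real n) ^ (a + b))"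
    by (simp only: power_add)
  then show ?thesis unfolding polylog_def ..
qed

lemma eventually_ln_ge_1: "\<forall>\<^sub>F n in sequentially. 1 \<le> ln (real n)"
  using filterlim_compose[OF ln_at_top filterlim_real_sequentially]
  by (simp add: filterlim_at_top)

lemma polylog_add:
  assumes "polylog f" "polylog g"
  shows "polylog (\<lambda>n. f n + g n)"
proof -
  from assms obtain a b where f: "f \<in> O(\<lambda>n. ln (real n) ^ a)" and g: "g \<in> O(\<lambda>n. ln (real n) ^ b)"
    by (auto simp: polylog_def)
  \<comment> \<open>Raising the exponent increases the power once \<open>ln n\<close> is at least
    1.\<close>
  have mono: "(\<lambda>n. ln (real n) ^ i) \<in> O(\<lambda>n. ln (real n) ^ j)" if "i \<le> j" for i j
    by (rule landau_o.big_mono, rule eventually_mono[OF eventually_ln_ge_1])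
      (use that in \<open>auto intro: power_increasing\<close>)
  have "f \<in> O(\<lambda>n. ln (real n) ^ max a b)" "g \<in> O(\<lambda>n. ln (real n) ^ max a b)"
    using landau_o.big_trans[OF f mono] landau_o.big_trans[OF g mono] by simp_all
  then have "(\<lambda>n. f n + g n) \<in> O(\<lambda>n. ln (real n) ^ max a b)" by (rule sum_in_bigo)
  then show ?thesis unfolding polylog_def ..
qed

lemma polylog_log: "polylog (\<lambda>n. log 2 (real n))"
  using polylog_mult[OF polylog_ln polylog_const[of "1 / ln 2"]] by (simp add: log_def)

lemma soft_O_polylog:
  assumes "polylog h" "\<forall>\<^sub>F n in sequentially. norm (f n) \<le> norm (g n * h n)"
  shows "f \<in> soft_O g"
proof -
  from assms(1) obtain c where "h \<in> O(\<lambda>n. ln (real n) ^ c)" by (auto simp: polylog_def)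
  then have "(\<lambda>n. g n * h n) \<in> O(\<lambda>n. g n * ln (real n) ^ c)"
    by (intro landau_o.big.mult) simp_all
  moreover have "f \<in> O(\<lambda>n. g n * h n)" using assms(2) by (rule landau_o.big_mono)
  ultimately have "f \<in> O(\<lambda>n. g n * ln (real n) ^ c)" by (rule landau_o.big_trans[rotated])
  then show ?thesis unfolding soft_O_def by blast
qed

lemma bits_mult: "bits (a * b) \<le> bits a + bits b"
proof (cases "a * b = 0")
  case True
  then show ?thesis by (metis bits_0 bits_pos(2) One_nat_def trans_le_add1)
next
  case False
  have "2 ^ floor_log (a * b) \<le> a * b" using False by (intro floor_log_exp2_le) simp
  also have "\<dots> < 2 ^ bits a * 2 ^ bits b"
    by (intro mult_strict_mono less_exp_bits) simp_all
  also have "\<dots> = 2 ^ (bits a + bits b)" by (simp add: power_add)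
  finally have "floor_log (a * b) < bits a + bits b" by simp
  then show ?thesis by (simp add: bits_def[of "a * b"])
qed

lemma bits_le_log: "1 \<le> n \<Longrightarrow> real (bits n) \<le> log 2 (real n) + 1"
proof -
  assume n: "1 \<le> n"
  have "2 ^ floor_log n \<le> n" using n by (intro floor_log_exp2_le) simp
  then have "real (2 ^ floor_log n) \<le> real n" by (rule of_nat_mono)
  then have "2 powr real (floor_log n) \<le> real n" by (simp add: powr_realpow)
  then have "real (floor_log n) \<le> log 2 (real n)" using n by (subst le_log_iff) simp_all
  then show ?thesis by (simp add: bits_def)
qed

text \<open>The product form isolates the only large factor \<open>sz + 1 + T\<close>; for fixed
  \<open>k\<close> and \<open>N\<close> the others will be polylogarithmic.\<close>

lemma (in reduction) search_cost_le:
  "search_cost \<le> 40000 * ((k + 1) * ((q + 1) * ((N + 1) * (sz + 1 + T) * L)))"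
proof -
  define Z where "Z = (N + 1) * (sz + 1 + T) * L"
  define Y where "Y = (k + 1) * ((q + 1) * Z)"
  have xL: "x * L \<le> Z" if "x \<le> sz + 1 + T" for x
  proof -
    have "x * L \<le> (sz + 1 + T) * L" by (rule mult_le_mono1[OF that])
    also have "\<dots> = 1 * (sz + 1 + T) * L" by simp
    also have "\<dots> \<le> Z" unfolding Z_def by (intro mult_le_mono) simp_all
    finally show ?thesis .
  qed
  have Z: "(sz + 1) * L \<le> Z" "L \<le> Z" "T \<le> Z" "1 \<le> Z" "N \<le> Z"
  proof -
    show "(sz + 1) * L \<le> Z" "L \<le> Z" using xL[of "sz + 1"] xL[of 1] by simp_all
    show "T \<le> Z" using xL[of T] mult_le_mono2[OF L_pos, of T] by linarith
    show "1 \<le> Z" using \<open>L \<le> Z\<close> L_pos by linarith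
    have "N * 1 * 1 \<le> (N + 1) * (sz + 1 + T) * L" by (intro mult_le_mono) simp_all
    then show "N \<le> Z" by (simp add: Z_def)
  qed
  \<comment> \<open>31004 is 1000 + 1 + 30000 + 3, one summand for each term of
    \<open>query_cost\<close>.\<close>
  have query: "query_cost \<le> 31004 * Z"
    using Z unfolding query_cost_def fill_cost_def mult.left_commute[of _ 30000] by linarith
  have "block_cost \<le> q * (31004 * Z + 30 * Z) + 40 * Z"
    unfolding block_cost_def using query Z by (intro add_mono mult_le_mono) simp_all
  also have "\<dots> \<le> 31034 * ((q + 1) * Z)" by (simp add: algebra_simps)
  finally have block: "block_cost \<le> 31034 * ((q + 1) * Z)" .
  have Y: "Z \<le> Y" "k * ((q + 1) * Z) \<le> Y" "k * Z \<le> Y"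
  proof -
    have "1 * (1 * Z) \<le> Y" unfolding Y_def by (intro mult_le_mono) simp_all
    then show "Z \<le> Y" by simp
    show "k * ((q + 1) * Z) \<le> Y" unfolding Y_def by (intro mult_le_mono1) simp
    have "k * (1 * Z) \<le> Y" unfolding Y_def by (intro mult_le_mono) simp_all
    then show "k * Z \<le> Y" by simp
  qed
  have "save_cost \<le> 400 * Z" using Z unfolding save_cost_def mult.left_commute[of _ 300] by linarith
  moreover have "k * block_cost \<le> 31034 * (k * ((q + 1) * Z))"
    using mult_le_mono2[OF block, of k] by (simp add: algebra_simps)
  moreover have "k * (10 * L) \<le> 10 * (k * Z)"
    using mult_le_mono2[OF Z(2), of "10 * k"] by (simp add: algebra_simps)
  ultimately have "search_cost \<le> 40000 * Y"
    unfolding search_cost_def using Y Z(4) by linarith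
  then show ?thesis by (simp only: Y_def Z_def)
qed

section \<open>Choice of parameters and asymptotics\<close>

theorem theorem11:
  fixes k :: nat and \<alpha> \<delta> :: "nat \<Rightarrow> real" and T :: "nat \<Rightarrow> nat" and A_decide :: com
  assumes "k \<ge> 2"
    and "polylog \<alpha>"
    and "filterlim \<alpha> at_top sequentially"
    and "solves_decision k \<alpha> A_decide (\<lambda>n. 1 - \<delta> n)"
    and "runs_in_time k \<alpha> A_decide T"
  shows "\<exists>A_search T'.
           solves_search k \<alpha> A_search
             (\<lambda>n. 1 - real k * real_of_int \<lceil>log 2 (real n)\<rceil> * \<delta> n) \<and>
           runs_in_expected_time k \<alpha> A_search T' \<and>
           T' \<in> soft_O (\<lambda>n. real (T n) + real n)"
proof -
  obtain N0 where N0: "uses (\<lambda>a. a < N0) A_decide" using uses_bounded by blast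
  \<comment> \<open>Arrays 0 to 2 carry input and output and belong to the decision program even if
    its text does not name them.\<close>
  define N where "N = max 3 N0"
  have N: "3 \<le> N" "uses (\<lambda>a. a < N) A_decide" using N0 by (auto simp: N_def intro: uses_le)
  define A where "A = search k N A_decide"
  define p where "p n = ov_prob k \<alpha> n" for n
  define d where "d n = ov_dim \<alpha> n" for n
  define q where "q n = nat \<lceil>log 2 (real n)\<rceil>" for n
  define X where "X n = 2 * (k + 1) * ((n + 1) * (d n + 1))" for n
  define B where "B n = 40000 * ((k + 1) * ((q n + 1) * ((N + 1) * (k * n * d n + 1 + T n) * bits (X n))))" for n

  \<comment> \<open>The growth of \<alpha> drives \<open>p\<close> to 0 and so below 1/2, as
    planting requires.\<close>
  have "((\<lambda>n. - 2 * real k / \<alpha> n) \<longlongrightarrow> 0) sequentially"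
    by (rule tendsto_divide_0[OF tendsto_const filterlim_at_top_imp_at_infinity[OF assms(3)]])
  then have "((\<lambda>n. 1 - 2 powr (- 2 * real k / \<alpha> n)) \<longlongrightarrow> 1 - 2 powr 0) sequentially"
    by (intro tendsto_intros) simp_all
  \<comment> \<open>The base of \<open>powr\<close> tends to 0, where the continuity rule used asks
    for nonnegative values.\<close>
  moreover have "\<forall>\<^sub>F n in sequentially. 0 < \<alpha> n"
    using assms(3) by (simp add: filterlim_at_top_dense)
  then have "\<forall>\<^sub>F n in sequentially. 0 \<le> 1 - 2 powr (- 2 * real k / \<alpha> n)"
  proof eventually_elim
    case (elim n)
    then have "2 powr (- 2 * real k / \<alpha> n) \<le> 2 powr 0" by (intro powr_mono) simp_all
    then show ?case by simp
  qed
  ultimately have "((\<lambda>n. p n) \<longlongrightarrow> (1 - 2 powr 0) powr (1 / real k)) sequentially"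
    unfolding p_def ov_prob_def using assms(1) by (intro tendsto_powr2 tendsto_const) simp_all
  then have "(p \<longlongrightarrow> 0) sequentially" by simp
  then have p_small: "\<forall>\<^sub>F n in sequentially. p n < 1 / 2"
    by (rule order_tendstoD) simp
  have p_nonneg: "0 \<le> p n" for n by (simp add: p_def ov_prob_def)

  have red: "reduction k N n (d n) (X n) (p n) A_decide (T n) (q n)"
    if n: "1 \<le> n" and p: "p n < 1 / 2" and T: "\<And>U. lossless_spmf (run k \<alpha> A_decide n U) \<and>
      (\<forall>\<sigma>\<in>set_spmf (run k \<alpha> A_decide n U). snd \<sigma> \<le> T n)" for n
  proof unfold_locales
    show "3 \<le> N" "0 \<le> p n" "p n < 1" "uses (\<lambda>a. a < N) A_decide" "1 \<le> n"
      using N p_nonneg p n by simp_all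
    show "2 \<le> X n" "k \<le> X n" "2 * n \<le> X n" "d n \<le> X n" "k * n * d n \<le> X n"
      by (simp_all add: X_def algebra_simps)
    show "lossless_spmf (exec (binary_digit (p n)) A_decide (ov_input k n (d n) V, 0))" for V
      using T[of V] by (simp add: run_def p_def d_def)
    show "\<sigma> \<in> set_spmf (exec (binary_digit (p n)) A_decide (ov_input k n (d n) V, 0)) \<Longrightarrow> snd \<sigma> \<le> T n" for V \<sigma>
      using T[of V] by (simp add: run_def p_def d_def)
    have "log 2 (real n) \<le> real (q n)" using n by (simp add: q_def)
    then have "real n \<le> 2 powr real (q n)" using n by (subst (asm) log_le_iff) simp_all
    then have "real n \<le> real (2 ^ q n)" by (simp add: powr_realpow)
    then show "n \<le> 2 ^ q n" by (simp only: of_nat_le_iff)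
    fix b assume "b < q n"
    then have "real b < log 2 (real n)" unfolding q_def by linarith
    then have "2 powr real b < real n" using n by (subst (asm) less_log_iff) simp_all
    then have "real (2 ^ b) < real n" by (simp add: powr_realpow)
    then show "2 ^ b < n" by (simp only: of_nat_less_iff)
  qed

  have large: "\<forall>\<^sub>F n in sequentially. reduction k N n (d n) (X n) (p n) A_decide (T n) (q n) \<and> p n < 1 / 2 \<and> 1 \<le> n"
    using p_small assms(5)[unfolded runs_in_time_def] eventually_ge_at_top[of 1]
    by eventually_elim (use red in blast)

  have run_A: "run k \<alpha> A n U = exec (binary_digit (p n)) (search k N A_decide) (ov_input k n (d n) U, 0)" for n U
    by (simp add: run_def A_def p_def d_def)

  have "runs_in_expected_time k \<alpha> A (\<lambda>n. real (B n))"
    unfolding runs_in_expected_time_def using large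
  proof eventually_elim
    case (elim n)
    then interpret reduction k N n "d n" "X n" "p n" A_decide "T n" U "q n" for U by simp
    show ?case
      unfolding run_A ennreal_of_nat_eq_real_of_nat[symmetric]
      using search_time_le search_cost_le unfolding B_def by (meson of_nat_mono order_trans)
  qed

  moreover have "solves_search k \<alpha> A (\<lambda>n. 1 - real k * real_of_int \<lceil>log 2 (real n)\<rceil> * \<delta> n)"
    unfolding solves_search_def
    using large assms(4)[unfolded solves_decision_def, rule_format, of True]
      assms(4)[unfolded solves_decision_def, rule_format, of False]
  proof eventually_elim
    case (elim n)
    have red: "reduction k N n (d n) (X n) (p n) A_decide (T n) (q n)" and p_half: "p n \<le> 1 / 2" and n1: "1 \<le> n"
      using elim(1) by auto
    interpret reduction k N n "d n" "X n" "p n" A_decide "T n" U "q n" for U by (rule red)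
    have "0 \<le> log 2 (real n)" using n1 by simp
    then have rounds: "0 \<le> \<lceil>log 2 (real n)\<rceil>" unfolding le_ceiling_iff by simp
    have k1: "1 \<le> k" using assms(1) by simp
    define M where "M = coin_matrices k (p n) n (d n)"
    define I where "I = pmf_of_set (PiE {..<k} (\<lambda>_. {..<n}))"
    define P where "P s = bind_pmf M (\<lambda>U. plant k (p n) (d n) U s)" for s
    have model: "model_kov k \<alpha> n = M"
      by (simp add: model_kov_def M_def coin_matrices_def cells_def p_def d_def)
    \<comment> \<open>The planted position is drawn first, so that errors can be analysed for fixed
      \<open>s\<close>.\<close>
    have planted: "planted_kov k \<alpha> n = bind_pmf I P"
      unfolding planted_kov_def model P_def I_def p_def[symmetric] d_def[symmetric]
      by (rule bind_commute_pmf)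
    have run: "run k \<alpha> A_decide n V = run_A V" for V
      by (simp add: run_def p_def d_def)
    \<comment> \<open>A success probability is at most 1, which forces \<delta> to be nonnegative
      here.\<close>
    have "1 - \<delta> n \<le> 1" by (rule order_trans[OF elim(2) pmf_le_1])
    then have \<delta>: "0 \<le> \<delta> n" by simp
    have err: "(\<integral>\<^sup>+V. decision_error w A_decide k n (d n) b V \<partial>kov b k \<alpha> n) \<le> ennreal (\<delta> n)" for b
    proof -
      have "(\<integral>\<^sup>+V. decision_error w A_decide k n (d n) b V \<partial>kov b k \<alpha> n) \<le>
          (\<integral>\<^sup>+V. \<integral>\<^sup>+\<sigma>. of_bool (\<not> ov_output \<sigma> 0 = of_bool b) \<partial>measure_spmf (run_A V) \<partial>kov b k \<alpha> n)"
        unfolding decision_error_def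
        by (intro nn_integral_mono) (auto simp: ov_output_def)
      also have "\<dots> \<le> ennreal (\<delta> n)"
        by (rule error_le_of_success_ge[OF lossless]) (use elim in \<open>cases b; simp add: run\<close>)
      finally show ?thesis .
    qed
    have "(\<integral>\<^sup>+U. \<integral>\<^sup>+\<sigma>. of_bool (\<not> ((\<forall>l<k. ov_output \<sigma> l < n) \<and> orthogonal_rows k (ov_dim \<alpha> n) U (ov_output \<sigma>)))
        \<partial>measure_spmf (run k \<alpha> A n U) \<partial>planted_kov k \<alpha> n) =
      (\<integral>\<^sup>+s. \<integral>\<^sup>+U. expc (\<lambda>\<sigma>. of_bool (\<not> ((\<forall>l<k. ov_output \<sigma> l < n) \<and> orthogonal_rows k (d n) U (ov_output \<sigma>))))
        (exec w (search k N A_decide) (ov_input k n (d n) U, 0)) \<partial>P s \<partial>I)"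
      unfolding planted run_A d_def[symmetric] by (simp add: expc_lossless[OF search_lossless])
    \<comment> \<open>Returning exactly the planted rows is enough, since these are orthogonal with
      certainty.\<close>
    also have "\<dots> \<le> (\<integral>\<^sup>+s. \<integral>\<^sup>+U. expc (\<lambda>\<sigma>. of_bool (\<exists>l<k. fst \<sigma> 2 l \<noteq> s l))
        (exec w (search k N A_decide) (ov_input k n (d n) U, 0)) \<partial>P s \<partial>I)"
    proof (intro nn_integral_mono_AE, unfold AE_measure_pmf_iff, intro ballI,
        intro nn_integral_mono_AE, unfold AE_measure_pmf_iff, intro ballI, rule expc_mono)
      fix s U \<sigma> assume "s \<in> set_pmf I" "U \<in> set_pmf (P s)"
      have "finite (PiE {..<k} (\<lambda>_. {..<n}))" "PiE {..<k} (\<lambda>_. {..<n}) \<noteq> {}"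
        using n by (auto intro!: finite_PiE simp: PiE_eq_empty_iff lessThan_empty_iff)
      with \<open>s \<in> set_pmf I\<close> have s: "s l < n" if "l < k" for l using that by (auto simp: I_def)
      have orth: "orthogonal_rows k (d n) U s"
        using \<open>U \<in> set_pmf (P s)\<close> plant_orthogonal[OF k1 p_nonneg p_half s] by (auto simp: P_def)
      have "(\<forall>l<k. ov_output \<sigma> l < n) \<and> orthogonal_rows k (d n) U (ov_output \<sigma>)"
        if "\<forall>l<k. fst \<sigma> 2 l = s l"
        using that s orth by (simp add: orthogonal_rows_def ov_output_def)
      then show "of_bool (\<not> ((\<forall>l<k. ov_output \<sigma> l < n) \<and> orthogonal_rows k (d n) U (ov_output \<sigma>))) \<le>
          (of_bool (\<exists>l<k. fst \<sigma> 2 l \<noteq> s l) :: ennreal)"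
        by (cases "\<exists>l<k. fst \<sigma> 2 l \<noteq> s l") auto
    qed
    also have "\<dots> \<le> of_nat (k * q n) * ennreal (\<delta> n)"
      unfolding P_def M_def I_def
      by (rule planted_search_error[OF k1 p_nonneg p_half n1 red])
        (use err[of True] err[of False] in \<open>simp_all add: kov_def model planted P_def M_def I_def\<close>)
    also have "\<dots> = ennreal (real k * real_of_int \<lceil>log 2 (real n)\<rceil> * \<delta> n)"
    proof -
      have "real (q n) = real_of_int \<lceil>log 2 (real n)\<rceil>" using rounds by (simp add: q_def)
      then show ?thesis
        using \<delta> rounds by (simp add: ennreal_of_nat_eq_real_of_nat ennreal_mult)
    qed
    finally show ?case
      by (rule success_ge_of_error_le[rotated])
        (use rounds \<delta> in \<open>simp_all add: run_A search_lossless\<close>)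
  qed

  moreover have "(\<lambda>n. real (B n)) \<in> soft_O (\<lambda>n. real (T n) + real n)"
  proof -
    have q_polylog: "polylog (\<lambda>n. real (q n) + 1)"
    proof (rule polylog_mono[OF polylog_add[OF polylog_log polylog_const[of 2]]])
      show "\<forall>\<^sub>F n in sequentially. norm (real (q n) + 1) \<le> norm (log 2 (real n) + 2)"
        using eventually_ge_at_top[of 1]
      proof eventually_elim
        case (elim n)
        then have "0 \<le> log 2 (real n)" by simp
        then show ?case unfolding q_def by simp linarith
      qed
    qed
    have d_polylog: "polylog (\<lambda>n. real (d n) + 1)"
    proof (rule polylog_mono[OF polylog_add[OF _ polylog_const[of 2]]])
      show "polylog (\<lambda>n. \<bar>\<alpha> n * log 2 (real n)\<bar>)"
        by (rule polylog_mono[OF polylog_mult[OF assms(2) polylog_log]]) simp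
      show "\<forall>\<^sub>F n in sequentially. norm (real (d n) + 1) \<le> norm (\<bar>\<alpha> n * log 2 (real n)\<bar> + 2)"
        by (intro always_eventually allI) (simp add: d_def ov_dim_def, linarith)
    qed
    have X_polylog: "polylog (\<lambda>n. real (bits (X n)))"
    proof (rule polylog_mono)
      show "polylog (\<lambda>n. (log 2 (real n) + real (bits (2 * (k + 1)))) + ((real (d n) + 1) + 3))"
        by (intro polylog_add polylog_log polylog_const d_polylog)
      show "\<forall>\<^sub>F n in sequentially. norm (real (bits (X n))) \<le>
          norm ((log 2 (real n) + real (bits (2 * (k + 1)))) + ((real (d n) + 1) + 3))"
        using eventually_ge_at_top[of 1]
      proof eventually_elim
        case (elim n)
        have "bits (X n) \<le> bits (2 * (k + 1)) + (bits (n + 1) + bits (d n + 1))"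
          unfolding X_def by (intro order_trans[OF bits_mult] add_left_mono bits_mult)
        \<comment> \<open>The crude linear bound on \<open>bits (d n + 1)\<close> suffices because
          \<open>d\<close> itself is polylogarithmic.\<close>
        also have "\<dots> \<le> bits (2 * (k + 1)) + (bits (2 * n) + (d n + 2))"
          using elim bits_le_Suc[of "d n + 1"] by (intro add_mono bits_mono order_refl) simp_all
        finally have "real (bits (X n)) \<le> real (bits (2 * (k + 1))) + (real (bits (2 * n)) + (real (d n) + 2))"
          by linarith
        moreover have "real (bits (2 * n)) \<le> log 2 (real n) + 2"
          using bits_le_log[of "2 * n"] elim by (simp add: log_mult)
        moreover have "0 \<le> log 2 (real n)" using elim by simp
        ultimately show ?case by simp
      qed
    qed
    let ?C = "40000 * (real k + 1) * ((real N + 1) * (real k + 1))"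
    show ?thesis
    proof (rule soft_O_polylog)
      show "polylog (\<lambda>n. ?C * ((real (q n) + 1) * ((real (d n) + 1) * real (bits (X n)))))"
        by (intro polylog_mult polylog_const q_polylog d_polylog X_polylog)
      show "\<forall>\<^sub>F n in sequentially. norm (real (B n)) \<le> norm ((real (T n) + real n) *
          (?C * ((real (q n) + 1) * ((real (d n) + 1) * real (bits (X n))))))"
        using eventually_ge_at_top[of 1]
      proof eventually_elim
        case (elim n)
        \<comment> \<open>This extracts the factor \<open>T n + n\<close>; as
          \<open>1 \<le> n\<close>, it also absorbs the summand 1.\<close>
        have "k * n * d n + 1 + T n \<le> (k + 1) * (d n + 1) * (T n + n)"
          using elim by (simp add: algebra_simps)
        then have "B n \<le> 40000 * ((k + 1) * ((q n + 1) * ((N + 1) * ((k + 1) * (d n + 1) * (T n + n)) * bits (X n))))"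
          unfolding B_def by (intro mult_le_mono order_refl)
        then have "real (B n) \<le> real (40000 * ((k + 1) * ((q n + 1) * ((N + 1) * ((k + 1) * (d n + 1) * (T n + n)) * bits (X n)))))"
          by (rule of_nat_mono)
        also have "\<dots> = (real (T n) + real n) *
          (?C * ((real (q n) + 1) * ((real (d n) + 1) * real (bits (X n)))))"
          by (simp only: of_nat_mult of_nat_add of_nat_1 of_nat_numeral mult_ac add_ac)
        finally show ?case unfolding real_norm_def by linarith
      qed
    qed
  qed
  ultimately show ?thesis by (intro exI[of _ A] exI[of _ "\<lambda>n. real (B n)"] conjI)
qed

end
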